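(* Let $p$ be a prime and let $g(\mathbf x)\in\mathbb Z_p[x_1^{\pm1},\dots,x_n^{\pm1}]$ be a Laurent polynomial such that $\mathbf 0$ is the only lattice point in the interior $\Delta^\circ$ of its Newton polytope $\Delta$. Put $f(\mathbf x)=1-t\,g(\mathbf x)$ with $t$ a further variable, let $\beta_p(t)\in\mathbb Z_p[t]$ be the constant term (in $\mathbf x$) of $f(\mathbf x)^{p-1}$, let $R$ be the $p$-adic completion of $\mathbb Z_p[t,\beta_p(t)^{-1}]$, with Frobenius lift $\sigma$ given by $t\mapsto t^p$, and let $$q(t)=\sum_{k\ge0}b_kt^k\in\mathbb Z_p[[t]],\qquad b_k=\text{constant term of }g(\mathbf x)^k .$$ Then, in $\mathbb Z_p[[t]]$, $$\frac{q(t)}{q(t^p)}=\Lambda,$$ where $\Lambda\in R$ is the (single entry) matrix of the Cartier operation $\mathscr C_p:Q_f(\Delta^\circ)\to Q_{f^\sigma}(\Delta^\circ)$, i.e. $\mathscr C_p(1/f)\equiv\Lambda\cdot 1/f^\sigma\ \mathrm{mod}\ U_{f^\sigma}(\Delta^\circ)$.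
   Context: $R$ is regarded as a subring of its $t$-adic completion $\mathbb Z_p[[t]]$ (note $\beta_p(0)=1$). Let $\mu=\Delta^\circ$. For $F\in\{f,f^\sigma\}$, where $f^\sigma=1-t^pg(\mathbf x)$ is $f$ with $\sigma$ applied to its coefficients, let $$\Omega_F(\mu)=\Big\{(k-1)!\frac{h(\mathbf x)}{F(\mathbf x)^k}:\ k\ge1,\ h\in R[x_1^{\pm1},\dots,x_n^{\pm1}],\ \mathrm{supp}(h)\subset k\mu\Big\},$$ and let $\widehat\Omega_F(\mu)$ be its $p$-adic completion. The Cartier operator $\mathscr C_p:\widehat\Omega_f(\mu)\to\widehat\Omega_{f^\sigma}(\mu)$ is the $R$-linear operator defined as follows. On Laurent polynomials put $\mathscr C_p(\sum a_{\mathbf k}\mathbf x^{\mathbf k})=\sum a_{p\mathbf k}\mathbf x^{\mathbf k}$. Write $f(\mathbf x)^p=f^\sigma(\mathbf x^p)+pG(\mathbf x)$ with $G$ a Laurent polynomial over $R$. For $k\ge1$ and $m=\lceil k/p\rceil$, $$\mathscr C_p\Big((k-1)!\frac{h}{f^k}\Big)=(k-1)!\sum_{r\ge0}\binom{-m}{r}p^r\,\frac{\mathscr C_p\big(h\,G^r f^{pm-k}\big)}{(f^\sigma)^{m+r}},$$ obtained by expanding $h/f^k=hf^{pm-k}/(f^\sigma(\mathbf x^p)+pG)^m$ $p$-adically; the existence of this operator on the completions is taken as known (convergence of the series is automatic for $p>2$). Equivalently, $\mathscr C_p$ acts on Laurent series expansions by $\sum a_{\mathbf k}\mathbf x^{\mathbf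 k}\mapsto\sum a_{p\mathbf k}\mathbf x^{\mathbf k}$. The same construction applies to $f^{\sigma^s}$ in place of $f$, and $\mathscr C_p^s$ denotes the composition $\widehat\Omega_F(\mu)\to\widehat\Omega_{F^{\sigma^s}}(\mu)$. Define $$U_F(\mu)=\{\omega\in\widehat\Omega_F(\mu):\ \mathscr C_p^s(\omega)\equiv0\ \mathrm{mod}\ p^s\widehat\Omega_{F^{\sigma^s}}(\mu)\text{ for all }s\ge1\},\qquad Q_F(\mu)=\widehat\Omega_F(\mu)/U_F(\mu).$$ It is known from earlier work that, since the $1\times1$ Hasse--Witt matrix $\beta_p(t)$ is invertible in $R$, $Q_f(\mu)$ and $Q_{f^\sigma}(\mu)$ are free $R$-modules of rank $1$ generated by the classes of $1/f$ and $1/f^\sigma$; this makes $\Lambda$ well defined.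
   Formalization: For p = 2 the Cartier operators on the completed modules of f and its Frobenius twists are assumed to exist (their defining series converge); this can fail, e.g. for g = x + 1/x, where the image of 1/f is not in the completion. For odd p nothing is added. *)

theory Defs
  imports "HOL-Analysis.Analysis" "HOL-Library.Poly_Mapping" "HOL-Library.Set_Algebras"
    "HOL-Computational_Algebra.Computational_Algebra" "Berlekamp_Zassenhaus.Finite_Field"
begin

section \<open>The ring of p-adic integers\<close>

text \<open>
  The prime is \<open>p = CARD('p)\<close> for a type \<open>'p\<close> of class \<^class>\<open>prime_card\<close>, so that
  \<open>\<int>\<^sub>p\<close> is a type, namely the inverse limit of the rings \<open>\<int>/p\<^sup>n\<close> (represented by the
  residues \<open>{0..<p\<^sup>n}\<close>).
\<close>

typedef ('p :: prime_card) padic_int =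
  "{x :: nat \<Rightarrow> int. \<forall>n. x n = x (Suc n) mod int CARD('p) ^ n}"
  by (rule exI[of _ "\<lambda>_. 0"]) simp

setup_lifting type_definition_padic_int

lemma mod_Suc_power_mod: "(a :: int) mod b ^ Suc n mod b ^ n = a mod b ^ n"
  by (rule mod_mod_cancel) simp

lemma Rep_padic_int_mod:
  "Rep_padic_int x n mod int CARD('p) ^ n = Rep_padic_int (x :: 'p::prime_card padic_int) n"
proof -
  have "Rep_padic_int x n = Rep_padic_int x (Suc n) mod int CARD('p) ^ n"
    using Rep_padic_int[of x] by blast
  then show ?thesis by simp
qed

instantiation padic_int :: (prime_card) comm_ring_1
begin

lift_definition zero_padic_int :: "'a padic_int" is "\<lambda>_. 0"
  by simp

lift_definition one_padic_int :: "'a padic_int" is "\<lambda>n. 1 mod int CARD('a) ^ n"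
  by (simp only: mod_Suc_power_mod)

lift_definition plus_padic_int :: "'a padic_int \<Rightarrow> 'a padic_int \<Rightarrow> 'a padic_int"
  is "\<lambda>x y n. (x n + y n) mod int CARD('a) ^ n"
  subgoal premises prems for x y n
  proof -
    have "x n = x (Suc n) mod int CARD('a) ^ n" "y n = y (Suc n) mod int CARD('a) ^ n"
      using prems by blast+
    then show ?thesis
      by (simp only: mod_Suc_power_mod mod_add_eq)
  qed
  done

lift_definition minus_padic_int :: "'a padic_int \<Rightarrow> 'a padic_int \<Rightarrow> 'a padic_int"
  is "\<lambda>x y n. (x n - y n) mod int CARD('a) ^ n"
  subgoal premises prems for x y n
  proof -
    have "x n = x (Suc n) mod int CARD('a) ^ n" "y n = y (Suc n) mod int CARD('a) ^ n"
      using prems by blast+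
    then show ?thesis
      by (simp only: mod_Suc_power_mod mod_diff_eq)
  qed
  done

lift_definition times_padic_int :: "'a padic_int \<Rightarrow> 'a padic_int \<Rightarrow> 'a padic_int"
  is "\<lambda>x y n. (x n * y n) mod int CARD('a) ^ n"
  subgoal premises prems for x y n
  proof -
    have "x n = x (Suc n) mod int CARD('a) ^ n" "y n = y (Suc n) mod int CARD('a) ^ n"
      using prems by blast+
    then show ?thesis
      by (simp only: mod_Suc_power_mod mod_mult_eq)
  qed
  done

lift_definition uminus_padic_int :: "'a padic_int \<Rightarrow> 'a padic_int"
  is "\<lambda>x n. (- x n) mod int CARD('a) ^ n"
  subgoal premises prems for x n
  proof -
    have "x n = x (Suc n) mod int CARD('a) ^ n"
      using prems by blast
    then show ?thesis
      by (simp only: mod_Suc_power_mod mod_minus_eq)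
  qed
  done

instance
proof
  fix a b c :: "'a padic_int"
  note rep = Rep_padic_int_inject[symmetric] fun_eq_iff zero_padic_int.rep_eq one_padic_int.rep_eq
    plus_padic_int.rep_eq minus_padic_int.rep_eq uminus_padic_int.rep_eq times_padic_int.rep_eq
    Rep_padic_int_mod mod_simps
  show "a + b + c = a + (b + c)"
    by (simp add: rep add.assoc)
  show "a + b = b + a"
    by (simp add: rep add.commute)
  show "0 + a = a"
    by (simp add: rep)
  show "- a + a = 0"
    by (simp add: rep)
  show "a - b = a + - b"
    by (simp add: rep)
  show "a * b * c = a * (b * c)"
    by (simp add: rep mult.assoc)
  show "a * b = b * a"
    by (simp add: rep mult.commute)
  show "1 * a = a"
    by (simp add: rep)
  show "(a + b) * c = a * c + b * c"
    by (simp add: rep distrib_right)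
  show "(0 :: 'a padic_int) \<noteq> 1"
  proof
    assume "(0 :: 'a padic_int) = 1"
    then have "Rep_padic_int (0 :: 'a padic_int) 1 = Rep_padic_int (1 :: 'a padic_int) 1"
      by simp
    moreover have "int CARD('a) > 1"
      using prime_card_int prime_gt_1_int by blast
    ultimately show False
      by (simp add: zero_padic_int.rep_eq one_padic_int.rep_eq)
  qed
qed

end


section \<open>Laurent polynomials and expansions in powers of t\<close>

text \<open>
  \<open>('n, 'p) laurent\<close> is \<open>\<int>\<^sub>p[x\<^sub>1\<^sup>\<plusminus>\<^sup>1, \<dots>, x\<^sub>n\<^sup>\<plusminus>\<^sup>1]\<close>. All rational functions \<open>h / F\<^sup>k\<close> occurring
  below live in \<open>\<int>\<^sub>p[x\<^sup>\<plusminus>\<^sup>1][[t]]\<close>: this ring contains \<open>R[x\<^sup>\<plusminus>\<^sup>1]\<close> for every subring \<open>R\<close> of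
  \<open>\<int>\<^sub>p[[t]]\<close>, and each \<open>F = 1 - t\<^sup>m g\<close> with \<open>m > 0\<close> is a unit in it.
\<close>

type_synonym ('n, 'p) laurent = "(int ^ 'n) \<Rightarrow>\<^sub>0 'p padic_int"
type_synonym ('n, 'p) lseries = "('n, 'p) laurent fps"

definition xcoeff :: "('n::finite, 'p::prime_card) lseries \<Rightarrow> int ^ 'n \<Rightarrow> 'p padic_int fps"
  where "xcoeff a v = Abs_fps (\<lambda>i. Poly_Mapping.lookup (fps_nth a i) v)"

definition xsupp :: "('n::finite, 'p::prime_card) lseries \<Rightarrow> (int ^ 'n) set"
  where "xsupp a = {v. xcoeff a v \<noteq> 0}"

definition xconst :: "'p::prime_card padic_int fps \<Rightarrow> ('n::finite, 'p) lseries"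
  where "xconst r = Abs_fps (\<lambda>i. Poly_Mapping.single 0 (fps_nth r i))"

definition laurent_over ::
    "'p::prime_card padic_int fps set \<Rightarrow> ('n::finite, 'p) lseries set"
  where "laurent_over R = {h. finite (xsupp h) \<and> (\<forall>v. xcoeff h v \<in> R)}"

text \<open>The inverse of a power series with constant coefficient 1.\<close>

definition finv :: "'a::comm_ring_1 fps \<Rightarrow> 'a fps"
  where "finv F = fps_right_inverse F 1"

text \<open>The Frobenius lift \<open>t \<mapsto> t\<^sup>p\<close>, on \<open>\<int>\<^sub>p[[t]]\<close> and on coefficients of Laurent polynomials.\<close>

definition frob :: "nat \<Rightarrow> 'a::comm_ring_1 fps \<Rightarrow> 'a fps"
  where "frob p a = fps_compose a (fps_X ^ p)"

text \<open>The substitution \<open>x \<mapsto> x\<^sup>p\<close>.\<close>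

definition xpow :: "('n::finite, 'p::prime_card) lseries \<Rightarrow> ('n, 'p) lseries"
  where "xpow a = Abs_fps (\<lambda>i. \<Sum>v\<in>Poly_Mapping.keys (fps_nth a i).
     Poly_Mapping.single (int CARD('p) *s v) (Poly_Mapping.lookup (fps_nth a i) v))"

text \<open>The Cartier operation \<open>\<Sum> a\<^sub>k x\<^sup>k \<mapsto> \<Sum> a\<^bsub>pk\<^esub> x\<^sup>k\<close>.\<close>

definition cartier_x :: "('n::finite, 'p::prime_card) lseries \<Rightarrow> ('n, 'p) lseries"
  where "cartier_x a =
    Abs_fps (\<lambda>i. Poly_Mapping.map_key (\<lambda>v. int CARD('p) *s v) (fps_nth a i))"

definition real_vec :: "int ^ 'n \<Rightarrow> real ^ 'n::finite"
  where "real_vec v = (\<chi> i. real_of_int (vec_nth v i))"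

definition newton_polytope :: "('n::finite, 'p::prime_card) laurent \<Rightarrow> (real ^ 'n) set"
  where "newton_polytope g = convex hull (real_vec ` Poly_Mapping.keys g)"


section \<open>p-adic completion of a subgroup of a ring\<close>

text \<open>
  For an additive subgroup \<open>M\<close> of a commutative ring, the p-adic completion of \<open>M\<close> is the inverse
  limit of the quotients \<open>M / p\<^sup>m M\<close>; an element is a decreasing sequence of cosets. Note that the
  topology is that of \<open>M\<close> itself and not the one induced from the ambient ring.
\<close>

definition completion :: "nat \<Rightarrow> 'a::comm_ring_1 set \<Rightarrow> (nat \<Rightarrow> 'a set) set"
  where "completion p M =
    {\<omega>. (\<forall>m. \<exists>w\<in>M. \<omega> m = w +o (of_nat p ^ m *o M)) \<and> (\<forall>m. \<omega> (Suc m) \<subseteq> \<omega> m)}"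

definition compl_of :: "nat \<Rightarrow> 'a::comm_ring_1 set \<Rightarrow> 'a \<Rightarrow> (nat \<Rightarrow> 'a set)"
  where "compl_of p M w = (\<lambda>m. w +o (of_nat p ^ m *o M))"

definition compl_add :: "(nat \<Rightarrow> 'a::comm_ring_1 set) \<Rightarrow> (nat \<Rightarrow> 'a set) \<Rightarrow> (nat \<Rightarrow> 'a set)"
  where "compl_add \<omega> \<eta> = (\<lambda>m. \<omega> m + \<eta> m)"

definition compl_scale ::
    "nat \<Rightarrow> 'a::comm_ring_1 set \<Rightarrow> 'a \<Rightarrow> (nat \<Rightarrow> 'a set) \<Rightarrow> (nat \<Rightarrow> 'a set)"
  where "compl_scale p M c \<omega> = (\<lambda>m. (c *o \<omega> m) + (of_nat p ^ m *o M))"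

text \<open>Convergence to \<open>\<eta>\<close> in the completion of a sequence of elements of \<open>M\<close>.\<close>

definition compl_tendsto :: "(nat \<Rightarrow> 'a::comm_ring_1) \<Rightarrow> (nat \<Rightarrow> 'a set) \<Rightarrow> bool"
  where "compl_tendsto w \<eta> \<longleftrightarrow> (\<forall>m. \<forall>\<^sub>F N in sequentially. w N \<in> \<eta> m)"


section \<open>The modules of rational functions and the Cartier operator\<close>

definition numerators ::
    "'p::prime_card padic_int fps set \<Rightarrow> (real ^ 'n::finite) set \<Rightarrow> nat \<Rightarrow> ('n, 'p) lseries set"
  where "numerators R \<mu> k = {h \<in> laurent_over R. real_vec ` xsupp h \<subseteq> (\<lambda>y. real k *\<^sub>R y) ` \<mu>}"

text \<open>
  The elements \<open>(k-1)! h / F\<^sup>k\<close> with fixed \<open>k\<close> form an \<open>R\<close>-module, but their union over all \<open>k\<close>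
  is not closed under addition; \<open>\<Omega>\<^sub>F(\<mu>)\<close> is the \<open>R\<close>-module generated by it. The two functions below
  give the finite families of numerators \<open>(h\<^sub>k)\<close> and the represented elements.
\<close>

definition families ::
    "'p::prime_card padic_int fps set \<Rightarrow> (real ^ 'n::finite) set
      \<Rightarrow> (nat \<times> (nat \<Rightarrow> ('n, 'p) lseries)) set"
  where "families R \<mu> = {(K, h). \<forall>k\<in>{1..K}. h k \<in> numerators R \<mu> k}"

definition represented ::
    "('n::finite, 'p::prime_card) lseries \<Rightarrow> nat \<Rightarrow> (nat \<Rightarrow> ('n, 'p) lseries) \<Rightarrow> ('n, 'p) lseries"
  where "represented F K h = (\<Sum>k=1..K. of_nat (fact (k - 1)) * (h k * finv F ^ k))"

definition Omega ::
    "'p::prime_card padic_int fps set \<Rightarrow> (real ^ 'n::finite) set \<Rightarrow> ('n, 'p) lseries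
      \<Rightarrow> ('n, 'p) lseries set"
  where "Omega R \<mu> F = {represented F K h | K h. (K, h) \<in> families R \<mu>}"

definition Omega_hat ::
    "'p::prime_card padic_int fps set \<Rightarrow> (real ^ 'n::finite) set \<Rightarrow> ('n, 'p) lseries
      \<Rightarrow> (nat \<Rightarrow> ('n, 'p) lseries set) set"
  where "Omega_hat R \<mu> F = completion CARD('p) (Omega R \<mu> F)"

text \<open>The Laurent polynomial \<open>G\<close> with \<open>F\<^sup>p = F\<^sup>\<sigma>(x\<^sup>p) + p G\<close>.\<close>

definition frob_defect :: "('n::finite, 'p::prime_card) lseries \<Rightarrow> ('n, 'p) lseries"
  where "frob_defect F =
    (THE G. F ^ CARD('p) = xpow (frob CARD('p) F) + of_nat CARD('p) * G)"

text \<open>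
  The r-th term of the p-adic expansion of \<open>(k-1)! h F\<^bsup>pm-k\<^esup> / (F\<^sup>\<sigma>(x\<^sup>p) + p G)\<^sup>m\<close> after the Cartier
  operation; the sign and the binomial coefficient are those of \<open>-m\<close> over \<open>r\<close>.
\<close>

definition cartier_term ::
    "('n::finite, 'p::prime_card) lseries \<Rightarrow> nat \<Rightarrow> ('n, 'p) lseries \<Rightarrow> nat \<Rightarrow> ('n, 'p) lseries"
  where "cartier_term F k h r =
    (let p = CARD('p); m = nat \<lceil>real k / real p\<rceil> in
      of_nat (fact (k - 1)) * ((- 1) ^ r * of_nat ((m + r - 1) choose r)) * of_nat p ^ r
        * (cartier_x (h * frob_defect F ^ r * F ^ (p * m - k)) * finv (frob p F) ^ (m + r)))"

definition cartier_partial_sum ::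
    "('n::finite, 'p::prime_card) lseries \<Rightarrow> nat \<Rightarrow> (nat \<Rightarrow> ('n, 'p) lseries) \<Rightarrow> nat
      \<Rightarrow> ('n, 'p) lseries"
  where "cartier_partial_sum F K h N = (\<Sum>k=1..K. \<Sum>r<N. cartier_term F k (h k) r)"

text \<open>
  \<open>\<eta>\<close> is the image of \<open>\<omega> \<in> \<Omega>\<^sub>F(\<mu>)\<close>: the defining series converges to \<open>\<eta>\<close> in the completion of
  \<open>\<Omega>\<close> for \<open>F\<^sup>\<sigma>\<close>, for every representation of \<open>\<omega>\<close>.
\<close>

definition is_cartier ::
    "'p::prime_card padic_int fps set \<Rightarrow> (real ^ 'n::finite) set \<Rightarrow> ('n, 'p) lseries
      \<Rightarrow> ('n, 'p) lseries \<Rightarrow> (nat \<Rightarrow> ('n, 'p) lseries set) \<Rightarrow> bool"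
  where "is_cartier R \<mu> F \<omega> \<eta> \<longleftrightarrow>
    \<eta> \<in> Omega_hat R \<mu> (frob CARD('p) F) \<and>
    (\<forall>K h. (K, h) \<in> families R \<mu> \<and> represented F K h = \<omega>
       \<longrightarrow> compl_tendsto (cartier_partial_sum F K h) \<eta>)"

text \<open>
  Existence of the operator on \<open>\<Omega>\<^sub>F(\<mu>)\<close>. For \<open>p > 2\<close> convergence is automatic, because
  \<open>p\<^sup>r / r!\<close> tends to 0; for \<open>p = 2\<close> it is a genuine condition.
\<close>

definition cartier_exists ::
    "'p::prime_card padic_int fps set \<Rightarrow> (real ^ 'n::finite) set \<Rightarrow> ('n, 'p) lseries \<Rightarrow> bool"
  where "cartier_exists R \<mu> F \<longleftrightarrow> (\<forall>\<omega>\<in>Omega R \<mu> F. \<exists>\<eta>. is_cartier R \<mu> F \<omega> \<eta>)"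

text \<open>
  The operator on the completion. On \<open>\<Omega>\<^sub>F(\<mu>)\<close> it is \<open>R\<close>-linear, hence maps
  \<open>p\<^sup>m \<Omega>\<^sub>F(\<mu>)\<close> into multiples of \<open>p\<^sup>m\<close>; so the cosets united on the right-hand side
  all coincide.
\<close>

definition cartier ::
    "'p::prime_card padic_int fps set \<Rightarrow> (real ^ 'n::finite) set \<Rightarrow> ('n, 'p) lseries
      \<Rightarrow> (nat \<Rightarrow> ('n, 'p) lseries set) \<Rightarrow> (nat \<Rightarrow> ('n, 'p) lseries set)"
  where "cartier R \<mu> F \<omega> = (\<lambda>m. \<Union>w\<in>\<omega> m. (THE \<eta>. is_cartier R \<mu> F w \<eta>) m)"

primrec cartier_iter ::
    "'p::prime_card padic_int fps set \<Rightarrow> (real ^ 'n::finite) set \<Rightarrow> ('n, 'p) lseries \<Rightarrow> nat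
      \<Rightarrow> (nat \<Rightarrow> ('n, 'p) lseries set) \<Rightarrow> (nat \<Rightarrow> ('n, 'p) lseries set)"
  where
    "cartier_iter R \<mu> F 0 \<omega> = \<omega>"
  | "cartier_iter R \<mu> F (Suc s) \<omega> =
       cartier R \<mu> ((frob CARD('p) ^^ s) F) (cartier_iter R \<mu> F s \<omega>)"

definition U_module ::
    "'p::prime_card padic_int fps set \<Rightarrow> (real ^ 'n::finite) set \<Rightarrow> ('n, 'p) lseries
      \<Rightarrow> (nat \<Rightarrow> ('n, 'p) lseries set) set"
  where "U_module R \<mu> F = {\<omega> \<in> Omega_hat R \<mu> F. \<forall>s\<ge>1.
    cartier_iter R \<mu> F s \<omega> \<in>
      compl_scale CARD('p) (Omega R \<mu> ((frob CARD('p) ^^ s) F)) (of_nat CARD('p) ^ s)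
        ` Omega_hat R \<mu> ((frob CARD('p) ^^ s) F)}"

text \<open>The congruence \<open>\<C>\<^sub>p(1/F) \<equiv> \<Lambda> \<cdot> 1/F\<^sup>\<sigma>\<close> modulo \<open>U\<close>, with \<open>\<Lambda> \<in> R\<close>.\<close>

definition is_cartier_matrix ::
    "'p::prime_card padic_int fps set \<Rightarrow> (real ^ 'n::finite) set \<Rightarrow> ('n, 'p) lseries
      \<Rightarrow> 'p padic_int fps \<Rightarrow> bool"
  where "is_cartier_matrix R \<mu> F \<Lambda> \<longleftrightarrow> \<Lambda> \<in> R \<and>
    (let p = CARD('p); M = Omega R \<mu> F; M\<sigma> = Omega R \<mu> (frob p F) in
      \<exists>u\<in>U_module R \<mu> (frob p F).
        cartier R \<mu> F (compl_of p M (finv F)) =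
          compl_add (compl_scale p M\<sigma> (xconst \<Lambda>) (compl_of p M\<sigma> (finv (frob p F)))) u)"

definition cartier_matrix ::
    "'p::prime_card padic_int fps set \<Rightarrow> (real ^ 'n::finite) set \<Rightarrow> ('n, 'p) lseries
      \<Rightarrow> 'p padic_int fps"
  where "cartier_matrix R \<mu> F = (THE \<Lambda>. is_cartier_matrix R \<mu> F \<Lambda>)"


section \<open>The data attached to g\<close>

definition f_of :: "('n::finite, 'p::prime_card) laurent \<Rightarrow> ('n, 'p) lseries"
  where "f_of g = 1 - fps_X * fps_const g"

definition hasse_witt :: "('n::finite, 'p::prime_card) laurent \<Rightarrow> 'p padic_int fps"
  where "hasse_witt g = xcoeff (f_of g ^ (CARD('p) - 1)) 0"

text \<open>
  The p-adic completion of \<open>S = \<int>\<^sub>p[t, \<beta>\<^sup>-\<^sup>1]\<close>, as a subring of \<open>\<int>\<^sub>p[[t]]\<close>. Since \<open>\<beta>(0) = 1\<close>, one has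
  \<open>p\<^sup>m \<int>\<^sub>p[[t]] \<inter> S = p\<^sup>m S\<close>, so the completion is the p-adic closure of \<open>S\<close> in \<open>\<int>\<^sub>p[[t]]\<close>.
\<close>

definition coeff_ring :: "('n::finite, 'p::prime_card) laurent \<Rightarrow> 'p padic_int fps set"
  where "coeff_ring g =
    (let S = {fps_of_poly a * finv (hasse_witt g) ^ k | a k. True} in
      {r. \<forall>m. \<exists>s\<in>S. of_nat CARD('p) ^ m dvd (r - s)})"

definition period_series :: "('n::finite, 'p::prime_card) laurent \<Rightarrow> 'p padic_int fps"
  where "period_series g = Abs_fps (\<lambda>k. Poly_Mapping.lookup (g ^ k) 0)"

end

theory Submission
  imports Defs
begin

text \<open>
  Write \<open>q\<^sup>\<sigma>(t) = q(t\<^sup>p)\<close>. The constant term in \<open>x\<close> of \<open>1/f\<close> is \<open>q\<close>, that of \<open>1/f\<^sup>\<sigma>\<close> is \<open>q\<^sup>\<sigma>\<close>, and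
  the Cartier operation does not change constant terms. On an element of \<open>U\<close> the s-fold operation is
  divisible by \<open>p\<^sup>s\<close>, so its constant term is divisible by every \<open>p\<^sup>s\<close> and vanishes. Hence taking
  constant terms in \<open>\<C>\<^sub>p(1/f) \<equiv> \<Lambda> / f\<^sup>\<sigma>\<close> modulo \<open>U\<close> gives \<open>q = \<Lambda> q\<^sup>\<sigma>\<close>. This proves uniqueness of \<open>\<Lambda>\<close>
  and the formula for it (\<open>cartier_matrix_unique\<close>), once some \<open>\<Lambda>\<close> is known to exist.

  For existence (\<open>cartier_matrix_exists\<close>) the point is that, since 0 is the only interior lattice
  point, the image of \<open>\<C>\<^sub>p\<close> modulo \<open>p\<close> is spanned by \<open>1/f\<^sup>\<sigma>\<close> (\<open>rel_mod_p\<close>), and \<open>1/f\<close> itself is mapped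
  to \<open>\<beta> / f\<^sup>\<sigma>\<close> modulo \<open>p\<close> (\<open>rel_finv_mod_p\<close>). All Frobenius twists of \<open>\<beta>\<close> are units of \<open>R\<close>, so for every
  \<open>\<omega>\<close> one can correct \<open>\<lambda> \<in> R\<close> successively and make the s-fold operation on \<open>\<omega> - \<lambda> / f\<^sup>\<sigma>\<close> divisible by
  \<open>p\<^sup>s\<close> (\<open>chain_approximation\<close>). For \<open>\<omega> = \<C>\<^sub>p(1/f)\<close>, constant terms show that \<open>\<lambda>\<close> is congruent to
  \<open>q / q\<^sup>\<sigma>\<close> modulo \<open>p\<^sup>s\<close>. As \<open>R\<close> is p-adically closed and saturated in \<open>\<int>\<^sub>p[[t]]\<close>, the quotient \<open>q / q\<^sup>\<sigma>\<close>
  lies in \<open>R\<close> and may be used in place of all the \<open>\<lambda>\<close>.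

  It also has to be shown for odd \<open>p\<close> that \<open>\<C>\<^sub>p\<close> is well defined. Convergence of the expansion comes from
  \<open>p\<^sup>r / r! \<rightarrow> 0\<close>. Independence of the representation as a sum of fractions is less immediate, because
  the topology is that of \<open>\<Omega>\<close> and not that of the ambient ring; it follows from an exact formula for the
  remainders of the truncated binomial series (\<open>binomial_partial_shift\<close>, \<open>psum_null_tendsto\<close>).
\<close>

section \<open>Arithmetic of the p-adic integers\<close>

lemma of_nat_dvd_of_natI: "a dvd b \<Longrightarrow> of_nat a dvd (of_nat b :: 'a::comm_semiring_1)"
  by (auto simp: dvd_def)

lemma prime_CARD: "prime CARD('p::prime_card)"
  by (rule prime_card)

lemma Rep_padic_int_of_nat:
  "Rep_padic_int (of_nat a :: 'p::prime_card padic_int) n = int a mod int CARD('p) ^ n"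
  by (induction a)
    (simp_all add: zero_padic_int.rep_eq plus_padic_int.rep_eq one_padic_int.rep_eq mod_simps
      add.commute)

lemma Rep_padic_int_mod_le:
  assumes "m \<le> n"
  shows "Rep_padic_int (x :: 'p::prime_card padic_int) n mod int CARD('p) ^ m = Rep_padic_int x m"
  using assms
proof (induction n rule: dec_induct)
  case base
  then show ?case by (rule Rep_padic_int_mod)
next
  case (step n)
  have "Rep_padic_int x (Suc n) mod int CARD('p) ^ m
      = Rep_padic_int x (Suc n) mod int CARD('p) ^ n mod int CARD('p) ^ m"
    using step by (simp add: mod_mod_cancel le_imp_power_dvd)
  also have "Rep_padic_int x (Suc n) mod int CARD('p) ^ n = Rep_padic_int x n"
  proof (rule sym)
    show "Rep_padic_int x n = Rep_padic_int x (Suc n) mod int CARD('p) ^ n"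
      using Rep_padic_int[of x] by blast
  qed
  finally show ?case using step by simp
qed

lemma of_nat_power_padic_dvd_iff:
  "(of_nat CARD('p) ^ m dvd (x :: 'p::prime_card padic_int)) \<longleftrightarrow> Rep_padic_int x m = 0"
proof
  assume "of_nat CARD('p) ^ m dvd x"
  then obtain y where "x = of_nat (CARD('p) ^ m) * y"
    by (auto elim: dvdE)
  then show "Rep_padic_int x m = 0"
    by (simp only: times_padic_int.rep_eq Rep_padic_int_of_nat) simp
next
  assume x: "Rep_padic_int x m = 0"
  define P where "P = int CARD('p)"
  have P: "P > 0" by (simp add: P_def)
  define y where "y n = Rep_padic_int x (n + m) div P ^ m" for n
  have "y n = y (Suc n) mod P ^ n" for n
  proof -
    have "Rep_padic_int x (n + m) = Rep_padic_int x (Suc n + m) mod P ^ (n + m)"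
      unfolding P_def by (rule Rep_padic_int_mod_le[symmetric]) simp
    also have "P ^ (n + m) = P ^ m * P ^ n"
      by (simp add: power_add)
    finally show ?thesis
      using P by (simp add: y_def zmod_zmult2_eq)
  qed
  then have y: "Rep_padic_int (Abs_padic_int y :: 'p padic_int) = y"
    unfolding P_def by (intro Abs_padic_int_inverse) blast
  have "of_nat CARD('p) ^ m * Abs_padic_int y = x"
  proof (intro Rep_padic_int_inject[THEN iffD1] ext)
    fix n
    have "P ^ m dvd Rep_padic_int x (n + m)"
      using x Rep_padic_int_mod_le[of m "n + m" x] by (simp add: P_def dvd_eq_mod_eq_0)
    then have "P ^ m * y n = Rep_padic_int x (n + m)"
      by (simp add: y_def)
    moreover have "Rep_padic_int x (n + m) mod P ^ n = Rep_padic_int x n"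
      unfolding P_def by (rule Rep_padic_int_mod_le) simp
    moreover have "Rep_padic_int (of_nat CARD('p) ^ m :: 'p padic_int) n = P ^ m mod P ^ n"
      using Rep_padic_int_of_nat[of "CARD('p) ^ m" n, where ?'p = 'p] by (simp add: P_def)
    ultimately show "Rep_padic_int (of_nat CARD('p) ^ m * Abs_padic_int y :: 'p padic_int) n = Rep_padic_int x n"
      by (simp add: times_padic_int.rep_eq y mod_simps P_def)
  qed
  then show "of_nat CARD('p) ^ m dvd x"
    by (metis dvd_triv_left)
qed

lemma padic_separated:
  assumes "\<And>m. of_nat CARD('p) ^ m dvd (x :: 'p::prime_card padic_int)"
  shows "x = 0"
  using assms
  by (intro Rep_padic_int_inject[THEN iffD1] ext)
    (simp add: of_nat_power_padic_dvd_iff zero_padic_int.rep_eq)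

lemma padic_prime_cancel:
  assumes "of_nat CARD('p) * (x :: 'p::prime_card padic_int) = 0"
  shows "x = 0"
proof (intro Rep_padic_int_inject[THEN iffD1] ext)
  fix n
  define P where "P = int CARD('p)"
  have P: "P > 0" by (simp add: P_def)
  have "Rep_padic_int (of_nat CARD('p) * x) (Suc n) = 0"
    by (simp only: assms zero_padic_int.rep_eq)
  then have "P * Rep_padic_int x (Suc n) mod (P * P ^ n) = 0"
    unfolding times_padic_int.rep_eq Rep_padic_int_of_nat by (simp add: P_def mod_simps)
  then have "Rep_padic_int x (Suc n) mod P ^ n = 0"
    using P by (simp only: mult_mod_right[symmetric]) simp
  then show "Rep_padic_int x n = Rep_padic_int 0 n"
    using Rep_padic_int_mod_le[of n "Suc n" x] by (simp add: P_def zero_padic_int.rep_eq)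
qed

lemma padic_of_nat_unit:
  assumes "coprime a CARD('p::prime_card)"
  shows "of_nat a dvd (1 :: 'p padic_int)"
proof -
  define P where "P = int CARD('p)"
  have cop: "coprime (int a) (P ^ n)" for n
    using assms by (simp add: P_def coprime_power_right_iff)
  then have "\<forall>n. \<exists>x. [int a * x = 1] (mod P ^ n)"
    using cong_solve_coprime_int by blast
  then obtain x where x: "\<And>n. [int a * x n = 1] (mod P ^ n)"
    by metis
  define y where "y n = x n mod P ^ n" for n
  have "y n = y (Suc n) mod P ^ n" for n
  proof -
    have "[int a * x (Suc n) = 1] (mod P ^ n)"
      using x[of "Suc n"] by (rule cong_dvd_modulus) simp
    then have "[int a * x n = int a * x (Suc n)] (mod P ^ n)"
      using x[of n] by (metis cong_sym cong_trans)
    then have "[x n = x (Suc n)] (mod P ^ n)"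
      using cop[of n] by (simp add: cong_mult_lcancel)
    then show ?thesis
      by (simp only: y_def mod_Suc_power_mod cong_def)
  qed
  then have y: "Rep_padic_int (Abs_padic_int y :: 'p padic_int) = y"
    unfolding P_def by (intro Abs_padic_int_inverse) blast
  have "of_nat a * Abs_padic_int y = (1 :: 'p padic_int)"
  proof (intro Rep_padic_int_inject[THEN iffD1] ext)
    fix n
    show "Rep_padic_int (of_nat a * Abs_padic_int y :: 'p padic_int) n = Rep_padic_int (1 :: 'p padic_int) n"
      using x[of n]
      by (simp add: times_padic_int.rep_eq y y_def one_padic_int.rep_eq Rep_padic_int_of_nat
          mod_simps P_def cong_def)
  qed
  then show ?thesis
    by (metis dvd_triv_left)
qed

lemma padic_of_nat_dvd:
  assumes "a \<noteq> 0" "b \<noteq> 0" "multiplicity CARD('p::prime_card) a \<le> multiplicity CARD('p) b"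
  shows "of_nat a dvd (of_nat b :: 'p padic_int)"
proof -
  let ?p = "CARD('p)"
  obtain u where u: "a = ?p ^ multiplicity ?p a * u" "\<not> ?p dvd u"
    using assms prime_CARD[where ?'p = 'p]
    using multiplicity_decompose'[of a ?p] not_prime_unit[of ?p] by metis
  have "coprime u ?p"
    using u(2) prime_CARD[where ?'p = 'p] by (metis coprime_commute prime_imp_coprime)
  then have "of_nat u dvd (1 :: 'p padic_int)"
    by (rule padic_of_nat_unit)
  moreover have "of_nat (?p ^ multiplicity ?p a) dvd (of_nat b :: 'p padic_int)"
    using assms(3) by (intro of_nat_dvd_of_natI multiplicity_dvd') auto
  ultimately show ?thesis
    using mult_dvd_mono[of "of_nat (?p ^ multiplicity ?p a)" "of_nat b :: 'p padic_int" "of_nat u" 1]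
    by (subst u(1)) (simp only: of_nat_mult mult_1_right)
qed

text \<open>The p-adic valuation of factorials, in the recursive form of Legendre's formula.\<close>

lemma multiplicity_fact_div:
  assumes "prime (p::nat)"
  shows "multiplicity p (fact n :: nat) = n div p + multiplicity p (fact (n div p) :: nat)"
proof (induction n)
  case 0
  then show ?case by simp
next
  case (Suc n)
  have p: "prime_elem p" "p > 0" "p > 1"
    using assms using prime_gt_1_nat[OF assms] by auto
  have S: "multiplicity p (fact (Suc n) :: nat) = multiplicity p (Suc n) + multiplicity p (fact n :: nat)"
    using p by (simp only: fact_Suc of_nat_id) (subst prime_elem_multiplicity_mult_distrib, auto)
  show ?case
  proof (cases "p dvd Suc n")
    case True
    then obtain q where q: "Suc n = p * q" ..
    then have "q > 0" by (cases q) auto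
    then obtain q' where q': "q = Suc q'" by (cases q) auto
    have n: "n = (p - 1) + p * q'" using q q' p by (simp add: algebra_simps)
    have d: "n div p = q'" unfolding n using p by (subst div_mult_self2) auto
    have d': "Suc n div p = Suc q'" using q q' p by simp
    have 1: "multiplicity p (Suc n) = 1 + multiplicity p (Suc q')"
      unfolding q q' using p by (subst prime_elem_multiplicity_mult_distrib) (auto simp: multiplicity_self)
    have 2: "multiplicity p (fact (Suc q') :: nat) = multiplicity p (Suc q') + multiplicity p (fact q' :: nat)"
      using p by (simp only: fact_Suc of_nat_id) (subst prime_elem_multiplicity_mult_distrib, auto)
    show ?thesis
      unfolding S Suc.IH d d' 1 2 by simp
  next
    case False
    then have "multiplicity p (Suc n) = 0" by (rule not_dvd_imp_multiplicity_0)
    moreover have "Suc n div p = n div p"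
      using False by (metis div_Suc dvd_eq_mod_eq_0)
    ultimately show ?thesis
      unfolding S Suc.IH by simp
  qed
qed

lemma multiplicity_fact_less:
  assumes "prime (p::nat)" "n > 0"
  shows "(p - 1) * multiplicity p (fact n :: nat) < n"
  using assms(2)
proof (induction n rule: less_induct)
  case (less n)
  have p: "p > 1" using assms(1) by (rule prime_gt_1_nat)
  have v: "multiplicity p (fact n :: nat) = n div p + multiplicity p (fact (n div p) :: nat)"
    using assms(1) by (rule multiplicity_fact_div)
  show ?case
  proof (cases "n div p = 0")
    case True
    then show ?thesis using less v by simp
  next
    case False
    then have "(p - 1) * multiplicity p (fact (n div p) :: nat) < n div p"
      using less p by (intro less.IH) auto
    then have "(p - 1) * multiplicity p (fact n :: nat) < (p - 1) * (n div p) + n div p"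
      unfolding v by (simp add: algebra_simps)
    also have "\<dots> = p * (n div p)"
      using p by (cases p) auto
    also have "\<dots> \<le> n" by simp
    finally show ?thesis .
  qed
qed

lemma multiplicity_binomial_fact:
  assumes "prime (p::nat)"
  shows "multiplicity p ((j + r) choose r) + multiplicity p (fact r :: nat) + multiplicity p (fact j :: nat)
    = multiplicity p (fact (j + r) :: nat)"
proof -
  have "(fact r * fact j * ((j + r) choose r) :: nat) = fact (j + r)"
    using binomial_fact_lemma[of r "j + r"] by simp
  moreover have "multiplicity p (fact r * fact j * ((j + r) choose r) :: nat)
     = multiplicity p (fact r :: nat) + multiplicity p (fact j :: nat) + multiplicity p ((j + r) choose r)"
    using assms by (simp add: prime_elem_multiplicity_mult_distrib)
  ultimately show ?thesis
    by simp
qed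

text \<open>
  The r-th term of the expansion of \<open>\<C>\<^sub>p((k-1)! h / F\<^sup>k)\<close> carries the integer
  \<open>(k-1)! (m+r-1 choose r) p\<^sup>r\<close>, where \<open>m = \<lceil>k/p\<rceil>\<close>, and has a pole of order \<open>m + r\<close>, whose
  normalising factor in \<open>\<Omega>\<close> is \<open>(m+r-1)!\<close>. The next two lemmas, with \<open>n = k - 1\<close> and \<open>j = m - 1\<close>, say
  that the quotient of the two integers is divisible by \<open>p\<close> unless \<open>m = 1\<close> and \<open>r = 0\<close>, and that for odd \<open>p\<close>
  it tends to 0, even without the factor \<open>(k-1)!\<close>.
\<close>

lemma padic_cartier_factor_dvd:
  assumes "n div CARD('p::prime_card) = j" "r > 0 \<or> j > 0"
  shows "(of_nat (CARD('p) * fact (j + r)) :: 'p padic_int)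
    dvd of_nat (fact n * ((j + r) choose r) * CARD('p) ^ r)"
proof (rule padic_of_nat_dvd)
  let ?p = "CARD('p)"
  have p: "prime ?p" by (rule prime_CARD)
  then have p': "prime_elem ?p" "?p > 1" "\<not> is_unit ?p" using prime_gt_1_nat[OF p] by auto
  have v: "multiplicity ?p (fact n :: nat) = j + multiplicity ?p (fact j :: nat)"
    using multiplicity_fact_div[OF p, of n] assms(1) by simp
  have "multiplicity ?p (fact r :: nat) + (if r > 0 then 1 else 0) \<le> r"
  proof (cases "r > 0")
    case True
    have "1 * multiplicity ?p (fact r :: nat) \<le> (?p - 1) * multiplicity ?p (fact r :: nat)"
      using p' by (intro mult_le_mono1) simp
    then show ?thesis
      using le_less_trans[OF _ multiplicity_fact_less[OF p True]] True
      by (simp only: mult_1 if_True flip: Suc_eq_plus1) (rule Suc_leI)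
  qed simp
  then have "1 + multiplicity ?p (fact r :: nat) \<le> j + r"
    using assms(2) by (auto split: if_splits)
  then show "multiplicity ?p (?p * fact (j + r)) \<le> multiplicity ?p (fact n * ((j + r) choose r) * ?p ^ r)"
    using p' v multiplicity_binomial_fact[OF p, of j r]
    by (simp add: prime_elem_multiplicity_mult_distrib multiplicity_self multiplicity_same_power)
qed auto

lemma padic_binomial_factor_tendsto:
  assumes "CARD('p::prime_card) \<noteq> 2"
  shows "\<forall>\<^sub>F r in sequentially. (of_nat (CARD('p) ^ m * fact (j + r)) :: 'p padic_int)
    dvd of_nat (((j + r) choose r) * CARD('p) ^ r)"
  unfolding eventually_sequentially
proof (intro exI allI impI)
  let ?p = "CARD('p)"
  fix r
  assume r: "2 * (m + multiplicity ?p (fact j :: nat)) + 1 \<le> r"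
  have p: "prime ?p" by (rule prime_CARD)
  then have p': "prime_elem ?p" "?p > 2" "\<not> is_unit ?p" using assms
    using prime_ge_2_nat[OF p] by auto
  have "2 * multiplicity ?p (fact r :: nat) \<le> (?p - 1) * multiplicity ?p (fact r :: nat)"
    using p' by (intro mult_le_mono1) simp
  then have *: "2 * multiplicity ?p (fact r :: nat) < r"
    using multiplicity_fact_less[OF p, of r] r by linarith
  have "m + a + b \<le> r" if "2 * a < r" "2 * (m + b) + 1 \<le> r" for a b
    using that by presburger
  from this[OF * r] have "m + multiplicity ?p (fact r :: nat) + multiplicity ?p (fact j :: nat) \<le> r" .
  then show "(of_nat (?p ^ m * fact (j + r)) :: 'p padic_int) dvd of_nat (((j + r) choose r) * ?p ^ r)"
    using p' multiplicity_binomial_fact[OF p, of j r]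
    by (intro padic_of_nat_dvd)
      (auto simp: prime_elem_multiplicity_mult_distrib multiplicity_same_power)
qed

section \<open>Congruences modulo p for p-th powers\<close>

lemma prime_dvd_power_add_diff:
  fixes x y :: "'a::comm_ring_1"
  assumes "prime p"
  shows "of_nat p dvd (x + y) ^ p - (x ^ p + y ^ p)"
proof -
  have p: "p > 0" using assms by (rule prime_gt_0_nat)
  let ?t = "\<lambda>k. of_nat (p choose k) * x ^ k * y ^ (p - k)"
  have "(x + y) ^ p = (\<Sum>k\<le>p. ?t k)"
    by (rule binomial_ring)
  also have "{..p} = insert 0 (insert p {1..<p})"
    using p by auto
  also have "(\<Sum>k\<in>\<dots>. ?t k) = y ^ p + (x ^ p + (\<Sum>k\<in>{1..<p}. ?t k))"
    using p by simp
  finally have "(x + y) ^ p - (x ^ p + y ^ p) = (\<Sum>k\<in>{1..<p}. ?t k)"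
    by simp
  also have "of_nat p dvd \<dots>"
  proof (rule dvd_sum)
    fix k assume k: "k \<in> {1..<p}"
    then have "p dvd p choose k"
      using assms by (intro dvd_choose_prime) auto
    then have "of_nat p dvd (of_nat (p choose k) :: 'a)"
      by (rule of_nat_dvd_of_natI)
    then show "of_nat p dvd ?t k"
      by (intro dvd_mult2)
  qed
  finally show ?thesis .
qed

lemma prime_dvd_power_add:
  fixes x y :: "'a::comm_ring_1"
  assumes "prime p" "of_nat p dvd x ^ p - x'" "of_nat p dvd y ^ p - y'"
  shows "of_nat p dvd (x + y) ^ p - (x' + y')"
proof -
  have "(x + y) ^ p - (x' + y') = ((x + y) ^ p - (x ^ p + y ^ p)) + ((x ^ p - x') + (y ^ p - y'))"
    by (simp add: algebra_simps)
  then show ?thesis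
    using prime_dvd_power_add_diff[OF assms(1), of x y] assms(2,3) by (metis dvd_add)
qed

lemma dvd_power_diff:
  fixes x y :: "'a::comm_ring_1"
  assumes "d dvd x - y"
  shows "d dvd x ^ n - y ^ n"
proof -
  have "x - y dvd x ^ n - y ^ n"
    by (subst power_diff_sumr2) simp
  then show ?thesis
    using assms by (rule dvd_trans[rotated])
qed

lemma padic_fermat: "of_nat CARD('p) dvd (x :: 'p::prime_card padic_int) ^ CARD('p) - x"
proof -
  have nat: "of_nat CARD('p) dvd (of_nat a :: 'p padic_int) ^ CARD('p) - of_nat a" for a
  proof (induction a)
    case 0
    then show ?case by (simp add: zero_power)
  next
    case (Suc a)
    show ?case
      using prime_dvd_power_add[OF prime_CARD[where ?'p = 'p] _ Suc, of 1 1] by simp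
  qed
  define a where "a = nat (Rep_padic_int x 1)"
  have "Rep_padic_int x 1 mod int CARD('p) = Rep_padic_int x 1"
    using Rep_padic_int_mod[of x 1] by simp
  then have "Rep_padic_int x 1 \<ge> 0"
    by (metis of_nat_0_less_iff zero_less_card_finite pos_mod_sign)
  then have "Rep_padic_int (x - of_nat a) 1 = 0"
    unfolding minus_padic_int.rep_eq Rep_padic_int_of_nat a_def by (simp add: mod_simps)
  then have x: "of_nat CARD('p) dvd x - of_nat a"
    using of_nat_power_padic_dvd_iff[of 1 "x - of_nat a"] by simp
  have "x ^ CARD('p) - x = (x ^ CARD('p) - of_nat a ^ CARD('p)) + (of_nat a ^ CARD('p) - of_nat a)
      - (x - of_nat a)"
    by simp
  then show ?thesis
    using x nat dvd_power_diff[OF x] by (metis dvd_add dvd_diff)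
qed

section \<open>Laurent polynomials: the substitution of p-th powers and the Cartier operation\<close>

lemma poly_mapping_eq_sum_single:
  "a = (\<Sum>v\<in>Poly_Mapping.keys a. Poly_Mapping.single v (Poly_Mapping.lookup a v))"
proof (rule poly_mapping_eqI)
  fix w
  have "(\<Sum>v\<in>Poly_Mapping.keys a. Poly_Mapping.lookup a v when v = w)
      = (if w \<in> Poly_Mapping.keys a then Poly_Mapping.lookup a w else 0)"
    by (simp add: when_def)
  then show "Poly_Mapping.lookup a w = Poly_Mapping.lookup
      (\<Sum>v\<in>Poly_Mapping.keys a. Poly_Mapping.single v (Poly_Mapping.lookup a v)) w"
    by (simp add: lookup_sum lookup_single in_keys_iff)
qed

lemma poly_mapping_single_induct [case_names zero single add]:
  fixes a :: "'a \<Rightarrow>\<^sub>0 'b::comm_monoid_add" and P :: "('a \<Rightarrow>\<^sub>0 'b) \<Rightarrow> bool"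
  assumes "P 0" "\<And>v c. P (Poly_Mapping.single v c)" "\<And>a b. P a \<Longrightarrow> P b \<Longrightarrow> P (a + b)"
  shows "P a"
proof -
  have "P (\<Sum>v\<in>A. Poly_Mapping.single v (f v))" if "finite A" for A and f :: "'a \<Rightarrow> 'b"
    using that by (induction A rule: finite_induct) (auto intro: assms)
  from this[OF finite_keys[of a], of "Poly_Mapping.lookup a"] show ?thesis
    using poly_mapping_eq_sum_single[of a] by metis
qed

lemma power_single_laurent:
  "Poly_Mapping.single v c ^ n = (Poly_Mapping.single (int n *s v) (c ^ n) :: ('n::finite, 'p::prime_card) laurent)"
proof (induction n)
  case 0
  have "(0::int) *s v = 0" by (simp add: vec_eq_iff)
  then show ?case by (simp only: of_nat_0 power_0 single_one)
next
  case (Suc n)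
  have "v + int n *s v = int (Suc n) *s v"
    by (simp add: vec_eq_iff algebra_simps)
  then show ?case
    by (simp only: power_Suc Suc.IH mult_single)
qed

lemma inj_smult_CARD: "inj (\<lambda>v :: int ^ 'n::finite. int CARD('p::prime_card) *s v)"
  by (rule injI) (simp add: vec_eq_iff)

text \<open>The maps \<open>x \<mapsto> x\<^sup>p\<close> and \<open>\<C>\<^sub>p\<close> on Laurent polynomials with constant coefficients.\<close>

definition laurent_xpow :: "('n::finite, 'p::prime_card) laurent \<Rightarrow> ('n, 'p) laurent"
  where "laurent_xpow a = (\<Sum>v\<in>Poly_Mapping.keys a.
     Poly_Mapping.single (int CARD('p) *s v) (Poly_Mapping.lookup a v))"

definition laurent_cartier :: "('n::finite, 'p::prime_card) laurent \<Rightarrow> ('n, 'p) laurent"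
  where "laurent_cartier a = Poly_Mapping.map_key (\<lambda>v. int CARD('p) *s v) a"

lemma laurent_xpow_superset:
  fixes a :: "('n::finite, 'p::prime_card) laurent"
  assumes "finite A" "Poly_Mapping.keys a \<subseteq> A"
  shows "laurent_xpow a = (\<Sum>v\<in>A. Poly_Mapping.single (int CARD('p) *s v) (Poly_Mapping.lookup a v))"
  unfolding laurent_xpow_def using assms
  by (intro sum.mono_neutral_left) (auto simp: in_keys_iff)

lemma laurent_xpow_zero [simp]: "laurent_xpow 0 = 0"
  by (simp add: laurent_xpow_def)

lemma laurent_xpow_single [simp]:
  "laurent_xpow (Poly_Mapping.single v c :: ('n::finite, 'p::prime_card) laurent)
    = Poly_Mapping.single (int CARD('p) *s v) c"
  by (subst laurent_xpow_superset[of "{v}"]) auto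

lemma laurent_xpow_one [simp]: "laurent_xpow (1 :: ('n::finite, 'p::prime_card) laurent) = 1"
proof -
  have "int CARD('p) *s (0 :: int ^ 'n) = 0" by (simp add: vec_eq_iff)
  then show "laurent_xpow (1 :: ('n, 'p) laurent) = 1"
    using laurent_xpow_single[of "0 :: int ^ 'n" "1 :: 'p padic_int"] by (simp del: laurent_xpow_single)
qed

lemma laurent_xpow_add: "laurent_xpow (a + b) = laurent_xpow a + laurent_xpow b"
proof -
  let ?A = "Poly_Mapping.keys a \<union> Poly_Mapping.keys b"
  show ?thesis
    using keys_add[of a b]
    by (simp add: laurent_xpow_superset[of ?A] lookup_add single_add sum.distrib)
qed

lemma laurent_xpow_sum: "laurent_xpow (\<Sum>i\<in>I. f i) = (\<Sum>i\<in>I. laurent_xpow (f i))"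
  by (induction I rule: infinite_finite_induct) (auto simp: laurent_xpow_add)

lemma laurent_xpow_mult: "laurent_xpow (a * b) = laurent_xpow a * laurent_xpow b"
proof (induction a rule: poly_mapping_single_induct)
  case (single u c)
  show ?case
    by (induction b rule: poly_mapping_single_induct)
      (simp_all add: laurent_xpow_add mult_single algebra_simps)
qed (simp_all add: laurent_xpow_add algebra_simps)

lemma lookup_laurent_cartier:
  "Poly_Mapping.lookup (laurent_cartier (a :: ('n::finite, 'p::prime_card) laurent)) v
    = Poly_Mapping.lookup a (int CARD('p) *s v)"
  unfolding laurent_cartier_def by (simp add: map_key.rep_eq[OF inj_smult_CARD])

lemma laurent_cartier_zero [simp]: "laurent_cartier 0 = 0"
  by (rule poly_mapping_eqI) (simp add: lookup_laurent_cartier)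

lemma laurent_cartier_add: "laurent_cartier (a + b) = laurent_cartier a + laurent_cartier b"
  by (rule poly_mapping_eqI) (simp add: lookup_laurent_cartier lookup_add)

lemma laurent_cartier_sum: "laurent_cartier (\<Sum>i\<in>I. f i) = (\<Sum>i\<in>I. laurent_cartier (f i))"
  by (induction I rule: infinite_finite_induct) (auto simp: laurent_cartier_add)

lemma laurent_cartier_single:
  "laurent_cartier (Poly_Mapping.single (int CARD('p) *s v) c :: ('n::finite, 'p::prime_card) laurent)
    = Poly_Mapping.single v c"
  using inj_smult_CARD[where ?'p = 'p and ?'n = 'n]
  by (intro poly_mapping_eqI) (simp add: lookup_laurent_cartier lookup_single inj_eq)

lemma laurent_cartier_single_eq_0:
  fixes c :: "'p::prime_card padic_int" and v :: "int ^ 'n::finite"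
  assumes "v \<notin> range (\<lambda>v. int CARD('p) *s v)"
  shows "laurent_cartier (Poly_Mapping.single v c) = 0"
  using assms by (intro poly_mapping_eqI) (auto simp: lookup_laurent_cartier lookup_single when_def)

lemma laurent_cartier_mult_xpow:
  fixes a b :: "('n::finite, 'p::prime_card) laurent"
  shows "laurent_cartier (a * laurent_xpow b) = laurent_cartier a * b"
proof (induction a rule: poly_mapping_single_induct)
  case (single u c)
  show ?case
  proof (induction b rule: poly_mapping_single_induct)
    case (single w d)
    show ?case
    proof (cases "u \<in> range (\<lambda>v. int CARD('p) *s v)")
      case True
      then obtain v where u: "u = int CARD('p) *s v" by blast
      have "u + int CARD('p) *s w = int CARD('p) *s (v + w)"
        by (simp add: u vec_eq_iff algebra_simps)
      then show ?thesis
        by (simp only: laurent_xpow_single mult_single laurent_cartier_single)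
          (simp only: u mult_single laurent_cartier_single)
    next
      case False
      have "u + int CARD('p) *s w \<notin> range (\<lambda>v. int CARD('p) *s v)"
      proof
        assume "u + int CARD('p) *s w \<in> range (\<lambda>v. int CARD('p) *s v)"
        then obtain v where "u + int CARD('p) *s w = int CARD('p) *s v" by blast
        then have "u = int CARD('p) *s (v - w)"
          by (simp add: vec_eq_iff algebra_simps eq_diff_eq)
        then show False using False by blast
      qed
      then show ?thesis
        using False by (simp add: mult_single laurent_cartier_single_eq_0)
    qed
  qed (simp_all add: laurent_xpow_add laurent_cartier_add algebra_simps)
qed (simp_all add: laurent_cartier_add algebra_simps)

lemma laurent_power_cong_xpow:
  "of_nat CARD('p) dvd (a :: ('n::finite, 'p::prime_card) laurent) ^ CARD('p) - laurent_xpow a"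
proof (induction a rule: poly_mapping_single_induct)
  case zero
  then show ?case by (simp add: zero_power)
next
  case (single v c)
  obtain d where "c ^ CARD('p) - c = of_nat CARD('p) * d"
    using padic_fermat[of c] by (elim dvdE)
  then have "Poly_Mapping.single v c ^ CARD('p) - laurent_xpow (Poly_Mapping.single v c)
      = Poly_Mapping.single 0 (of_nat CARD('p)) * Poly_Mapping.single (int CARD('p) *s v) d"
    by (simp only: power_single_laurent laurent_xpow_single mult_single flip: single_diff) simp
  then show ?case
    by simp
next
  case (add a b)
  then show ?case
    unfolding laurent_xpow_add by (intro prime_dvd_power_add prime_CARD)
qed

section \<open>Coefficients of Laurent polynomials over power series in t\<close>

lemma fps_nth_xpow [simp]: "fps_nth (xpow a) i = laurent_xpow (fps_nth a i)"
  by (simp add: xpow_def laurent_xpow_def)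

lemma fps_nth_cartier_x [simp]: "fps_nth (cartier_x a) i = laurent_cartier (fps_nth a i)"
  by (simp add: cartier_x_def laurent_cartier_def)

lemma xpow_one [simp]: "xpow 1 = 1"
  by (rule fps_ext) simp

lemma xpow_add: "xpow (a + b) = xpow a + xpow b"
  by (rule fps_ext) (simp add: laurent_xpow_add)

lemma xpow_diff: "xpow (a - b) = xpow a - xpow b"
  using xpow_add[of "a - b" b] by (simp add: algebra_simps)

lemma xpow_mult: "xpow (a * b) = xpow a * xpow b"
  by (rule fps_ext) (simp add: fps_mult_nth laurent_xpow_sum laurent_xpow_mult)

lemma xpow_power: "xpow (a ^ n) = xpow a ^ n"
  by (induction n) (simp_all add: xpow_mult)

lemma cartier_x_mult_xpow: "cartier_x (a * xpow b) = cartier_x a * b"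
  by (rule fps_ext) (simp add: fps_mult_nth laurent_cartier_sum laurent_cartier_mult_xpow)

lemma fps_nth_xcoeff [simp]: "fps_nth (xcoeff a v) i = Poly_Mapping.lookup (fps_nth a i) v"
  by (simp add: xcoeff_def)

lemma lseries_eqI: "(\<And>v. xcoeff a v = xcoeff b v) \<Longrightarrow> a = b"
  by (metis fps_ext fps_nth_xcoeff poly_mapping_eqI)

lemma xcoeff_zero [simp]: "xcoeff 0 v = 0"
  by (rule fps_ext) simp

lemma xcoeff_add: "xcoeff (a + b) v = xcoeff a v + xcoeff b v"
  by (rule fps_ext) (simp add: lookup_add)

lemma xcoeff_diff: "xcoeff (a - b) v = xcoeff a v - xcoeff b v"
  by (rule fps_ext) (simp add: lookup_minus)

lemma xcoeff_sum: "xcoeff (\<Sum>i\<in>I. f i) v = (\<Sum>i\<in>I. xcoeff (f i) v)"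
  by (induction I rule: infinite_finite_induct) (auto simp: xcoeff_add)

lemma xcoeff_cartier_x:
  "xcoeff (cartier_x (a :: ('n::finite, 'p::prime_card) lseries)) v = xcoeff a (int CARD('p) *s v)"
  by (rule fps_ext) (simp add: lookup_laurent_cartier)

lemma lookup_single_zero_mult:
  "Poly_Mapping.lookup (Poly_Mapping.single 0 c * a) v = c * Poly_Mapping.lookup a v"
  unfolding mult_map_scale_conv_mult[symmetric] by (simp add: map.rep_eq when_def)

lemma xcoeff_xconst_mult: "xcoeff (xconst r * a) v = r * xcoeff a v"
  by (rule fps_ext) (simp add: xconst_def fps_mult_nth lookup_sum lookup_single_zero_mult)

lemma xconst_one [simp]: "xconst 1 = 1"
  by (rule fps_ext) (simp add: xconst_def)

lemma xconst_zero [simp]: "xconst 0 = 0"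
  by (rule fps_ext) (simp add: xconst_def)

lemma xconst_add: "xconst (r + s) = xconst r + xconst s"
  by (rule fps_ext) (simp add: xconst_def single_add)

lemma xconst_diff: "xconst (r - s) = xconst r - xconst s"
  by (rule fps_ext) (simp add: xconst_def single_diff)

lemma xconst_mult: "xconst (r * s) = xconst r * xconst s"
proof (rule lseries_eqI)
  fix v
  have "xcoeff (xconst (r * s) * 1) v = xcoeff (xconst r * (xconst s * 1)) v"
    by (simp only: xcoeff_xconst_mult mult.assoc)
  then show "xcoeff (xconst (r * s)) v = xcoeff (xconst r * xconst s) v"
    by simp
qed

lemma xconst_of_nat: "xconst (of_nat n) = of_nat n"
  by (induction n) (simp_all add: xconst_add)

lemma xconst_power: "xconst (r ^ n) = xconst r ^ n"
  by (induction n) (simp_all add: xconst_mult)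

lemma cartier_x_zero [simp]: "cartier_x 0 = 0"
  by (rule lseries_eqI) (simp add: xcoeff_cartier_x)

lemma cartier_x_add: "cartier_x (a + b) = cartier_x a + cartier_x b"
  by (rule lseries_eqI) (simp add: xcoeff_cartier_x xcoeff_add)

lemma cartier_x_sum: "cartier_x (\<Sum>i\<in>I. f i) = (\<Sum>i\<in>I. cartier_x (f i))"
  by (rule lseries_eqI) (simp add: xcoeff_cartier_x xcoeff_sum)

lemma cartier_x_xconst_mult: "cartier_x (xconst r * a) = xconst r * cartier_x a"
  by (rule lseries_eqI) (simp add: xcoeff_cartier_x xcoeff_xconst_mult)

lemma cartier_x_of_nat_mult: "cartier_x (of_nat n * a) = of_nat n * cartier_x a"
  using cartier_x_xconst_mult[of "of_nat n" a] by (simp add: xconst_of_nat)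

lemma xcoeff_of_nat_mult: "xcoeff (of_nat n * a) v = of_nat n * xcoeff a v"
  using xcoeff_xconst_mult[of "of_nat n" a v] by (simp add: xconst_of_nat)

lemma padic_fps_prime_cancel:
  assumes "of_nat CARD('p) * (a :: 'p::prime_card padic_int fps) = 0"
  shows "a = 0"
proof (rule fps_ext)
  fix i
  have "of_nat CARD('p) * fps_nth a i = 0"
    using arg_cong[OF assms, of "\<lambda>a. fps_nth a i"] by (simp add: fps_mult_of_nat_nth)
  then show "fps_nth a i = fps_nth 0 i"
    by (simp add: padic_prime_cancel)
qed

lemma padic_fps_separated:
  assumes "\<And>m. of_nat CARD('p) ^ m dvd (a :: 'p::prime_card padic_int fps)"
  shows "a = 0"
proof (rule fps_ext)
  fix i
  have *: "of_nat CARD('p) ^ m dvd fps_nth a i" for m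
  proof -
    obtain b where "a = of_nat (CARD('p) ^ m) * b"
      using assms[of m] by (auto simp: dvd_def)
    then have "fps_nth a i = of_nat (CARD('p) ^ m) * fps_nth b i"
      by (simp only: fps_mult_of_nat_nth)
    then show ?thesis by simp
  qed
  show "fps_nth a i = fps_nth 0 i"
    using padic_separated[OF *] by simp
qed

lemma lseries_prime_cancel:
  assumes "of_nat CARD('p) * (a :: ('n::finite, 'p::prime_card) lseries) = of_nat CARD('p) * b"
  shows "a = b"
proof (rule lseries_eqI)
  fix v
  have "of_nat CARD('p) * (xcoeff a v - xcoeff b v) = 0"
    using arg_cong[OF assms, of "\<lambda>a. xcoeff a v"] by (simp only: xcoeff_of_nat_mult right_diff_distrib diff_self)
  then show "xcoeff a v = xcoeff b v"
    using padic_fps_prime_cancel by fastforce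
qed

section \<open>Supports, and Laurent polynomials over a subring of coefficients\<close>

lemma xsupp_iff: "v \<in> xsupp a \<longleftrightarrow> (\<exists>i. Poly_Mapping.lookup (fps_nth a i) v \<noteq> 0)"
  by (auto simp: xsupp_def fps_eq_iff)

lemma xcoeff_eq_0: "v \<notin> xsupp a \<Longrightarrow> xcoeff a v = 0"
  by (simp add: xsupp_def)

lemma xsupp_zero [simp]: "xsupp 0 = {}"
  by (simp add: xsupp_def)

lemma xsupp_one: "xsupp 1 \<subseteq> {0}"
  by (auto simp: xsupp_iff lookup_one when_def split: if_splits)

lemma xsupp_add: "xsupp (a + b) \<subseteq> xsupp a \<union> xsupp b"
  by (auto simp: xsupp_def xcoeff_add)

lemma xsupp_diff: "xsupp (a - b) \<subseteq> xsupp a \<union> xsupp b"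
  by (auto simp: xsupp_def xcoeff_diff)

lemma xsupp_mult: "xsupp (a * b) \<subseteq> {u + w | u w. u \<in> xsupp a \<and> w \<in> xsupp b}"
proof
  fix v assume "v \<in> xsupp (a * b)"
  then obtain i where "(\<Sum>j=0..i. Poly_Mapping.lookup (fps_nth a j * fps_nth b (i - j)) v) \<noteq> 0"
    by (auto simp: xsupp_iff fps_mult_nth lookup_sum)
  then obtain j where "Poly_Mapping.lookup (fps_nth a j * fps_nth b (i - j)) v \<noteq> 0"
    by (meson sum.not_neutral_contains_not_neutral)
  then have "v \<in> Poly_Mapping.keys (fps_nth a j * fps_nth b (i - j))"
    by (simp add: in_keys_iff)
  then obtain u w where "v = u + w" "u \<in> Poly_Mapping.keys (fps_nth a j)"
      "w \<in> Poly_Mapping.keys (fps_nth b (i - j))"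
    using keys_mult by blast
  then show "v \<in> {u + w | u w. u \<in> xsupp a \<and> w \<in> xsupp b}"
    by (auto simp: xsupp_iff in_keys_iff)
qed

lemma xsupp_xconst_mult: "xsupp (xconst r * a) \<subseteq> xsupp a"
  by (auto simp: xsupp_def xcoeff_xconst_mult)

lemma xsupp_cartier_x:
  "xsupp (cartier_x (a :: ('n::finite, 'p::prime_card) lseries)) = (\<lambda>v. int CARD('p) *s v) -` xsupp a"
  by (auto simp: xsupp_def xcoeff_cartier_x)

text \<open>Subrings (with 1) of a commutative ring, as sets.\<close>

definition is_subring :: "'a::comm_ring_1 set \<Rightarrow> bool"
  where "is_subring S \<longleftrightarrow> 1 \<in> S \<and> (\<forall>a\<in>S. \<forall>b\<in>S. a - b \<in> S \<and> a * b \<in> S)"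

lemma is_subringD:
  assumes "is_subring S"
  shows is_subring_one: "1 \<in> S"
    and is_subring_diff: "a \<in> S \<Longrightarrow> b \<in> S \<Longrightarrow> a - b \<in> S"
    and is_subring_mult: "a \<in> S \<Longrightarrow> b \<in> S \<Longrightarrow> a * b \<in> S"
    and is_subring_zero: "0 \<in> S"
    and is_subring_add: "a \<in> S \<Longrightarrow> b \<in> S \<Longrightarrow> a + b \<in> S"
proof -
  show 1: "1 \<in> S" and d: "\<And>a b. a \<in> S \<Longrightarrow> b \<in> S \<Longrightarrow> a - b \<in> S"
    and "a \<in> S \<Longrightarrow> b \<in> S \<Longrightarrow> a * b \<in> S"
    using assms by (auto simp: is_subring_def)
  show 0: "0 \<in> S"
    using d[OF 1 1] by simp
  show "a \<in> S \<Longrightarrow> b \<in> S \<Longrightarrow> a + b \<in> S"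
    using d[OF _ d[OF 0]] by fastforce
qed

lemma is_subring_power: "is_subring S \<Longrightarrow> a \<in> S \<Longrightarrow> a ^ n \<in> S"
  by (induction n) (auto intro: is_subringD)

lemma is_subring_sum: "is_subring S \<Longrightarrow> (\<And>i. i \<in> I \<Longrightarrow> f i \<in> S) \<Longrightarrow> (\<Sum>i\<in>I. f i) \<in> S"
  by (induction I rule: infinite_finite_induct) (auto intro: is_subringD)

lemma is_subring_of_nat: "is_subring S \<Longrightarrow> of_nat n \<in> S"
  by (induction n) (auto intro: is_subringD)

lemma xcoeff_monomial:
  fixes r :: "'p::prime_card padic_int fps" and u v :: "int ^ 'n::finite"
  shows "xcoeff (xconst r * fps_const (Poly_Mapping.single u 1)) v = (if u = v then r else 0)"
proof -
  have "xcoeff (fps_const (Poly_Mapping.single u 1 :: ('n, 'p) laurent)) v = (if u = v then 1 else 0)"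
    by (rule fps_ext) (simp add: lookup_single)
  then show ?thesis
    by (simp add: xcoeff_xconst_mult)
qed

lemma laurent_over_expand:
  assumes "finite (xsupp h)"
  shows "h = (\<Sum>v\<in>xsupp h. xconst (xcoeff h v) * fps_const (Poly_Mapping.single v 1))"
  by (rule lseries_eqI) (use assms in \<open>auto simp: xcoeff_sum xcoeff_monomial xcoeff_eq_0\<close>)

lemma is_subring_laurent_over:
  assumes S: "is_subring S"
  shows "is_subring (laurent_over S :: ('n::finite, 'p::prime_card) lseries set)"
proof -
  let ?L = "laurent_over S :: ('n, 'p) lseries set"
  have zero: "0 \<in> ?L"
    using is_subring_zero[OF S] by (simp add: laurent_over_def)
  have diff: "a - b \<in> ?L" if "a \<in> ?L" "b \<in> ?L" for a b
    using that finite_subset[OF xsupp_diff] is_subring_diff[OF S]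
    by (auto simp: laurent_over_def xcoeff_diff)
  have add: "a + b \<in> ?L" if "a \<in> ?L" "b \<in> ?L" for a b
    using that diff[OF _ diff[OF zero]] by fastforce
  have sum: "(\<Sum>i\<in>I. f i) \<in> ?L" if "\<And>i. i \<in> I \<Longrightarrow> f i \<in> ?L" for I and f :: "int ^ 'n \<Rightarrow> _"
    using that by (induction I rule: infinite_finite_induct) (auto intro: zero add)
  have mono: "xconst r * fps_const (Poly_Mapping.single u 1) \<in> ?L" if "r \<in> S" for r u
  proof -
    have "xsupp (xconst r * fps_const (Poly_Mapping.single u 1) :: ('n, 'p) lseries) \<subseteq> {u}"
      by (auto simp: xsupp_def xcoeff_monomial)
    then show ?thesis
      using that is_subring_zero[OF S] finite_subset by (fastforce simp: laurent_over_def xcoeff_monomial)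
  qed
  have mono_mult: "fps_const (Poly_Mapping.single (u + w) 1 :: ('n, 'p) laurent)
      = fps_const (Poly_Mapping.single u 1) * fps_const (Poly_Mapping.single w 1)" for u w
    by (simp add: mult_single)
  have mult: "a * b \<in> ?L" if "a \<in> ?L" "b \<in> ?L" for a b
  proof -
    have "a * b = (\<Sum>v\<in>xsupp a. xconst (xcoeff a v) * fps_const (Poly_Mapping.single v 1))
        * (\<Sum>w\<in>xsupp b. xconst (xcoeff b w) * fps_const (Poly_Mapping.single w 1))"
      using laurent_over_expand[of a] laurent_over_expand[of b] that by (simp add: laurent_over_def)
    also have "\<dots> = (\<Sum>v\<in>xsupp a. \<Sum>w\<in>xsupp b.
        xconst (xcoeff a v * xcoeff b w) * fps_const (Poly_Mapping.single (v + w) 1))"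
      unfolding sum_product xconst_mult mono_mult by (intro sum.cong refl) (simp only: mult_ac)
    also have "\<dots> \<in> ?L"
      using that by (intro sum mono is_subring_mult[OF S]) (auto simp: laurent_over_def)
    finally show ?thesis .
  qed
  have "1 \<in> ?L"
    using mono[OF is_subring_one[OF S], of 0] by simp
  then show ?thesis
    using diff mult by (simp add: is_subring_def)
qed

lemma xconst_in_laurent_over:
  assumes "is_subring S" "r \<in> S"
  shows "(xconst r :: ('n::finite, 'p::prime_card) lseries) \<in> laurent_over S"
proof -
  have c: "xcoeff (xconst r :: ('n, 'p) lseries) v = (if v = 0 then r else 0)" for v :: "int ^ 'n"
    using xcoeff_monomial[of r 0 v] by auto
  then have "xsupp (xconst r :: ('n, 'p) lseries) \<subseteq> {0}"
    by (auto simp: xsupp_def)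
  then show ?thesis
    using assms is_subring_zero finite_subset by (fastforce simp: laurent_over_def c)
qed

lemma cartier_x_in_laurent_over:
  fixes h :: "('n::finite, 'p::prime_card) lseries"
  assumes "h \<in> laurent_over S"
  shows "cartier_x h \<in> laurent_over S"
  using assms inj_smult_CARD[where ?'p = 'p and ?'n = 'n]
  by (auto simp: laurent_over_def xsupp_cartier_x xcoeff_cartier_x intro: finite_vimageI)

section \<open>Inverses and Frobenius lift of power series\<close>

lemma finv_right: "fps_nth F 0 = 1 \<Longrightarrow> F * finv F = 1"
  unfolding finv_def by (rule fps_right_inverse) simp

lemma finv_left: "fps_nth F 0 = 1 \<Longrightarrow> finv F * F = 1"
  using finv_right by (simp add: mult.commute)

lemma finv_unique: "F * A = 1 \<Longrightarrow> fps_nth F 0 = 1 \<Longrightarrow> finv F = A"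
  by (metis finv_left mult.assoc mult_1 mult_1_right)

lemma fps_nth_frob:
  assumes "p > 0"
  shows "fps_nth (frob p a) n = (if p dvd n then fps_nth a (n div p) else 0)"
proof -
  have "fps_nth (frob p a) n = (\<Sum>i=0..n. if n = p * i then fps_nth a i else 0)"
    unfolding frob_def fps_compose_nth
    by (intro sum.cong refl) (simp add: fps_X_power_nth flip: power_mult)
  also have "\<dots> = (if p dvd n then fps_nth a (n div p) else 0)"
  proof (cases "p dvd n")
    case True
    then obtain j where j: "n = p * j" ..
    have "(\<Sum>i=0..n. if n = p * i then fps_nth a i else 0) = (\<Sum>i=0..n. if i = j then fps_nth a i else 0)"
      using assms j by (intro sum.cong) auto
    then show ?thesis
      using assms j by simp
  next
    case False
    then have "(\<Sum>i=0..n. if n = p * i then fps_nth a i else 0) = 0"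
      by (intro sum.neutral) auto
    then show ?thesis
      using False by simp
  qed
  finally show ?thesis .
qed

lemma frob_mult:
  assumes "p > 0"
  shows "frob p (a * b) = frob p a * frob p b"
proof (rule fps_ext)
  fix n
  show "fps_nth (frob p (a * b)) n = fps_nth (frob p a * frob p b) n"
  proof (cases "p dvd n")
    case True
    then obtain m where n: "n = p * m" ..
    let ?t = "\<lambda>i. fps_nth (frob p a) i * fps_nth (frob p b) (n - i)"
    have "fps_nth (frob p a * frob p b) n = (\<Sum>i=0..n. ?t i)"
      by (rule fps_mult_nth)
    also have "\<dots> = (\<Sum>i\<in>(*) p ` {0..m}. ?t i)"
      using assms n by (intro sum.mono_neutral_right) (auto simp: fps_nth_frob dvd_def)
    also have "\<dots> = (\<Sum>i=0..m. ?t (p * i))"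
      using assms by (subst sum.reindex) (auto intro: inj_onI)
    also have "\<dots> = (\<Sum>i=0..m. fps_nth a i * fps_nth b (m - i))"
      using assms n by (intro sum.cong refl) (simp add: fps_nth_frob flip: right_diff_distrib')
    finally show ?thesis
      using assms n by (simp add: fps_nth_frob fps_mult_nth)
  next
    case False
    then have "\<not> p dvd i \<or> \<not> p dvd n - i" if "i \<le> n" for i
      using that by (metis dvd_diffD)
    then have "fps_nth (frob p a * frob p b) n = 0"
      unfolding fps_mult_nth using assms by (intro sum.neutral) (auto simp: fps_nth_frob)
    then show ?thesis
      using False assms by (simp add: fps_nth_frob)
  qed
qed

lemma frob_one [simp]: "frob p 1 = 1"
  unfolding frob_def by simp

lemma xcoeff_frob:
  fixes a :: "('n::finite, 'p::prime_card) lseries"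
  shows "xcoeff (frob CARD('p) a) v = frob CARD('p) (xcoeff a v)"
  by (rule fps_ext) (simp add: fps_nth_frob)

section \<open>The coefficient ring\<close>

lemma frob_add: "p > 0 \<Longrightarrow> frob p (a + b) = frob p a + frob p b"
  by (rule fps_ext) (simp add: fps_nth_frob)

lemma frob_const: "p > 0 \<Longrightarrow> frob p (fps_const c) = fps_const c"
  by (rule fps_ext) (auto simp: fps_nth_frob elim!: dvdE)

lemma frob_X_power:
  assumes "p > 0"
  shows "frob p (fps_X ^ m :: 'a::comm_ring_1 fps) = fps_X ^ (p * m)"
  by (rule fps_ext) (use assms in \<open>auto simp: fps_nth_frob fps_X_power_nth elim!: dvdE\<close>)

lemma is_subring_range_fps_of_poly: "is_subring (range (fps_of_poly :: 'a::comm_ring_1 poly \<Rightarrow> _))"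
  unfolding is_subring_def
  by (auto simp flip: fps_of_poly_1 fps_of_poly_diff fps_of_poly_mult)

lemma frob_fps_of_poly:
  fixes a :: "'p::prime_card padic_int poly"
  shows "frob CARD('p) (fps_of_poly a) \<in> range fps_of_poly"
    and "of_nat CARD('p) dvd fps_of_poly a ^ CARD('p) - frob CARD('p) (fps_of_poly a)"
proof (induction a)
  case 0
  have "frob CARD('p) (0 :: 'p padic_int fps) = 0"
    by (rule fps_ext) (simp add: fps_nth_frob)
  then show "frob CARD('p) (fps_of_poly 0 :: 'p padic_int fps) \<in> range fps_of_poly"
    and "of_nat CARD('p) dvd (fps_of_poly 0 :: 'p padic_int fps) ^ CARD('p) - frob CARD('p) (fps_of_poly 0)"
    by (auto simp: zero_power intro: range_eqI[of _ _ 0])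
next
  case (pCons c a)
  let ?p = "CARD('p)"
  let ?a = "fps_of_poly a"
  have e: "fps_of_poly (pCons c a) = fps_const c + ?a * fps_X ^ 1"
    by (simp add: fps_of_poly_pCons)
  have f: "frob ?p (fps_of_poly (pCons c a)) = fps_const c + frob ?p ?a * fps_X ^ ?p"
    unfolding e by (simp only: frob_add frob_mult frob_const frob_X_power zero_less_card_finite mult_1_right)
  obtain b where b: "frob ?p ?a = fps_of_poly b"
    using pCons by blast
  have "frob ?p (fps_of_poly (pCons c a)) = fps_of_poly ([:c:] + b * Polynomial.monom 1 ?p)"
    unfolding f b by (simp add: fps_of_poly_add fps_of_poly_mult fps_of_poly_monom fps_of_poly_const)
  then show "frob ?p (fps_of_poly (pCons c a)) \<in> range fps_of_poly"
    by blast
  obtain d where "c ^ ?p - c = of_nat ?p * d"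
    using padic_fermat[of c] by (elim dvdE)
  then have "fps_const c ^ ?p - fps_const c = of_nat ?p * fps_const d"
    by (metis fps_const_mult fps_const_power fps_const_sub fps_of_nat)
  then have "of_nat ?p dvd fps_const c ^ ?p - fps_const c"
    by simp
  moreover have "of_nat ?p dvd (?a * fps_X ^ 1) ^ ?p - frob ?p ?a * fps_X ^ ?p"
  proof -
    have "(?a * fps_X ^ 1) ^ ?p - frob ?p ?a * fps_X ^ ?p = (?a ^ ?p - frob ?p ?a) * fps_X ^ ?p"
      by (simp add: power_mult_distrib algebra_simps)
    then show ?thesis
      using pCons by simp
  qed
  ultimately show "of_nat ?p dvd fps_of_poly (pCons c a) ^ ?p - frob ?p (fps_of_poly (pCons c a))"
    unfolding f unfolding e by (intro prime_dvd_power_add prime_CARD)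
qed

text \<open>The Laurent polynomials \<open>1 - t\<^sup>m g\<close>; for \<open>m = p\<^sup>s\<close> this is the s-th Frobenius twist of \<open>f\<close>.\<close>

definition twist :: "nat \<Rightarrow> ('n::finite, 'p::prime_card) laurent \<Rightarrow> ('n, 'p) lseries"
  where "twist m g = 1 - fps_X ^ m * fps_const g"

lemma frob_twist: "frob CARD('p) (twist m g) = twist (CARD('p) * m) (g :: ('n::finite, 'p::prime_card) laurent)"
proof -
  have "twist m g + fps_X ^ m * fps_const g = 1"
    by (simp add: twist_def)
  then have "frob CARD('p) (twist m g) + fps_X ^ (CARD('p) * m) * fps_const g = 1"
    by (metis frob_add frob_const frob_mult frob_one frob_X_power zero_less_card_finite)
  then show ?thesis
    by (simp add: twist_def eq_diff_eq)
qed

lemma f_of_eq_twist: "f_of g = twist 1 g"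
  by (simp add: f_of_def twist_def)

lemma xcoeff_X_power_const:
  "xcoeff (fps_X ^ m * fps_const g) v = fps_of_poly (Polynomial.monom (Poly_Mapping.lookup g v) m)"
  by (rule fps_ext) (simp add: fps_X_power_mult_nth)

lemma xsupp_X_power_const: "xsupp (fps_X ^ m * fps_const g) \<subseteq> Poly_Mapping.keys g"
  by (auto simp: xsupp_def xcoeff_X_power_const in_keys_iff)

lemma twist_in_laurent_over:
  assumes "is_subring S" "range fps_of_poly \<subseteq> S"
  shows "twist m g \<in> laurent_over S"
proof -
  have "fps_X ^ m * fps_const g \<in> laurent_over S"
    using assms(2) finite_subset[OF xsupp_X_power_const]
    by (auto simp: laurent_over_def xcoeff_X_power_const)
  then show ?thesis
    unfolding twist_def using is_subring_laurent_over[OF assms(1)]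
    by (intro is_subring_diff is_subring_one)
qed

lemma hasse_witt_poly: "hasse_witt g \<in> range fps_of_poly"
proof -
  have "f_of g ^ (CARD('p) - 1) \<in> laurent_over (range fps_of_poly)" for g :: "('n::finite, 'p::prime_card) laurent"
    unfolding f_of_eq_twist
    by (intro is_subring_power is_subring_laurent_over is_subring_range_fps_of_poly
        twist_in_laurent_over order_refl)
  then show ?thesis
    by (auto simp: laurent_over_def hasse_witt_def)
qed

lemma fps_nth_hasse_witt_0: "fps_nth (hasse_witt g) 0 = 1"
  by (simp add: hasse_witt_def f_of_def fps_nth_power_0)

text \<open>The ring \<open>\<int>\<^sub>p[t, \<beta>\<^sup>-\<^sup>1]\<close> inside \<open>\<int>\<^sub>p[[t]]\<close>, whose p-adic closure is the coefficient ring.\<close>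

definition coeff_ring_dense :: "('n::finite, 'p::prime_card) laurent \<Rightarrow> 'p padic_int fps set"
  where "coeff_ring_dense g = {fps_of_poly a * finv (hasse_witt g) ^ k | a k. True}"

lemma coeff_ring_iff:
  "r \<in> coeff_ring (g :: ('n::finite, 'p::prime_card) laurent)
    \<longleftrightarrow> (\<forall>m. \<exists>s\<in>coeff_ring_dense g. of_nat CARD('p) ^ m dvd r - s)"
  by (simp add: coeff_ring_def coeff_ring_dense_def)

lemma is_subring_coeff_ring_dense: "is_subring (coeff_ring_dense g)"
proof -
  obtain b where b: "hasse_witt g = fps_of_poly b"
    using hasse_witt_poly by blast
  let ?i = "finv (hasse_witt g)"
  have i: "fps_of_poly b * ?i = 1"
    using finv_right[OF fps_nth_hasse_witt_0, of g] by (simp add: b)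
  have i': "fps_of_poly b ^ k * ?i ^ k = 1" for k
    using i by (metis power_mult_distrib power_one)
  show ?thesis
    unfolding is_subring_def
  proof (intro conjI ballI)
    show "1 \<in> coeff_ring_dense g"
    proof -
      have "1 = fps_of_poly 1 * ?i ^ 0" by simp
      then show ?thesis unfolding coeff_ring_dense_def by blast
    qed
    fix x y assume "x \<in> coeff_ring_dense g" "y \<in> coeff_ring_dense g"
    then obtain a k c l where x: "x = fps_of_poly a * ?i ^ k" and y: "y = fps_of_poly c * ?i ^ l"
      by (auto simp: coeff_ring_dense_def)
    have "x = fps_of_poly a * ?i ^ k * (fps_of_poly b ^ l * ?i ^ l)"
      and "y = fps_of_poly c * ?i ^ l * (fps_of_poly b ^ k * ?i ^ k)"
      by (simp_all only: i' x y mult_1_right)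
    then have "x - y = fps_of_poly (a * b ^ l - c * b ^ k) * ?i ^ (k + l)"
      by (simp add: fps_of_poly_diff fps_of_poly_mult fps_of_poly_power power_add algebra_simps)
    then show "x - y \<in> coeff_ring_dense g"
      unfolding coeff_ring_dense_def by blast
    have "x * y = fps_of_poly (a * c) * ?i ^ (k + l)"
      by (simp add: x y fps_of_poly_mult power_add algebra_simps)
    then show "x * y \<in> coeff_ring_dense g"
      unfolding coeff_ring_dense_def by blast
  qed
qed

lemma coeff_ring_dense_subset: "coeff_ring_dense g \<subseteq> coeff_ring g"
  unfolding subset_iff coeff_ring_iff by (metis diff_self dvd_0_right)

lemma range_fps_of_poly_subset_coeff_ring: "range fps_of_poly \<subseteq> coeff_ring g"
proof -
  have "fps_of_poly a \<in> coeff_ring_dense g" for a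
  proof -
    have "fps_of_poly a = fps_of_poly a * finv (hasse_witt g) ^ 0" by simp
    then show ?thesis unfolding coeff_ring_dense_def by blast
  qed
  then show ?thesis
    using coeff_ring_dense_subset[of g] by blast
qed

lemma finv_hasse_witt_in_coeff_ring: "finv (hasse_witt g) \<in> coeff_ring g"
proof -
  have "finv (hasse_witt g) \<in> coeff_ring_dense g"
  proof -
    have "finv (hasse_witt g) = fps_of_poly 1 * finv (hasse_witt g) ^ 1" by simp
    then show ?thesis unfolding coeff_ring_dense_def by blast
  qed
  then show ?thesis
    using coeff_ring_dense_subset[of g] by blast
qed

lemma is_subring_coeff_ring:
  fixes g :: "('n::finite, 'p::prime_card) laurent"
  shows "is_subring (coeff_ring g)"
  unfolding is_subring_def
proof (intro conjI ballI)
  let ?S = "coeff_ring_dense g"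
  note S = is_subring_coeff_ring_dense[of g]
  show "1 \<in> coeff_ring g"
    using is_subring_one[OF S] coeff_ring_dense_subset[of g] by (rule rev_subsetD)
  fix x y assume x: "x \<in> coeff_ring g" and y: "y \<in> coeff_ring g"
  show "x - y \<in> coeff_ring g"
    unfolding coeff_ring_iff
  proof
    fix m
    obtain a b where ab: "a \<in> ?S" "b \<in> ?S" "of_nat CARD('p) ^ m dvd x - a" "of_nat CARD('p) ^ m dvd y - b"
      using x y unfolding coeff_ring_iff by blast
    have "(x - y) - (a - b) = (x - a) - (y - b)" by simp
    then show "\<exists>s\<in>?S. of_nat CARD('p) ^ m dvd x - y - s"
      using ab is_subring_diff[OF S] by (metis dvd_diff)
  qed
  show "x * y \<in> coeff_ring g"
    unfolding coeff_ring_iff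
  proof
    fix m
    obtain a b where ab: "a \<in> ?S" "b \<in> ?S" "of_nat CARD('p) ^ m dvd x - a" "of_nat CARD('p) ^ m dvd y - b"
      using x y unfolding coeff_ring_iff by blast
    have "x * y - a * b = x * (y - b) + (x - a) * b" by (simp add: algebra_simps)
    then have "of_nat CARD('p) ^ m dvd x * y - a * b"
      using ab by simp
    then show "\<exists>s\<in>?S. of_nat CARD('p) ^ m dvd x * y - s"
      using ab is_subring_mult[OF S] by blast
  qed
qed

lemma coeff_ring_closed:
  fixes g :: "('n::finite, 'p::prime_card) laurent"
  assumes "\<And>m. \<exists>s\<in>coeff_ring g. of_nat CARD('p) ^ m dvd r - s"
  shows "r \<in> coeff_ring g"
  unfolding coeff_ring_iff
proof
  fix m
  obtain s where s: "s \<in> coeff_ring g" "of_nat CARD('p) ^ m dvd r - s"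
    using assms by blast
  obtain a where a: "a \<in> coeff_ring_dense g" "of_nat CARD('p) ^ m dvd s - a"
    using s unfolding coeff_ring_iff by blast
  have "of_nat CARD('p) ^ m dvd (r - s) + (s - a)"
    using s(2) a(2) by (rule dvd_add)
  then show "\<exists>s\<in>coeff_ring_dense g. of_nat CARD('p) ^ m dvd r - s"
    using a(1) by auto
qed

text \<open>
  The ring is p-adically saturated in \<open>\<int>\<^sub>p[[t]]\<close>: since \<open>\<beta>\<close> is a unit of \<open>\<int>\<^sub>p[[t]]\<close>,
  division by \<open>p\<close> reduces to division of polynomials.
\<close>

lemma coeff_ring_dense_saturated:
  fixes g :: "('n::finite, 'p::prime_card) laurent"
  assumes "of_nat CARD('p) ^ m * z \<in> coeff_ring_dense g"
  shows "z \<in> coeff_ring_dense g"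
proof -
  let ?b = "hasse_witt g" and ?i = "finv (hasse_witt g)"
  have i: "?b * ?i = 1"
    by (rule finv_right[OF fps_nth_hasse_witt_0])
  have i': "?b ^ k * ?i ^ k = 1" for k
    using i by (metis power_mult_distrib power_one)
  obtain a k where a: "of_nat CARD('p) ^ m * z = fps_of_poly a * ?i ^ k"
    using assms by (auto simp: coeff_ring_dense_def)
  define y where "y = z * ?b ^ k"
  have y: "of_nat (CARD('p) ^ m) * y = fps_of_poly a"
  proof -
    have "of_nat (CARD('p) ^ m) * y = (of_nat CARD('p) ^ m * z) * ?b ^ k"
      by (simp add: y_def mult.assoc)
    also have "\<dots> = fps_of_poly a * (?b ^ k * ?i ^ k)"
      unfolding a by (simp add: ac_simps)
    finally show ?thesis by (simp add: i')
  qed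
  \<comment> \<open>\<open>y\<close> is a polynomial, since \<open>p\<^sup>m y\<close> is one and \<open>p\<close> is not a zero divisor\<close>
  have "fps_nth y n = 0" if "n > Polynomial.degree a" for n
  proof -
    have "of_nat (CARD('p) ^ m) * fps_nth y n = 0"
      using that arg_cong[OF y, of "\<lambda>u. fps_nth u n"]
      by (simp only: fps_mult_of_nat_nth fps_of_poly_nth Polynomial.coeff_eq_0)
    then have "of_nat CARD('p) ^ m * fps_nth y n = 0"
      by simp
    then show ?thesis
      by (induction m) (auto simp: mult.assoc dest: padic_prime_cancel)
  qed
  then have "y = fps_of_poly (\<Sum>i\<le>Polynomial.degree a. Polynomial.monom (fps_nth y i) i)"
    by (intro fps_ext) (auto simp: Polynomial.coeff_sum Polynomial.coeff_monom not_le)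
  then obtain c where c: "y = fps_of_poly c" by blast
  have "z = y * ?i ^ k"
    unfolding y_def by (simp add: mult.assoc i')
  then show ?thesis
    unfolding coeff_ring_dense_def c by blast
qed

lemma coeff_ring_saturated:
  fixes g :: "('n::finite, 'p::prime_card) laurent"
  assumes "of_nat CARD('p) ^ m * z \<in> coeff_ring g"
  shows "z \<in> coeff_ring g"
  unfolding coeff_ring_iff
proof
  fix l
  obtain s where s: "s \<in> coeff_ring_dense g" "of_nat CARD('p) ^ (m + l) dvd of_nat CARD('p) ^ m * z - s"
    using assms unfolding coeff_ring_iff by blast
  then obtain y where y: "of_nat CARD('p) ^ m * z - s = of_nat CARD('p) ^ m * (of_nat CARD('p) ^ l * y)"
    by (auto simp: dvd_def power_add mult.assoc)
  then have s': "s = of_nat CARD('p) ^ m * (z - of_nat CARD('p) ^ l * y)"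
    by (simp add: algebra_simps)
  then have "z - of_nat CARD('p) ^ l * y \<in> coeff_ring_dense g"
    using s(1) coeff_ring_dense_saturated by blast
  moreover have "of_nat CARD('p) ^ l dvd z - (z - of_nat CARD('p) ^ l * y)"
    by simp
  ultimately show "\<exists>s\<in>coeff_ring_dense g. of_nat CARD('p) ^ l dvd z - s"
    by blast
qed

text \<open>An element of \<open>R\<close> with constant coefficient 1 that is invertible modulo \<open>p\<close> is a unit of \<open>R\<close>.\<close>

lemma finv_in_coeff_ring:
  fixes g :: "('n::finite, 'p::prime_card) laurent"
  assumes b: "b \<in> coeff_ring g" "fps_nth b 0 = 1"
    and v: "v \<in> coeff_ring g" "of_nat CARD('p) dvd 1 - b * v"
  shows "finv b \<in> coeff_ring g"
proof (rule coeff_ring_closed)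
  fix m
  note R = is_subring_coeff_ring[of g]
  \<comment> \<open>partial sums of the geometric series for \<open>b\<^sup>-\<^sup>1 = v / (1 - e)\<close>\<close>
  let ?e = "1 - b * v"
  let ?s = "v * (\<Sum>i<m. ?e ^ i)"
  have "b * ?s = 1 - ?e ^ m"
    using sum_gp_basic one_diff_power_eq[of ?e m] by (simp add: mult.assoc[symmetric])
  then have "finv b * (1 - ?e ^ m) = finv b * b * ?s"
    by (simp add: mult.assoc)
  then have "finv b * (1 - ?e ^ m) = ?s"
    by (simp only: finv_left[OF b(2)] mult_1)
  then have "finv b - ?s = finv b * ?e ^ m"
    by (simp only: right_diff_distrib mult_1_right flip: \<open>finv b * (1 - ?e ^ m) = ?s\<close>) simp
  moreover have "of_nat CARD('p) ^ m dvd ?e ^ m"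
    using v(2) by (rule dvd_power_same)
  ultimately have "of_nat CARD('p) ^ m dvd finv b - ?s"
    by simp
  moreover have "?s \<in> coeff_ring g"
    using b v by (intro is_subring_mult[OF R] is_subring_sum[OF R] is_subring_power[OF R]
        is_subring_diff[OF R] is_subring_one[OF R])
  ultimately show "\<exists>s\<in>coeff_ring g. of_nat CARD('p) ^ m dvd finv b - s"
    by blast
qed

text \<open>All Frobenius twists of \<open>\<beta>\<close> are units of the coefficient ring, being congruent to powers of \<open>\<beta>\<close>.\<close>

lemma finv_frob_hasse_witt_in_coeff_ring:
  fixes g :: "('n::finite, 'p::prime_card) laurent"
  shows "finv ((frob CARD('p) ^^ s) (hasse_witt g)) \<in> coeff_ring g"
proof -
  let ?p = "CARD('p)" and ?b = "hasse_witt g"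
  have *: "(frob ?p ^^ s) ?b \<in> range fps_of_poly \<and> fps_nth ((frob ?p ^^ s) ?b) 0 = 1
    \<and> of_nat ?p dvd ?b ^ (?p ^ s) - (frob ?p ^^ s) ?b"
  proof (induction s)
    case 0
    then show ?case using hasse_witt_poly[of g] by (simp add: fps_nth_hasse_witt_0)
  next
    case (Suc s)
    let ?c = "(frob ?p ^^ s) ?b"
    obtain a where a: "?c = fps_of_poly a" using Suc by blast
    have "of_nat ?p dvd (?b ^ (?p ^ s)) ^ ?p - ?c ^ ?p"
      using Suc by (intro dvd_power_diff) blast
    then have "of_nat ?p dvd ((?b ^ (?p ^ s)) ^ ?p - ?c ^ ?p) + (?c ^ ?p - frob ?p ?c)"
      using frob_fps_of_poly(2)[of a] unfolding a by (rule dvd_add)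
    then have "of_nat ?p dvd ?b ^ (?p ^ Suc s) - frob ?p ?c"
      by (simp add: mult.commute flip: power_mult)
    moreover have "frob ?p ?c \<in> range fps_of_poly"
      using frob_fps_of_poly(1)[of a] unfolding a .
    ultimately show ?case
      using Suc by (simp add: fps_nth_frob)
  qed
  let ?c = "(frob ?p ^^ s) ?b" and ?v = "finv ?b ^ (?p ^ s)"
  have "?b ^ (?p ^ s) * ?v = 1"
    using finv_right[OF fps_nth_hasse_witt_0, of g] by (metis power_mult_distrib power_one)
  then have "1 - ?c * ?v = (?b ^ (?p ^ s) - ?c) * ?v"
    by (simp add: algebra_simps)
  then have "of_nat ?p dvd 1 - ?c * ?v"
    using * by simp
  moreover have "?v \<in> coeff_ring g"
    by (intro is_subring_power is_subring_coeff_ring finv_hasse_witt_in_coeff_ring)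
  ultimately show ?thesis
    using * range_fps_of_poly_subset_coeff_ring[of g] by (intro finv_in_coeff_ring[of _ _ ?v]) auto
qed

section \<open>Supports in dilates of a convex set\<close>

text \<open>The support of \<open>a\<close> lies in \<open>k D\<close>.\<close>

definition supp_in :: "('n::finite, 'p::prime_card) lseries \<Rightarrow> nat \<Rightarrow> (real ^ 'n) set \<Rightarrow> bool"
  where "supp_in a k D \<longleftrightarrow> real_vec ` xsupp a \<subseteq> (\<lambda>y. real k *\<^sub>R y) ` D"

lemma real_vec_add: "real_vec (u + w) = real_vec u + real_vec w"
  by (simp add: real_vec_def vec_eq_iff)

lemma real_vec_smult: "real_vec (int k *s v) = real k *\<^sub>R real_vec v"
  by (simp add: real_vec_def vec_eq_iff)

lemma real_vec_zero: "real_vec 0 = 0"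
  by (simp add: real_vec_def vec_eq_iff)

lemma supp_in_add: "supp_in a k D \<Longrightarrow> supp_in b k D \<Longrightarrow> supp_in (a + b) k D"
  using xsupp_add[of a b] unfolding supp_in_def by blast

lemma supp_in_diff: "supp_in a k D \<Longrightarrow> supp_in b k D \<Longrightarrow> supp_in (a - b) k D"
  using xsupp_diff[of a b] unfolding supp_in_def by blast

lemma supp_in_zero: "supp_in 0 k D"
  by (simp add: supp_in_def)

lemma supp_in_xconst_mult: "supp_in a k D \<Longrightarrow> supp_in (xconst r * a) k D"
  using xsupp_xconst_mult[of r a] unfolding supp_in_def by blast

lemma supp_in_mult_general:
  assumes "supp_in a j A" "supp_in b k B"
    and "\<And>x y. x \<in> A \<Longrightarrow> y \<in> B \<Longrightarrow> real j *\<^sub>R x + real k *\<^sub>R y \<in> (\<lambda>y. real (j + k) *\<^sub>R y) ` C"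
  shows "supp_in (a * b) (j + k) C"
  unfolding supp_in_def
proof
  fix z assume "z \<in> real_vec ` xsupp (a * b)"
  then obtain u w where "z = real_vec u + real_vec w" "u \<in> xsupp a" "w \<in> xsupp b"
    using xsupp_mult[of a b] by (auto simp: real_vec_add)
  moreover obtain x y where "real_vec u = real j *\<^sub>R x" "x \<in> A" "real_vec w = real k *\<^sub>R y" "y \<in> B"
    using assms(1,2) calculation(2,3) unfolding supp_in_def by blast
  ultimately show "z \<in> (\<lambda>y. real (j + k) *\<^sub>R y) ` C"
    using assms(3) by simp
qed

lemma supp_in_mult:
  assumes "convex D" "supp_in a j D" "supp_in b k D"
  shows "supp_in (a * b) (j + k) D"
  using assms(2,3)
proof (rule supp_in_mult_general)
  fix x y assume xy: "x \<in> D" "y \<in> D"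
  show "real j *\<^sub>R x + real k *\<^sub>R y \<in> (\<lambda>y. real (j + k) *\<^sub>R y) ` D"
  proof (cases "j + k = 0")
    case True
    then show ?thesis using xy by auto
  next
    case False
    let ?z = "(real j / real (j + k)) *\<^sub>R x + (real k / real (j + k)) *\<^sub>R y"
    have "?z \<in> D"
      using False xy assms(1) by (intro convexD) (auto simp flip: add_divide_distrib)
    moreover have "real j *\<^sub>R x + real k *\<^sub>R y = real (j + k) *\<^sub>R ?z"
      using False by (simp add: scaleR_add_right del: of_nat_add)
    ultimately show ?thesis by blast
  qed
qed

lemma supp_in_mult_interior:
  assumes "convex D" "supp_in a j (interior D)" "supp_in b k D" "j > 0"
  shows "supp_in (a * b) (j + k) (interior D)"
  using assms(2,3)
proof (rule supp_in_mult_general)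
  fix x y assume xy: "x \<in> interior D" "y \<in> D"
  let ?e = "real j / real (j + k)"
  have e: "0 < ?e" "?e \<le> 1" using assms(4) by auto
  let ?z = "y - ?e *\<^sub>R (y - x)"
  have "?z \<in> interior D"
    using assms(1) xy e by (intro mem_interior_convex_shrink) auto
  moreover have "real j *\<^sub>R x + real k *\<^sub>R y = real (j + k) *\<^sub>R ?z"
  proof -
    have "real (j + k) *\<^sub>R ?z = real (j + k) *\<^sub>R y - (real (j + k) * ?e) *\<^sub>R (y - x)"
      by (simp only: scaleR_diff_right scaleR_scaleR)
    also have "real (j + k) * ?e = real j" using assms(4) by simp
    finally show ?thesis by (simp add: algebra_simps)
  qed
  ultimately show "real j *\<^sub>R x + real k *\<^sub>R y \<in> (\<lambda>y. real (j + k) *\<^sub>R y) ` interior D"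
    by blast
qed

lemma supp_in_one: "0 \<in> D \<Longrightarrow> supp_in 1 k D"
  using xsupp_one unfolding supp_in_def by (force simp: real_vec_zero)

lemma supp_in_power:
  assumes "convex D" "0 \<in> D" "supp_in a j D"
  shows "supp_in (a ^ n) (n * j) D"
proof (induction n)
  case 0
  then show ?case using supp_in_one[OF assms(2)] by simp
next
  case (Suc n)
  then show ?case using supp_in_mult[OF assms(1,3)] by simp
qed

lemma supp_in_cartier_x:
  fixes a :: "('n::finite, 'p::prime_card) lseries"
  assumes "supp_in a (CARD('p) * k) D"
  shows "supp_in (cartier_x a) k D"
  unfolding supp_in_def
proof
  fix z assume "z \<in> real_vec ` xsupp (cartier_x a)"
  then obtain v where v: "z = real_vec v" "int CARD('p) *s v \<in> xsupp a"
    by (auto simp: xsupp_cartier_x)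
  have "real_vec (int CARD('p) *s v) \<in> (\<lambda>y. real (CARD('p) * k) *\<^sub>R y) ` D"
    using assms v(2) unfolding supp_in_def by blast
  then obtain y where y: "real CARD('p) *\<^sub>R real_vec v = real (CARD('p) * k) *\<^sub>R y" "y \<in> D"
    unfolding real_vec_smult by blast
  then have "real CARD('p) *\<^sub>R real_vec v = real CARD('p) *\<^sub>R (real k *\<^sub>R y)"
    by simp
  then have "real_vec v = real k *\<^sub>R y"
    by (subst (asm) real_vector.scale_cancel_left) simp
  then show "z \<in> (\<lambda>y. real k *\<^sub>R y) ` D"
    using v y by blast
qed

lemma numerators_iff: "h \<in> numerators R \<mu> k \<longleftrightarrow> h \<in> laurent_over R \<and> supp_in h k \<mu>"
  by (simp add: numerators_def supp_in_def)

section \<open>Submodules, cosets and completions\<close>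

text \<open>
  \<open>R\<close>-submodules of the ambient ring. When \<open>R\<close> is a subring it contains \<open>-1\<close>, so closure under
  subtraction follows.
\<close>

definition is_submodule :: "'p::prime_card padic_int fps set \<Rightarrow> ('n::finite, 'p) lseries set \<Rightarrow> bool"
  where "is_submodule R M \<longleftrightarrow> 0 \<in> M \<and> (\<forall>x\<in>M. \<forall>y\<in>M. x + y \<in> M) \<and> (\<forall>r\<in>R. \<forall>x\<in>M. xconst r * x \<in> M)"

lemma is_submoduleD:
  assumes "is_submodule R M"
  shows submodule_zero: "0 \<in> M"
    and submodule_add: "x \<in> M \<Longrightarrow> y \<in> M \<Longrightarrow> x + y \<in> M"
    and submodule_scale: "r \<in> R \<Longrightarrow> x \<in> M \<Longrightarrow> xconst r * x \<in> M"
  using assms by (auto simp: is_submodule_def)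

lemma submodule_diff:
  assumes "is_submodule R M" "is_subring R" "x \<in> M" "y \<in> M"
  shows "x - y \<in> M"
proof -
  have "0 - 1 \<in> R"
    using assms(2) by (intro is_subringD(2) is_subringD(4) is_subringD(1))
  then have "x + xconst (0 - 1) * y \<in> M"
    using assms by (intro submodule_add submodule_scale)
  then show ?thesis
    by (simp only: xconst_diff xconst_zero xconst_one) simp
qed

lemma submodule_sum:
  assumes "is_submodule R M" "\<And>i. i \<in> I \<Longrightarrow> f i \<in> M"
  shows "(\<Sum>i\<in>I. f i) \<in> M"
  using assms(2)
  by (induction I rule: infinite_finite_induct)
    (auto intro: submodule_zero[OF assms(1)] submodule_add[OF assms(1)])

lemma mem_elt_set_times: "x \<in> c *o M \<longleftrightarrow> (\<exists>y\<in>M. x = c * y)"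
  by (auto simp: elt_set_times_def)

lemma mem_elt_set_plus: "(x :: 'a::comm_ring_1) \<in> w +o N \<longleftrightarrow> x - w \<in> N"
  by (auto simp: elt_set_plus_def intro: bexI[of _ "x - w"])

lemma is_submodule_times:
  assumes "is_submodule R M"
  shows "is_submodule R (c *o M)"
  unfolding is_submodule_def
proof (intro conjI ballI)
  show "0 \<in> c *o M"
    using submodule_zero[OF assms] by (force simp: mem_elt_set_times)
  show "x + y \<in> c *o M" if "x \<in> c *o M" "y \<in> c *o M" for x y
    using that submodule_add[OF assms] by (auto simp: mem_elt_set_times simp flip: distrib_left)
  show "xconst r * x \<in> c *o M" if "r \<in> R" "x \<in> c *o M" for r x
    using that submodule_scale[OF assms] by (auto simp: mem_elt_set_times mult.left_commute)
qed

lemma submodule_times_subset: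
  assumes "is_submodule R M" "is_subring R"
  shows "of_nat n *o M \<subseteq> M"
proof
  fix x assume "x \<in> of_nat n *o M"
  then obtain y where "y \<in> M" "x = xconst (of_nat n) * y"
    by (auto simp: mem_elt_set_times xconst_of_nat)
  then show "x \<in> M"
    using assms by (auto intro: submodule_scale is_subring_of_nat)
qed

lemma submodule_power_times_mono:
  assumes "is_submodule R M" "is_subring R" "l \<le> m"
  shows "of_nat p ^ m *o M \<subseteq> of_nat p ^ l *o M"
proof
  fix x assume "x \<in> of_nat p ^ m *o M"
  then obtain y where y: "y \<in> M" "x = of_nat p ^ m * y"
    by (auto simp: mem_elt_set_times)
  have "x = of_nat p ^ l * (of_nat (p ^ (m - l)) * y)"
    using assms(3) by (simp add: y(2) flip: mult.assoc power_add)
  moreover have "of_nat (p ^ (m - l)) * y \<in> M"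
    using submodule_times_subset[OF assms(1,2), of "p ^ (m - l)"] y(1)
    by (auto simp: mem_elt_set_times subset_iff)
  ultimately show "x \<in> of_nat p ^ l *o M"
    by (auto simp: mem_elt_set_times)
qed

lemma coset_eqI:
  assumes "is_submodule R N" "is_subring R" "w - w' \<in> N"
  shows "w +o N = w' +o N"
proof -
  have "w' - w \<in> N"
    using submodule_diff[OF assms(1,2) submodule_zero[OF assms(1)] assms(3)] by simp
  then have "x - w' \<in> N \<longleftrightarrow> x - w \<in> N" for x
    using submodule_add[OF assms(1), of "x - w" "w - w'"] submodule_add[OF assms(1), of "x - w'" "w' - w"]
      assms(3) by auto
  then show ?thesis
    by (auto simp: mem_elt_set_plus)
qed

lemma completion_coset:
  assumes "is_submodule R M" "is_subring R" "\<omega> \<in> completion p M" "w \<in> \<omega> m"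
  shows "w \<in> M" "\<omega> m = w +o (of_nat p ^ m *o M)"
proof -
  let ?N = "of_nat p ^ m *o M"
  have N: "is_submodule R ?N" "?N \<subseteq> M"
    using assms(1) submodule_times_subset[OF assms(1,2), of "p ^ m"]
    by (auto intro: is_submodule_times)
  obtain w0 where w0: "w0 \<in> M" "\<omega> m = w0 +o ?N"
    using assms(3) unfolding completion_def by blast
  then have d: "w - w0 \<in> ?N"
    using assms(4) by (simp add: mem_elt_set_plus)
  show "\<omega> m = w +o ?N"
    unfolding w0 using coset_eqI[OF N(1) assms(2) d] by simp
  have "w = w0 + (w - w0)" by simp
  then show "w \<in> M"
    using submodule_add[OF assms(1) w0(1), of "w - w0"] d N(2) by auto
qed

lemma completion_nonempty:
  assumes "is_submodule R M" "\<omega> \<in> completion p M"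
  shows "\<exists>w. w \<in> \<omega> m"
proof -
  obtain w0 where w0: "w0 \<in> M" "\<omega> m = w0 +o (of_nat p ^ m *o M)"
    using assms(2) unfolding completion_def by blast
  then have "w0 \<in> \<omega> m"
    using submodule_zero[OF is_submodule_times[OF assms(1)]] by (simp add: mem_elt_set_plus)
  then show ?thesis ..
qed

lemma completion_antimono:
  assumes "\<omega> \<in> completion p M" "l \<le> m"
  shows "\<omega> m \<subseteq> \<omega> l"
  using assms(2)
proof (induction m rule: dec_induct)
  case (step m)
  have "\<omega> (Suc m) \<subseteq> \<omega> m"
    using assms(1) unfolding completion_def by blast
  then show ?case using step.IH by (rule order_trans)
qed simp

lemma completionI:
  assumes "is_submodule R M" "is_subring R"
    and "\<And>m. \<exists>w\<in>M. \<omega> m = w +o (of_nat p ^ m *o M)" "\<And>m. \<exists>x. x \<in> \<omega> m \<and> x \<in> \<omega> (Suc m)"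
  shows "\<omega> \<in> completion p M"
  unfolding completion_def
proof (intro CollectI conjI allI)
  show "\<exists>w\<in>M. \<omega> m = w +o (of_nat p ^ m *o M)" for m
    by (rule assms(3))
  fix m
  obtain x where x: "x \<in> \<omega> m" "x \<in> \<omega> (Suc m)"
    using assms(4) by blast
  have coset: "\<omega> l = x +o (of_nat p ^ l *o M)" if "x \<in> \<omega> l" for l
  proof -
    obtain w where w: "w \<in> M" "\<omega> l = w +o (of_nat p ^ l *o M)"
      using assms(3) by blast
    show ?thesis
      unfolding w(2)
      by (rule coset_eqI[OF is_submodule_times[OF assms(1)] assms(2), symmetric])
        (use that w in \<open>simp add: mem_elt_set_plus\<close>)
  qed
  show "\<omega> (Suc m) \<subseteq> \<omega> m"
    unfolding coset[OF x(1)] coset[OF x(2)]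
    using submodule_power_times_mono[OF assms(1,2), of m "Suc m" p] by (auto simp: mem_elt_set_plus)
qed

text \<open>
  An element of the completion of \<open>M\<close> that vanishes modulo \<open>p\<^sup>s\<close> is \<open>p\<^sup>s\<close> times an element of the completion.
  This uses that \<open>p\<close> is not a zero divisor.
\<close>

lemma completion_divide_power:
  fixes M :: "('n::finite, 'p::prime_card) lseries set"
  assumes M: "is_submodule R M" and R: "is_subring R"
    and \<omega>: "\<omega> \<in> completion CARD('p) M" "0 \<in> \<omega> s"
  shows "\<omega> \<in> compl_scale CARD('p) M (of_nat CARD('p) ^ s) ` completion CARD('p) M"
proof -
  let ?p = "of_nat CARD('p) :: ('n, 'p) lseries"
  define \<eta> where "\<eta> m = {w \<in> M. ?p ^ s * w \<in> \<omega> (m + s)}" for m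
  have cancel: "x = y" if "?p ^ k * x = ?p ^ k * y" for x y k
    using that by (induction k) (auto simp: mult.assoc dest: lseries_prime_cancel)
  have ex: "\<exists>w\<in>M. \<omega> (m + s) = ?p ^ s * w +o (?p ^ (m + s) *o M) \<and> \<eta> m = w +o (?p ^ m *o M)" for m
  proof -
    obtain v where v: "v \<in> \<omega> (m + s)"
      using completion_nonempty[OF M \<omega>(1)] by blast
    then have "v \<in> \<omega> s"
      using completion_antimono[OF \<omega>(1), of s "m + s"] by auto
    then obtain w where w: "w \<in> M" "v = ?p ^ s * w"
      unfolding completion_coset(2)[OF M R \<omega>] by (auto simp: mem_elt_set_plus mem_elt_set_times)
    have c: "\<omega> (m + s) = ?p ^ s * w +o (?p ^ (m + s) *o M)"
      using completion_coset(2)[OF M R \<omega>(1) v] by (simp add: w(2))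
    have "x \<in> \<eta> m \<longleftrightarrow> x \<in> w +o (?p ^ m *o M)" for x
    proof
      assume "x \<in> \<eta> m"
      then obtain y where y: "y \<in> M" "?p ^ s * x - ?p ^ s * w = ?p ^ (m + s) * y"
        by (auto simp: \<eta>_def c mem_elt_set_plus mem_elt_set_times)
      then have "?p ^ s * (x - w) = ?p ^ s * (?p ^ m * y)"
        by (simp add: algebra_simps power_add)
      then show "x \<in> w +o (?p ^ m *o M)"
        using y(1) by (auto simp: mem_elt_set_plus mem_elt_set_times dest: cancel)
    next
      assume "x \<in> w +o (?p ^ m *o M)"
      then obtain y where y: "y \<in> M" "x - w = ?p ^ m * y"
        by (auto simp: mem_elt_set_plus mem_elt_set_times)
      then have "x = w + xconst (of_nat CARD('p) ^ m) * y"
        by (simp add: xconst_power xconst_of_nat algebra_simps)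
      then have "x \<in> M"
        using w(1) y(1) by (auto intro!: submodule_add[OF M] submodule_scale[OF M] is_subring_power[OF R]
            is_subring_of_nat[OF R])
      moreover have "?p ^ s * x - ?p ^ s * w = ?p ^ s * (x - w)"
        by (simp only: right_diff_distrib)
      then have "?p ^ s * x - ?p ^ s * w = ?p ^ (m + s) * y"
        unfolding y(2) by (simp add: power_add mult_ac)
      ultimately show "x \<in> \<eta> m"
        using y(1) by (auto simp: \<eta>_def c mem_elt_set_plus mem_elt_set_times)
    qed
    then show ?thesis
      using w(1) c by blast
  qed
  have mem: "w \<in> \<eta> m" if "\<eta> m = w +o (?p ^ m *o M)" for w m
    using that submodule_zero[OF is_submodule_times[OF M]] by (simp add: mem_elt_set_plus)
  have "\<eta> \<in> completion CARD('p) M"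
  proof (rule completionI[OF M R])
    fix m
    show "\<exists>w\<in>M. \<eta> m = w +o (?p ^ m *o M)"
      using ex by blast
    have "\<eta> (Suc m) \<subseteq> \<eta> m"
      using completion_antimono[OF \<omega>(1), of "m + s" "Suc m + s"] by (auto simp: \<eta>_def)
    then show "\<exists>x. x \<in> \<eta> m \<and> x \<in> \<eta> (Suc m)"
      using ex[of "Suc m"] mem by blast
  qed
  moreover have "\<omega> = compl_scale CARD('p) M (?p ^ s) \<eta>"
  proof
    fix m
    obtain w where w: "w \<in> M" "\<omega> (m + s) = ?p ^ s * w +o (?p ^ (m + s) *o M)" "\<eta> m = w +o (?p ^ m *o M)"
      using ex by blast
    have "?p ^ s * w \<in> \<omega> (m + s)"
      using mem[OF w(3)] by (simp add: \<eta>_def)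
    then have "?p ^ s * w \<in> \<omega> m"
      using completion_antimono[OF \<omega>(1), of m "m + s"] by auto
    then have "\<omega> m = ?p ^ s * w +o (?p ^ m *o M)"
      by (rule completion_coset(2)[OF M R \<omega>(1)])
    also have "\<dots> = (?p ^ s *o \<eta> m) + (?p ^ m *o M)"
    proof (intro equalityI subsetI)
      fix x assume "x \<in> ?p ^ s * w +o (?p ^ m *o M)"
      moreover have "?p ^ s * w \<in> ?p ^ s *o \<eta> m"
        using mem[OF w(3)] by (auto simp: mem_elt_set_times)
      ultimately show "x \<in> (?p ^ s *o \<eta> m) + (?p ^ m *o M)"
        by (auto simp: elt_set_plus_def set_plus_def)
    next
      fix x assume "x \<in> (?p ^ s *o \<eta> m) + (?p ^ m *o M)"
      then obtain y z where x: "x = ?p ^ s * y + z" "y - w \<in> ?p ^ m *o M" "z \<in> ?p ^ m *o M"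
      proof -
        obtain u z where "u \<in> ?p ^ s *o \<eta> m" "z \<in> ?p ^ m *o M" "x = u + z"
          using \<open>x \<in> (?p ^ s *o \<eta> m) + _\<close> by (auto simp: set_plus_def)
        moreover obtain y where "y \<in> \<eta> m" "u = ?p ^ s * y"
          using calculation(1) unfolding mem_elt_set_times by blast
        ultimately show ?thesis
          using that unfolding w(3) mem_elt_set_plus by blast
      qed
      have "x - ?p ^ s * w = xconst (of_nat CARD('p) ^ s) * (y - w) + z"
        by (simp add: x(1) xconst_power xconst_of_nat algebra_simps)
      also have "\<dots> \<in> ?p ^ m *o M"
        using x(2,3) is_subring_power[OF R is_subring_of_nat[OF R]]
        by (intro submodule_add[OF is_submodule_times[OF M]] submodule_scale[OF is_submodule_times[OF M]])
      finally show "x \<in> ?p ^ s * w +o (?p ^ m *o M)"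
        by (simp add: mem_elt_set_plus)
    qed
    finally show "\<omega> m = compl_scale CARD('p) M (?p ^ s) \<eta> m"
      by (simp add: compl_scale_def)
  qed
  ultimately show ?thesis by blast
qed

section \<open>The module of rational functions\<close>

lemma numerators_zero: "is_subring R \<Longrightarrow> 0 \<in> numerators R \<mu> k"
  by (simp add: numerators_iff supp_in_zero is_subring_zero is_subring_laurent_over)

lemma numerators_add:
  "is_subring R \<Longrightarrow> h \<in> numerators R \<mu> k \<Longrightarrow> h' \<in> numerators R \<mu> k \<Longrightarrow> h + h' \<in> numerators R \<mu> k"
  by (simp add: numerators_iff supp_in_add is_subring_add is_subring_laurent_over)

lemma numerators_scale:
  "is_subring R \<Longrightarrow> r \<in> R \<Longrightarrow> h \<in> numerators R \<mu> k \<Longrightarrow> xconst r * h \<in> numerators R \<mu> k"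
  by (simp add: numerators_iff supp_in_xconst_mult is_subring_mult is_subring_laurent_over
      xconst_in_laurent_over)

text \<open>
  Extension by 0 of a family of numerators indexed by \<open>{1..K}\<close>. It allows two representations to be
  brought to a common length and then added.
\<close>

definition truncate_family :: "nat \<Rightarrow> (nat \<Rightarrow> ('n::finite, 'p::prime_card) lseries) \<Rightarrow> nat \<Rightarrow> ('n, 'p) lseries"
  where "truncate_family K h k = (if k \<in> {1..K} then h k else 0)"

lemma sum_truncate_family:
  assumes "K \<le> K'" "\<And>k. f k 0 = 0"
  shows "(\<Sum>k=1..K'. f k (truncate_family K h k)) = (\<Sum>k=1..K. f k (h k))"
proof -
  have "(\<Sum>k=1..K'. f k (truncate_family K h k)) = (\<Sum>k=1..K. f k (truncate_family K h k))"
    using assms by (intro sum.mono_neutral_right) (auto simp: truncate_family_def)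
  then show ?thesis
    by (simp add: truncate_family_def)
qed

lemma represented_truncate: "K \<le> K' \<Longrightarrow> represented F K' (truncate_family K h) = represented F K h"
  unfolding represented_def by (rule sum_truncate_family) auto

lemma cartier_term_zero: "cartier_term F k 0 r = 0"
  by (simp add: cartier_term_def Let_def)

lemma cartier_partial_sum_truncate:
  "K \<le> K' \<Longrightarrow> cartier_partial_sum F K' (truncate_family K h) N = cartier_partial_sum F K h N"
  unfolding cartier_partial_sum_def by (rule sum_truncate_family) (auto simp: cartier_term_zero)

lemma families_truncate: "is_subring R \<Longrightarrow> (K, h) \<in> families R \<mu> \<Longrightarrow> (K', truncate_family K h) \<in> families R \<mu>"
  by (auto simp: families_def truncate_family_def numerators_zero)

lemma represented_add: "represented F K (\<lambda>k. h k + h' k) = represented F K h + represented F K h'"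
  by (simp add: represented_def sum.distrib algebra_simps)

lemma represented_scale: "represented F K (\<lambda>k. xconst r * h k) = xconst r * represented F K h"
  by (simp add: represented_def sum_distrib_left algebra_simps)

lemma cartier_partial_sum_add:
  "cartier_partial_sum F K (\<lambda>k. h k + h' k) N = cartier_partial_sum F K h N + cartier_partial_sum F K h' N"
  by (simp add: cartier_partial_sum_def cartier_term_def Let_def sum.distrib cartier_x_add algebra_simps)

lemma cartier_partial_sum_scale:
  "cartier_partial_sum F K (\<lambda>k. xconst r * h k) N = xconst r * cartier_partial_sum F K h N"
  by (simp add: cartier_partial_sum_def cartier_term_def Let_def sum_distrib_left cartier_x_xconst_mult
      mult.assoc mult.left_commute[of _ "xconst r"])

lemma families_add:
  "is_subring R \<Longrightarrow> (K, h) \<in> families R \<mu> \<Longrightarrow> (K, h') \<in> families R \<mu> \<Longrightarrow> (K, \<lambda>k. h k + h' k) \<in> families R \<mu>"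
  by (auto simp: families_def intro: numerators_add)

lemma families_scale:
  "is_subring R \<Longrightarrow> r \<in> R \<Longrightarrow> (K, h) \<in> families R \<mu> \<Longrightarrow> (K, \<lambda>k. xconst r * h k) \<in> families R \<mu>"
  by (auto simp: families_def intro: numerators_scale)

lemma OmegaE:
  assumes "w \<in> Omega R \<mu> F"
  obtains K h where "(K, h) \<in> families R \<mu>" "represented F K h = w"
  using assms by (auto simp: Omega_def)

lemma is_submodule_Omega:
  assumes R: "is_subring R"
  shows "is_submodule R (Omega R \<mu> F)"
  unfolding is_submodule_def
proof (intro conjI ballI)
  have "(0, \<lambda>_. 0) \<in> families R \<mu>" "represented F 0 (\<lambda>_. 0) = 0"
    by (auto simp: families_def represented_def)
  then show "0 \<in> Omega R \<mu> F"
    unfolding Omega_def by force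
  show "x + y \<in> Omega R \<mu> F" if x: "x \<in> Omega R \<mu> F" and y: "y \<in> Omega R \<mu> F" for x y
  proof -
    obtain K h where h: "(K, h) \<in> families R \<mu>" "represented F K h = x"
      using x by (rule OmegaE)
    obtain K' h' where h': "(K', h') \<in> families R \<mu>" "represented F K' h' = y"
      using y by (rule OmegaE)
    let ?h = "\<lambda>k. truncate_family K h k + truncate_family K' h' k"
    have "(max K K', ?h) \<in> families R \<mu>"
      using h h' R by (intro families_add families_truncate)
    moreover have "represented F (max K K') ?h = x + y"
      using h h' by (simp add: represented_add represented_truncate)
    ultimately show ?thesis
      unfolding Omega_def by force
  qed
  show "xconst r * x \<in> Omega R \<mu> F" if r: "r \<in> R" and x: "x \<in> Omega R \<mu> F" for r x
  proof -
    obtain K h where h: "(K, h) \<in> families R \<mu>" "represented F K h = x"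
      using x by (rule OmegaE)
    then have "(K, \<lambda>k. xconst r * h k) \<in> families R \<mu>" "represented F K (\<lambda>k. xconst r * h k) = xconst r * x"
      using R r by (auto simp: represented_scale intro: families_scale)
    then show ?thesis
      unfolding Omega_def by force
  qed
qed

lemma Omega_generator:
  assumes R: "is_subring R" and h: "h \<in> numerators R \<mu> k" "k > 0"
  shows "of_nat (fact (k - 1)) * (h * finv F ^ k) \<in> Omega R \<mu> F"
proof -
  let ?h = "\<lambda>i. if i = k then h else 0"
  have "(k, ?h) \<in> families R \<mu>"
    using h R by (auto simp: families_def numerators_zero)
  moreover have "represented F k ?h = (\<Sum>i=1..k. if i = k then of_nat (fact (k - 1)) * (h * finv F ^ k) else 0)"
    unfolding represented_def by (intro sum.cong refl) auto
  then have "represented F k ?h = of_nat (fact (k - 1)) * (h * finv F ^ k)"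
    using h(2) by simp
  ultimately show ?thesis
    unfolding Omega_def by force
qed

section \<open>Truncated binomial series\<close>

text \<open>The expansion of \<open>(1 + a)\<^bsup>-(j+1)\<^esup>\<close> truncated after \<open>N\<close> terms.\<close>

definition binomial_partial :: "'a::comm_ring_1 \<Rightarrow> nat \<Rightarrow> nat \<Rightarrow> 'a"
  where "binomial_partial a j N = (\<Sum>r<N. (- 1) ^ r * of_nat ((j + r) choose r) * a ^ r)"

text \<open>
  The truncations for consecutive \<open>j\<close> differ by the factor \<open>1 + a\<close>, up to a single monomial of degree \<open>N + 1\<close>.
\<close>

lemma binomial_partial_Suc:
  "binomial_partial a j (Suc N) = (1 + a) * binomial_partial a (Suc j) (Suc N)
    + (- 1) ^ Suc N * of_nat ((j + Suc N) choose N) * a ^ Suc N"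
proof (induction N)
  case 0
  then show ?case by (simp add: binomial_partial_def)
next
  case (Suc N)
  let ?s = "(- 1) ^ Suc N * a ^ Suc N :: 'a"
  have pascal: "of_nat ((Suc j + Suc N) choose Suc N)
      = (of_nat ((j + Suc N) choose N) + of_nat ((j + Suc N) choose Suc N) :: 'a)"
    by (simp flip: of_nat_add)
  have "binomial_partial a j (Suc (Suc N))
      = binomial_partial a j (Suc N) + ?s * of_nat ((j + Suc N) choose Suc N)"
    by (simp add: binomial_partial_def mult_ac)
  moreover have "binomial_partial a (Suc j) (Suc (Suc N))
      = binomial_partial a (Suc j) (Suc N) + ?s * of_nat ((Suc j + Suc N) choose Suc N)"
    by (simp add: binomial_partial_def mult_ac)
  moreover have "(j + Suc (Suc N)) choose Suc N = (Suc j + Suc N) choose Suc N"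
    by simp
  ultimately show ?case
    by (simp only: Suc.IH pascal) (simp add: algebra_simps)
qed

lemma binomial_partial_inverse:
  "a ^ N dvd (1 + a) ^ Suc j * binomial_partial a j N - 1"
proof (cases N)
  case 0
  then show ?thesis by simp
next
  case (Suc M)
  show ?thesis
  proof (induction j)
    case 0
    have "(1 + a) * binomial_partial a 0 N = 1 - (- a) ^ N"
      using one_diff_power_eq[of "- a" N]
      by (simp add: binomial_partial_def flip: power_mult_distrib)
    then have "(1 + a) ^ Suc 0 * binomial_partial a 0 N - 1 = a ^ N * (- ((- 1) ^ N))"
      by (simp add: power_minus[of a] mult.commute)
    then show ?case by (metis dvd_triv_left)
  next
    case (Suc j)
    let ?c = "(- 1) ^ N * of_nat ((j + N) choose M) * a ^ N"
    have c: "(1 + a) * binomial_partial a (Suc j) N = binomial_partial a j N - ?c"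
      using binomial_partial_Suc[of a j M] unfolding \<open>N = Suc M\<close> by (simp only: add_diff_cancel_right')
    have "(1 + a) ^ Suc (Suc j) * binomial_partial a (Suc j) N
        = (1 + a) ^ Suc j * ((1 + a) * binomial_partial a (Suc j) N)"
      by (simp only: power_Suc2[of _ "Suc j"] mult.assoc)
    then have "(1 + a) ^ Suc (Suc j) * binomial_partial a (Suc j) N - 1
        = ((1 + a) ^ Suc j * binomial_partial a j N - 1) - (1 + a) ^ Suc j * ?c"
      unfolding c by (simp only: right_diff_distrib diff_diff_eq add.commute)
    moreover have "a ^ N dvd (1 + a) ^ Suc j * ?c"
      by (intro dvd_mult) simp
    ultimately show ?case
      using Suc by (simp only: dvd_diff)
  qed
qed

lemma binomial_partial_shift:
  assumes "N > 0"
  shows "binomial_partial a j N = (1 + a) ^ d * binomial_partial a (j + d) N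
    + (\<Sum>i<d. (- 1) ^ N * of_nat ((j + i + N) choose (N - 1)) * (a ^ N * (1 + a) ^ i))"
proof (induction d)
  case (Suc d)
  have "binomial_partial a (j + d) N = (1 + a) * binomial_partial a (j + Suc d) N
      + (- 1) ^ N * of_nat ((j + d + N) choose (N - 1)) * a ^ N"
    using assms binomial_partial_Suc[of a "j + d" "N - 1"] by simp
  then show ?case
    unfolding Suc by (simp add: algebra_simps)
qed simp

section \<open>One step of the Cartier operation\<close>

lemma ceiling_divide_eq:
  assumes "k > 0" "p > 0"
  shows "nat \<lceil>real k / real p\<rceil> = Suc ((k - 1) div p)"
proof -
  let ?q = "(k - 1) div p"
  have "p * ?q \<le> k - 1" by simp
  then have "p * ?q < k" using assms(1) by linarith
  have "k - 1 < p * Suc ?q"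
    using assms(2) by (metis dividend_less_times_div mult.commute mult_Suc_right)
  then have "k \<le> p * Suc ?q" using assms(1) by linarith
  have "real p * real ?q < real k"
    using \<open>p * ?q < k\<close> by (simp flip: of_nat_mult)
  moreover have "real k \<le> real p * real (Suc ?q)"
    using \<open>k \<le> p * Suc ?q\<close> by (simp only: of_nat_le_iff flip: of_nat_mult)
  ultimately have "\<lceil>real k / real p\<rceil> = int (Suc ?q)"
    using assms(2) by (intro ceiling_unique) (simp_all add: field_simps)
  then show ?thesis by simp
qed

lemma xconst_uminus_one: "xconst (- 1) = - 1"
  using xconst_diff[of 0 1] by simp

lemma submodule_sign:
  assumes "is_submodule R M" "is_subring R" "x \<in> M"
  shows "(- 1) ^ r * x \<in> M"
proof (induction r)
  case (Suc r)
  then have "0 - (- 1) ^ r * x \<in> M"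
    using assms by (intro submodule_diff[OF assms(1,2)] submodule_zero[OF assms(1)])
  then show ?case by simp
qed (use assms in simp)

lemma of_nat_dvd_cartier_x:
  assumes "of_nat n dvd a"
  shows "of_nat n dvd cartier_x a"
  using assms by (auto simp: dvd_def cartier_x_of_nat_mult)

lemma of_nat_dvd_xcoeff:
  assumes "of_nat n dvd a"
  shows "of_nat n dvd xcoeff a v"
  using assms by (auto simp: dvd_def xcoeff_of_nat_mult)

text \<open>
  \<open>w'\<close> represents the image of \<open>w\<close> under the Cartier operation modulo \<open>p\<^sup>m\<close>. Working with this relation
  between elements of \<open>\<Omega>\<close> for \<open>F\<close> and for \<open>F\<^sup>\<sigma>\<close> avoids algebra with sequences of cosets.
\<close>

definition cartier_rel ::
    "'p::prime_card padic_int fps set \<Rightarrow> (real ^ 'n::finite) set \<Rightarrow> ('n, 'p) lseries \<Rightarrow> nat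
      \<Rightarrow> ('n, 'p) lseries \<Rightarrow> ('n, 'p) lseries \<Rightarrow> bool"
  where "cartier_rel R \<mu> F m w w' \<longleftrightarrow> w \<in> Omega R \<mu> F \<and> w' \<in> Omega R \<mu> (frob CARD('p) F) \<and>
    (\<forall>K h. (K, h) \<in> families R \<mu> \<and> represented F K h = w \<longrightarrow>
      (\<forall>\<^sub>F N in sequentially. cartier_partial_sum F K h N - w'
         \<in> of_nat CARD('p) ^ m *o Omega R \<mu> (frob CARD('p) F)))"

text \<open>
  The data for one application of the Cartier operation, from \<open>\<Omega>\<close> for \<open>F\<close> to \<open>\<Omega>\<close> for \<open>F\<^sup>\<sigma>\<close>. Here \<open>D\<close> is a convex
  set that contains the Newton polytope of \<open>F\<close> and has 0 as its only interior lattice point, and \<open>G\<close> is the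
  Laurent polynomial with \<open>F\<^sup>p = F\<^sup>\<sigma>(x\<^sup>p) + p G\<close>. For \<open>p = 2\<close> the operation is assumed to exist.
\<close>

locale cartier_step =
  fixes R :: "'p::prime_card padic_int fps set" and D :: "(real ^ 'n::finite) set"
    and F G :: "('n, 'p) lseries"
  assumes subring: "is_subring R"
    and constants: "\<And>c. fps_const c \<in> R"
    and convex: "convex D"
    and lattice: "{v. real_vec v \<in> interior D} = {0}"
    and F_coeff: "F \<in> laurent_over R"
    and F_0: "fps_nth F 0 = 1"
    and F_supp: "supp_in F 1 D"
    and G_coeff: "G \<in> laurent_over R"
    and G_supp: "supp_in G CARD('p) D"
    and G_eq: "F ^ CARD('p) = xpow (frob CARD('p) F) + of_nat CARD('p) * G"
    and exists_2: "CARD('p) = 2 \<Longrightarrow> cartier_exists R (interior D) F"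
begin

abbreviation "F' \<equiv> frob CARD('p) F"
abbreviation "\<Omega> \<equiv> Omega R (interior D) F"
abbreviation "\<Omega>' \<equiv> Omega R (interior D) F'"
abbreviation "\<Omega>'p m \<equiv> of_nat CARD('p) ^ m *o \<Omega>'"
abbreviation "num k \<equiv> numerators R (interior D) k"
abbreviation "fam \<equiv> families R (interior D)"
abbreviation "psum \<equiv> cartier_partial_sum F"

lemma p_gt_1: "CARD('p) > 1"
  using prime_CARD[where ?'p = 'p] by (rule prime_gt_1_nat)

lemma zero_in_D: "0 \<in> D" "0 \<in> interior D"
proof -
  have "real_vec 0 \<in> interior D" using lattice by blast
  then show "0 \<in> interior D" by (simp add: real_vec_zero)
  then show "0 \<in> D" using interior_subset by blast
qed

lemma F'_0: "fps_nth F' 0 = 1"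
  by (simp add: fps_nth_frob F_0)

lemma laurent_subring: "is_subring (laurent_over R :: ('n, 'p) lseries set)"
  by (rule is_subring_laurent_over[OF subring])

lemma submodule: "is_submodule R \<Omega>" "is_submodule R \<Omega>'" "is_submodule R (\<Omega>'p m)"
  using is_submodule_Omega[OF subring] is_submodule_times by blast+

lemma \<Omega>'p_subset: "\<Omega>'p m \<subseteq> \<Omega>'"
  using submodule_times_subset[OF submodule(2) subring, of "CARD('p) ^ m"] by simp

lemma defect_eq: "frob_defect F = G"
  unfolding frob_defect_def using G_eq by (intro the_equality) (auto dest: lseries_prime_cancel)

subsection \<open>Closed form of the partial sums\<close>

text \<open>
  \<open>iF\<close> is the inverse of \<open>F\<^sup>\<sigma>(x\<^sup>p)\<close>, and \<open>F\<^sup>p = F\<^sup>\<sigma>(x\<^sup>p) (1 + a)\<close>. Thus \<open>\<C>\<^sub>p\<close> is computed by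
  expanding powers of \<open>1 + a\<close>, where \<open>p\<close> divides \<open>a\<close>.
\<close>

definition iF where "iF = xpow (finv F')"

definition a where "a = of_nat CARD('p) * (G * iF)"

lemma xpow_iF: "xpow F' * iF = 1"
  unfolding iF_def by (simp flip: xpow_mult add: finv_right[OF F'_0])

lemma one_plus_a: "1 + a = F ^ CARD('p) * iF"
  unfolding G_eq a_def by (simp add: distrib_right xpow_iF mult.assoc)

lemma cartier_term_eq:
  assumes "k > 0" "j = (k - 1) div CARD('p)"
  shows "cartier_term F k h r = (- 1) ^ r * (of_nat (fact (k - 1) * ((j + r) choose r) * CARD('p) ^ r)
      * (cartier_x (h * G ^ r * F ^ (CARD('p) * Suc j - k)) * finv F' ^ (Suc j + r)))"
  unfolding cartier_term_def Let_def defect_eq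
  using ceiling_divide_eq[OF assms(1), of "CARD('p)"] assms(2) by (simp add: mult_ac)

lemma cartier_x_scalar:
  "(- 1) ^ r * (of_nat c * (cartier_x x * y)) = cartier_x ((- 1) ^ r * (of_nat c * (x * xpow y)))"
proof -
  have "cartier_x ((- 1) ^ r * (of_nat c * (x * xpow y))) = cartier_x (xconst ((- 1) ^ r) * (xconst (of_nat c) * (x * xpow y)))"
    by (simp only: xconst_power xconst_uminus_one xconst_of_nat)
  also have "\<dots> = xconst ((- 1) ^ r) * (xconst (of_nat c) * (cartier_x x * y))"
    by (simp only: cartier_x_xconst_mult cartier_x_mult_xpow)
  finally show ?thesis
    by (simp only: xconst_power xconst_uminus_one xconst_of_nat)
qed

lemma sum_cartier_term_eq:
  assumes "k > 0" "j = (k - 1) div CARD('p)"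
  shows "(\<Sum>r<N. cartier_term F k h r)
    = cartier_x (of_nat (fact (k - 1)) * (h * F ^ (CARD('p) * Suc j - k) * iF ^ Suc j) * binomial_partial a j N)"
proof -
  have "cartier_term F k h r = cartier_x (of_nat (fact (k - 1)) * (h * F ^ (CARD('p) * Suc j - k) * iF ^ Suc j)
      * ((- 1) ^ r * of_nat ((j + r) choose r) * a ^ r))" for r
    unfolding cartier_term_eq[OF assms] cartier_x_scalar
    by (rule arg_cong[where f = cartier_x])
      (simp add: a_def iF_def xpow_power xpow_mult power_add power_mult_distrib mult_ac)
  then show ?thesis
    by (simp add: binomial_partial_def sum_distrib_left cartier_x_sum)
qed

lemma psum_eq:
  "psum K h N = cartier_x (\<Sum>k=1..K. of_nat (fact (k - 1))
     * (h k * F ^ (CARD('p) * Suc ((k - 1) div CARD('p)) - k) * iF ^ Suc ((k - 1) div CARD('p)))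
     * binomial_partial a ((k - 1) div CARD('p)) N)"
  unfolding cartier_partial_sum_def cartier_x_sum
  by (intro sum.cong refl sum_cartier_term_eq) auto

lemma le_pole_order: "k > 0 \<Longrightarrow> k \<le> CARD('p) * Suc ((k - 1) div CARD('p))"
proof -
  assume "k > 0"
  have "k - 1 < CARD('p) * Suc ((k - 1) div CARD('p))"
    using p_gt_1 by (metis dividend_less_times_div mult_Suc_right zero_less_card_finite add.commute)
  then show ?thesis by linarith
qed

lemma F_finv_power: "k \<le> n \<Longrightarrow> F ^ n * finv F ^ k = F ^ (n - k)"
proof -
  assume "k \<le> n"
  then have "F ^ n * finv F ^ k = F ^ (n - k) * (F ^ k * finv F ^ k)"
    by (simp flip: mult.assoc power_add)
  also have "F ^ k * finv F ^ k = 1"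
    using finv_right[OF F_0] by (metis power_mult_distrib power_one)
  finally show ?thesis by simp
qed

text \<open>
  Modulo \<open>p\<^sup>N\<close> in the ambient ring, the N-th partial sum is the Cartier operation on expansions. In
  contrast to convergence in \<open>\<Omega>\<close> this needs no assumption on \<open>p\<close>.
\<close>

lemma psum_cong:
  "of_nat (CARD('p) ^ N) dvd psum K h N - cartier_x (represented F K h)"
proof -
  \<comment> \<open>the inverse of \<open>1 + a\<close>\<close>
  define u where "u = xpow F' * finv F ^ CARD('p)"
  have "u * (1 + a) = (F ^ CARD('p) * finv F ^ CARD('p)) * (xpow F' * iF)"
    unfolding one_plus_a u_def by (simp add: mult_ac)
  then have u: "u * (1 + a) = 1"
    using F_finv_power[of "CARD('p)" "CARD('p)"] by (simp add: xpow_iF)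
  let ?t = "\<lambda>k. of_nat (fact (k - 1))
     * (h k * F ^ (CARD('p) * Suc ((k - 1) div CARD('p)) - k) * iF ^ Suc ((k - 1) div CARD('p)))
     * binomial_partial a ((k - 1) div CARD('p)) N"
  let ?s = "\<lambda>k. of_nat (fact (k - 1)) * (h k * finv F ^ k)"
  have "of_nat (CARD('p) ^ N) dvd ?t k - ?s k" if "k > 0" for k
  proof -
    define j where "j = (k - 1) div CARD('p)"
    let ?n = "CARD('p) * Suc j"
    have k: "k \<le> ?n" using le_pole_order[OF that] by (simp add: j_def)
    have "iF ^ Suc j * u ^ Suc j = (xpow F' * iF) ^ Suc j * finv F ^ ?n"
      unfolding u_def by (simp only: power_mult_distrib power_mult mult_ac)
    then have iu: "iF ^ Suc j * u ^ Suc j = finv F ^ (?n - k) * finv F ^ k"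
      using k by (simp add: xpow_iF flip: power_add)
    have "F ^ (?n - k) * finv F ^ (?n - k) = 1"
      using F_finv_power[of "?n - k" "?n - k"] by simp
    then have iu': "F ^ (?n - k) * (iF ^ Suc j * u ^ Suc j) = finv F ^ k"
      unfolding iu by (simp flip: mult.assoc)
    have "u ^ Suc j * ((1 + a) ^ Suc j * binomial_partial a j N - 1)
        = (u * (1 + a)) ^ Suc j * binomial_partial a j N - u ^ Suc j"
      by (simp only: power_mult_distrib right_diff_distrib mult.assoc mult_1_right)
    also have "\<dots> = binomial_partial a j N - u ^ Suc j"
      unfolding u by simp
    finally have "a ^ N dvd binomial_partial a j N - u ^ Suc j"
      using binomial_partial_inverse[of a N j] by (metis dvd_mult)
    moreover have "of_nat (CARD('p) ^ N) dvd a ^ N"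
      unfolding a_def power_mult_distrib by simp
    ultimately have "of_nat (CARD('p) ^ N) dvd of_nat (fact (k - 1)) * (h k * F ^ (?n - k) * iF ^ Suc j)
        * (binomial_partial a j N - u ^ Suc j)"
      by (meson dvd_mult dvd_trans)
    also have "\<dots> = ?t k - of_nat (fact (k - 1)) * (h k * (F ^ (?n - k) * (iF ^ Suc j * u ^ Suc j)))"
      unfolding j_def[symmetric] by (simp only: right_diff_distrib mult.assoc)
    finally show ?thesis
      unfolding iu' .
  qed
  then have "of_nat (CARD('p) ^ N) dvd (\<Sum>k=1..K. ?t k - ?s k)"
    by (intro dvd_sum) auto
  then have "of_nat (CARD('p) ^ N) dvd cartier_x ((\<Sum>k=1..K. ?t k - ?s k))"
    by (rule of_nat_dvd_cartier_x)
  moreover have "psum K h N = cartier_x (\<Sum>k=1..K. ?t k - ?s k) + cartier_x (represented F K h)"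
    unfolding psum_eq represented_def cartier_x_add[symmetric] by (simp add: sum_subtractf)
  ultimately show ?thesis by simp
qed

lemma xcoeff_psum_cong: "of_nat (CARD('p) ^ N) dvd xcoeff (psum K h N) 0 - xcoeff (represented F K h) 0"
  using of_nat_dvd_xcoeff[OF psum_cong, of N K h 0]
  by (simp add: xcoeff_diff xcoeff_cartier_x)

subsection \<open>Membership of the terms\<close>

text \<open>Multiples of functions with a pole of order \<open>n\<close>, when the integer factor absorbs \<open>(n-1)!\<close>.\<close>

lemma pole_term_mem:
  assumes "H \<in> num n" "n > 0" "(of_nat (CARD('p) ^ l * fact (n - 1)) :: 'p padic_int) dvd of_nat c"
  shows "of_nat c * (H * finv F' ^ n) \<in> \<Omega>'p l"
proof -
  define b :: nat where "b = CARD('p) ^ l * fact (n - 1)"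
  obtain d where d: "(of_nat c :: 'p padic_int) = of_nat b * d"
    using assms(3) unfolding b_def by (elim dvdE)
  have "(of_nat c :: ('n, 'p) lseries) = xconst (fps_const (of_nat c))"
    by (simp only: xconst_of_nat fps_of_nat)
  also have "\<dots> = of_nat b * xconst (fps_const d)"
    unfolding d by (simp only: fps_const_mult[symmetric] xconst_mult xconst_of_nat fps_of_nat)
  also have "of_nat b = (of_nat CARD('p) ^ l * of_nat (fact (n - 1)) :: ('n, 'p) lseries)"
    unfolding b_def by (simp only: of_nat_mult of_nat_power)
  finally have "of_nat c * (H * finv F' ^ n)
      = of_nat CARD('p) ^ l * (xconst (fps_const d) * (of_nat (fact (n - 1)) * (H * finv F' ^ n)))"
    by (simp only: mult_ac)
  moreover have "xconst (fps_const d) * (of_nat (fact (n - 1)) * (H * finv F' ^ n)) \<in> \<Omega>'"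
    using assms(1,2) constants by (intro submodule_scale[OF submodule(2)] Omega_generator subring)
  ultimately show ?thesis
    unfolding mem_elt_set_times by blast
qed

lemma cartier_x_numerator:
  assumes "h \<in> num k" "k > 0" "k + CARD('p) * r + e = CARD('p) * n"
  shows "cartier_x (h * G ^ r * F ^ e) \<in> num n"
proof -
  have h: "h \<in> laurent_over R" "supp_in h k (interior D)"
    using assms(1) by (auto simp: numerators_iff)
  have "supp_in (G ^ r * F ^ e) (r * CARD('p) + e * 1) D"
    using convex zero_in_D(1) G_supp F_supp by (intro supp_in_mult supp_in_power)
  then have "supp_in (h * (G ^ r * F ^ e)) (k + (r * CARD('p) + e * 1)) (interior D)"
    using h assms(2) convex by (intro supp_in_mult_interior)
  moreover have "k + (r * CARD('p) + e * 1) = CARD('p) * n"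
    using assms(3) by (simp add: mult.commute)
  ultimately have "supp_in (cartier_x (h * G ^ r * F ^ e)) n (interior D)"
    by (intro supp_in_cartier_x) (simp add: mult.assoc)
  moreover have "cartier_x (h * G ^ r * F ^ e) \<in> laurent_over R"
    using h(1) F_coeff G_coeff
    by (intro cartier_x_in_laurent_over is_subring_mult[OF laurent_subring] is_subring_power[OF laurent_subring])
  ultimately show ?thesis
    by (simp add: numerators_iff)
qed

lemma numerator_1_eq:
  assumes "H \<in> num 1"
  shows "H = xconst (xcoeff H 0)" "xcoeff H 0 \<in> R"
proof -
  have "real_vec v \<in> interior D" if "v \<in> xsupp H" for v
    using assms that by (auto simp: numerators_iff supp_in_def)
  then have s: "xsupp H \<subseteq> {0}"
    using lattice by auto
  show "H = xconst (xcoeff H 0)"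
  proof (rule lseries_eqI)
    fix v
    have "xcoeff (xconst (xcoeff H 0) :: ('n, 'p) lseries) v = (if 0 = v then xcoeff H 0 else 0)"
      using xcoeff_monomial[of "xcoeff H 0" 0 v] by simp
    then show "xcoeff H v = xcoeff (xconst (xcoeff H 0) :: ('n, 'p) lseries) v"
      using s xcoeff_eq_0[of v H] by auto
  qed
  show "xcoeff H 0 \<in> R"
    using assms by (auto simp: numerators_iff laurent_over_def)
qed

lemma cartier_term_mem:
  assumes h: "h \<in> num k" "k > 0"
  shows cartier_term_mem_p: "r > 0 \<or> k > CARD('p) \<Longrightarrow> cartier_term F k h r \<in> \<Omega>'p 1"
    and cartier_term_mem_pm: "CARD('p) \<noteq> 2 \<Longrightarrow> \<forall>\<^sub>F r in sequentially. cartier_term F k h r \<in> \<Omega>'p m"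
    and cartier_term_const: "k \<le> CARD('p) \<Longrightarrow>
      cartier_term F k h 0 = xconst (of_nat (fact (k - 1)) * xcoeff (h * F ^ (CARD('p) - k)) 0) * finv F'"
    and "k \<le> CARD('p) \<Longrightarrow> xcoeff (h * F ^ (CARD('p) - k)) 0 \<in> R"
proof -
  define j where "j = (k - 1) div CARD('p)"
  have H: "cartier_x (h * G ^ r * F ^ (CARD('p) * Suc j - k)) \<in> num (Suc j + r)" for r
    using h le_pole_order[OF h(2)] by (intro cartier_x_numerator) (auto simp: j_def algebra_simps)
  have dvdI: "cartier_term F k h r \<in> \<Omega>'p l"
    if "(of_nat (CARD('p) ^ l * fact (j + r)) :: 'p padic_int) dvd of_nat (fact (k - 1) * ((j + r) choose r) * CARD('p) ^ r)" for r l
    unfolding cartier_term_eq[OF h(2) j_def] using that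
    by (intro submodule_sign[OF submodule(3) subring] pole_term_mem[OF H]) auto
  show "cartier_term F k h r \<in> \<Omega>'p 1" if "r > 0 \<or> k > CARD('p)"
  proof (rule dvdI)
    have "r > 0 \<or> j > 0"
      using that p_gt_1 by (auto simp: j_def div_greater_zero_iff)
    then show "(of_nat (CARD('p) ^ 1 * fact (j + r)) :: 'p padic_int) dvd of_nat (fact (k - 1) * ((j + r) choose r) * CARD('p) ^ r)"
      using padic_cartier_factor_dvd[where ?'p = 'p, OF j_def[symmetric]] by simp
  qed
  show "\<forall>\<^sub>F r in sequentially. cartier_term F k h r \<in> \<Omega>'p m" if "CARD('p) \<noteq> 2"
    using padic_binomial_factor_tendsto[OF that, of m j]
  proof eventually_elim
    case (elim r)
    then have "(of_nat (CARD('p) ^ m * fact (j + r)) :: 'p padic_int) dvd of_nat (fact (k - 1)) * of_nat (((j + r) choose r) * CARD('p) ^ r)"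
      by (rule dvd_mult)
    then show ?case
      by (intro dvdI) (simp add: mult.assoc)
  qed
  assume "k \<le> CARD('p)"
  then have j: "j = 0"
    using h(2) by (simp add: j_def)
  have 1: "cartier_x (h * F ^ (CARD('p) - k)) \<in> num 1"
    using H[of 0] by (simp add: j)
  show "cartier_term F k h 0 = xconst (of_nat (fact (k - 1)) * xcoeff (h * F ^ (CARD('p) - k)) 0) * finv F'"
    using cartier_term_eq[OF h(2) j_def, of h 0] numerator_1_eq(1)[OF 1]
    by (simp add: j xconst_mult xconst_of_nat xcoeff_cartier_x mult.assoc)
  show "xcoeff (h * F ^ (CARD('p) - k)) 0 \<in> R"
    using numerator_1_eq(2)[OF 1] by (simp add: xcoeff_cartier_x)
qed

text \<open>
  Modulo \<open>p\<close> the image of the Cartier operation is spanned by \<open>1/F\<^sup>\<sigma>\<close>: the only term that need not be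
  divisible by \<open>p\<close> is the one with \<open>m = 1\<close> and \<open>r = 0\<close>, whose numerator is supported on interior lattice points of \<open>D\<close>.
\<close>

lemma sum_cartier_term_mod_p:
  assumes h: "h \<in> num k" "k > 0"
  shows "\<exists>c\<in>R. \<forall>N>0. (\<Sum>r<N. cartier_term F k h r) - xconst c * finv F' \<in> \<Omega>'p 1"
proof (cases "k \<le> CARD('p)")
  case True
  let ?c = "of_nat (fact (k - 1)) * xcoeff (h * F ^ (CARD('p) - k)) 0"
  have "(\<Sum>r<N. cartier_term F k h r) - xconst ?c * finv F' \<in> \<Omega>'p 1" if "N > 0" for N
  proof -
    have "{..<N} = insert 0 {1..<N}" using that by auto
    then have "(\<Sum>r<N. cartier_term F k h r) - xconst ?c * finv F' = (\<Sum>r=1..<N. cartier_term F k h r)"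
      using cartier_term_const[OF h True] by simp
    also have "\<dots> \<in> \<Omega>'p 1"
      by (intro submodule_sum[OF submodule(3)] cartier_term_mem_p[OF h]) auto
    finally show ?thesis .
  qed
  moreover have "?c \<in> R"
    using cartier_term_mem(4)[OF h True] by (intro is_subring_mult[OF subring] is_subring_of_nat[OF subring])
  ultimately show ?thesis by blast
next
  case False
  then have "(\<Sum>r<N. cartier_term F k h r) \<in> \<Omega>'p 1" for N
    by (intro submodule_sum[OF submodule(3)] cartier_term_mem_p[OF h]) simp
  then have "\<forall>N>0. (\<Sum>r<N. cartier_term F k h r) - xconst 0 * finv F' \<in> \<Omega>'p 1"
    by (simp only: xconst_zero mult_zero_left diff_zero) simp
  then show ?thesis
    using is_subring_zero[OF subring] by blast
qed

lemma psum_mod_p: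
  assumes "(K, h) \<in> fam"
  shows "\<exists>c\<in>R. \<forall>N>0. psum K h N - xconst c * finv F' \<in> \<Omega>'p 1"
proof -
  have "\<forall>k\<in>{1..K}. \<exists>c\<in>R. \<forall>N>0. (\<Sum>r<N. cartier_term F k (h k) r) - xconst c * finv F' \<in> \<Omega>'p 1"
    using assms by (intro ballI sum_cartier_term_mod_p) (auto simp: families_def)
  then obtain c where c: "\<And>k. k \<in> {1..K} \<Longrightarrow> c k \<in> R"
      "\<And>k N. k \<in> {1..K} \<Longrightarrow> N > 0 \<Longrightarrow> (\<Sum>r<N. cartier_term F k (h k) r) - xconst (c k) * finv F' \<in> \<Omega>'p 1"
    by metis
  have xs: "xconst (\<Sum>k\<in>A. c k) = (\<Sum>k\<in>A. xconst (c k))" for A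
    by (induction A rule: infinite_finite_induct) (auto simp: xconst_add)
  have "psum K h N - xconst (\<Sum>k=1..K. c k) * finv F' \<in> \<Omega>'p 1" if "N > 0" for N
    unfolding cartier_partial_sum_def xs sum_distrib_right sum_subtractf[symmetric]
    using c(2) that by (intro submodule_sum[OF submodule(3)]) auto
  then show ?thesis
    using c(1) is_subring_sum[OF subring] by blast
qed

lemma one_in_num: "1 \<in> num 1"
  using supp_in_one[OF zero_in_D(2)] is_subring_one[OF laurent_subring] by (simp add: numerators_iff)

lemma finv_represented: "(1, \<lambda>_. 1) \<in> fam" "represented F 1 (\<lambda>_. 1) = finv F"
  using one_in_num by (auto simp: families_def represented_def)

lemma finv_in_\<Omega>: "finv F \<in> \<Omega>"
  using finv_represented unfolding Omega_def by force

lemma psum_finv_mod_p: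
  assumes "N > 0"
  shows "psum 1 (\<lambda>_. 1) N - xconst (xcoeff (F ^ (CARD('p) - 1)) 0) * finv F' \<in> \<Omega>'p 1"
proof -
  have "{..<N} = insert 0 {1..<N}" using assms by auto
  then have "psum 1 (\<lambda>_. 1) N - xconst (xcoeff (F ^ (CARD('p) - 1)) 0) * finv F'
      = (\<Sum>r=1..<N. cartier_term F 1 1 r)"
    using cartier_term_const[OF one_in_num] p_gt_1 by (simp add: cartier_partial_sum_def)
  also have "\<dots> \<in> \<Omega>'p 1"
    by (intro submodule_sum[OF submodule(3)] cartier_term_mem_p[OF one_in_num]) auto
  finally show ?thesis .
qed

subsection \<open>Existence of the Cartier operation for odd p\<close>

text \<open>
  For odd \<open>p\<close> the partial sums of a representation of 0 tend to 0 in the topology of \<open>\<Omega>\<close>. Expressing the truncations of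
  \<open>(1 + a)\<^bsup>-(j+1)\<^esup>\<close> for all \<open>j\<close> through the one of largest order \<open>j = K\<close>, the main terms add up to a multiple of
  the represented function, which is 0, and only the remainders are left.
\<close>

lemma psum_null_tendsto:
  assumes "CARD('p) \<noteq> 2" "(K, h) \<in> fam" "represented F K h = 0"
  shows "\<forall>\<^sub>F N in sequentially. psum K h N \<in> \<Omega>'p l"
proof -
  define J where "J k = (k - 1) div CARD('p)" for k
  have J: "J k \<le> K" if "k \<in> {1..K}" for k
    using that div_le_dividend[of "k - 1" "CARD('p)"] unfolding J_def atLeastAtMost_iff by linarith
  let ?H = "\<lambda>N k i. cartier_x (h k * G ^ N * F ^ (CARD('p) * Suc (J k) - k + CARD('p) * i))"
  let ?c = "\<lambda>N k i. fact (k - 1) * ((J k + i + N) choose (N - 1)) * CARD('p) ^ N"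
  \<comment> \<open>the main terms cancel\<close>
  have null: "(\<Sum>k=1..K. of_nat (fact (k - 1)) * (h k * F ^ (CARD('p) * Suc (J k) - k) * iF ^ Suc (J k))
      * ((1 + a) ^ (K - J k) * E)) = 0" for E
  proof -
    have "of_nat (fact (k - 1)) * (h k * F ^ (CARD('p) * Suc (J k) - k) * iF ^ Suc (J k)) * ((1 + a) ^ (K - J k) * E)
       = (F ^ (CARD('p) * Suc K) * iF ^ Suc K * E) * (of_nat (fact (k - 1)) * (h k * finv F ^ k))"
      if k: "k \<in> {1..K}" for k
    proof -
      have K: "Suc (J k) + (K - J k) = Suc K" using J[OF k] by simp
      have k': "k \<le> CARD('p) * Suc (J k)" using le_pole_order[of k] k by (simp add: J_def)
      have "CARD('p) * Suc (J k) \<le> CARD('p) * Suc K" using J[OF k] by simp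
      then have k'': "k \<le> CARD('p) * Suc K" using k' by linarith
      have "CARD('p) * Suc (J k) + CARD('p) * (K - J k) = CARD('p) * Suc K"
        using K by (metis distrib_left)
      then have e: "(CARD('p) * Suc (J k) - k) + CARD('p) * (K - J k) = CARD('p) * Suc K - k"
        using k' by linarith
      have "F ^ (CARD('p) * Suc (J k) - k) * iF ^ Suc (J k) * (1 + a) ^ (K - J k)
          = (F ^ (CARD('p) * Suc (J k) - k) * F ^ (CARD('p) * (K - J k))) * (iF ^ Suc (J k) * iF ^ (K - J k))"
        unfolding one_plus_a power_mult_distrib power_mult by (simp only: mult_ac)
      also have "\<dots> = F ^ (CARD('p) * Suc K) * finv F ^ k * iF ^ Suc K"
        unfolding F_finv_power[OF k''] power_add[symmetric] e K ..
      finally have *: "F ^ (CARD('p) * Suc (J k) - k) * iF ^ Suc (J k) * (1 + a) ^ (K - J k)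
          = F ^ (CARD('p) * Suc K) * finv F ^ k * iF ^ Suc K" .
      have "of_nat (fact (k - 1)) * (h k * F ^ (CARD('p) * Suc (J k) - k) * iF ^ Suc (J k)) * ((1 + a) ^ (K - J k) * E)
        = of_nat (fact (k - 1)) * h k * E * (F ^ (CARD('p) * Suc (J k) - k) * iF ^ Suc (J k) * (1 + a) ^ (K - J k))"
        by (simp only: mult_ac)
      then show ?thesis
        unfolding * by (simp only: mult_ac)
    qed
    then have "(\<Sum>k=1..K. of_nat (fact (k - 1)) * (h k * F ^ (CARD('p) * Suc (J k) - k) * iF ^ Suc (J k))
        * ((1 + a) ^ (K - J k) * E)) = (F ^ (CARD('p) * Suc K) * iF ^ Suc K * E) * represented F K h"
      unfolding represented_def sum_distrib_left by (intro sum.cong) auto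
    then show ?thesis
      using assms(3) by simp
  qed
  \<comment> \<open>what is left: the remainders, with poles of order \<open>N + j + i + 1\<close>\<close>
  have psum: "psum K h N = (\<Sum>k=1..K. \<Sum>i<K - J k.
      (- 1) ^ N * (of_nat (?c N k i) * (?H N k i * finv F' ^ (Suc (J k) + N + i))))" if "N > 0" for N
  proof -
    have terms: "of_nat (fact (k - 1)) * (h k * F ^ (CARD('p) * Suc (J k) - k) * iF ^ Suc (J k)) * binomial_partial a (J k) N
      = of_nat (fact (k - 1)) * (h k * F ^ (CARD('p) * Suc (J k) - k) * iF ^ Suc (J k))
            * ((1 + a) ^ (K - J k) * binomial_partial a K N)
        + (\<Sum>i<K - J k. (- 1) ^ N * (of_nat (?c N k i) * (h k * G ^ N * F ^ (CARD('p) * Suc (J k) - k + CARD('p) * i)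
            * xpow (finv F' ^ (Suc (J k) + N + i)))))" if k: "k \<in> {1..K}" for k
    proof -
      have "binomial_partial a (J k) N = (1 + a) ^ (K - J k) * binomial_partial a K N
        + (\<Sum>i<K - J k. (- 1) ^ N * of_nat ((J k + i + N) choose (N - 1)) * (a ^ N * (1 + a) ^ i))"
        using binomial_partial_shift[OF \<open>N > 0\<close>, of a "J k" "K - J k"] J[OF k] by simp
      moreover have "of_nat (fact (k - 1)) * (h k * F ^ (CARD('p) * Suc (J k) - k) * iF ^ Suc (J k))
          * ((- 1) ^ N * of_nat ((J k + i + N) choose (N - 1)) * (a ^ N * (1 + a) ^ i))
        = (- 1) ^ N * (of_nat (?c N k i) * (h k * G ^ N * F ^ (CARD('p) * Suc (J k) - k + CARD('p) * i)
            * xpow (finv F' ^ (Suc (J k) + N + i))))" for i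
        unfolding one_plus_a unfolding a_def power_add xpow_mult xpow_power iF_def[symmetric] of_nat_mult of_nat_power
          power_mult_distrib power_mult
        by (simp only: mult_ac)
      ultimately show ?thesis
        by (simp only: distrib_left sum_distrib_left)
    qed
    let ?A = "\<lambda>k. of_nat (fact (k - 1)) * (h k * F ^ (CARD('p) * Suc (J k) - k) * iF ^ Suc (J k))
            * ((1 + a) ^ (K - J k) * binomial_partial a K N)"
    let ?B = "\<lambda>k. \<Sum>i<K - J k. (- 1) ^ N * (of_nat (?c N k i)
            * (h k * G ^ N * F ^ (CARD('p) * Suc (J k) - k + CARD('p) * i)
            * xpow (finv F' ^ (Suc (J k) + N + i))))"
    have "psum K h N = cartier_x (\<Sum>k=1..K. ?A k + ?B k)"
      unfolding psum_eq J_def[symmetric] by (intro arg_cong[where f = cartier_x] sum.cong refl terms)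
    then have "psum K h N = cartier_x (\<Sum>k=1..K. ?B k)"
      unfolding sum.distrib null by simp
    then show ?thesis
      by (simp only: cartier_x_sum cartier_x_scalar)
  qed
  \<comment> \<open>the binomial coefficient has lower entry \<open>N - 1\<close>, so the estimate is applied with \<open>r = N - 1\<close>\<close>
  have mem: "\<forall>\<^sub>F r in sequentially. \<forall>k\<in>{1..K}. \<forall>i\<in>{..<K - J k}.
      of_nat (?c (Suc r) k i) * (?H (Suc r) k i * finv F' ^ (Suc (J k) + Suc r + i)) \<in> \<Omega>'p l"
  proof (intro eventually_ball_finite finite_atLeastAtMost finite_lessThan ballI)
    fix k i assume k: "k \<in> {1..K}"
    show "\<forall>\<^sub>F r in sequentially. of_nat (?c (Suc r) k i)
        * (?H (Suc r) k i * finv F' ^ (Suc (J k) + Suc r + i)) \<in> \<Omega>'p l"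
      using padic_binomial_factor_tendsto[OF assms(1), of l "J k + i + 1"]
    proof eventually_elim
      case (elim r)
      have k': "k \<le> CARD('p) * Suc (J k)" using le_pole_order[of k] k by (simp add: J_def)
      have "?H (Suc r) k i \<in> num (Suc (J k) + Suc r + i)"
        using assms(2) k k' by (intro cartier_x_numerator) (auto simp: families_def algebra_simps)
      moreover have "(of_nat (CARD('p) ^ l * fact (Suc (J k) + Suc r + i - 1)) :: 'p padic_int) dvd of_nat (?c (Suc r) k i)"
      proof -
        have "(of_nat (CARD('p) ^ l * fact (J k + i + 1 + r)) :: 'p padic_int)
          dvd of_nat (fact (k - 1)) * of_nat (((J k + i + 1 + r) choose r) * CARD('p) ^ r) * of_nat CARD('p)"
          using elim by (intro dvd_mult2 dvd_mult)
        moreover have "?c (Suc r) k i = fact (k - 1) * (((J k + i + 1 + r) choose r) * CARD('p) ^ r) * CARD('p)"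
          by (simp add: mult_ac)
        moreover have "Suc (J k) + Suc r + i - 1 = J k + i + 1 + r" by simp
        ultimately show ?thesis
          by (simp only: of_nat_mult)
      qed
      ultimately show ?case
        by (intro pole_term_mem) auto
    qed
  qed
  have "\<forall>\<^sub>F r in sequentially. psum K h (Suc r) \<in> \<Omega>'p l"
    using mem
  proof eventually_elim
    case (elim r)
    show ?case
      unfolding psum[OF zero_less_Suc] using elim
      by (intro submodule_sum[OF submodule(3)] submodule_sign[OF submodule(3) subring]) auto
  qed
  then show ?thesis
    by (simp only: eventually_sequentially_Suc[of "\<lambda>N. psum K h N \<in> \<Omega>'p l"])
qed

lemma finv_F'_in:
  assumes "c \<in> R"
  shows "xconst c * finv F' \<in> \<Omega>'"
proof -
  have "of_nat (fact (1 - 1)) * (1 * finv F' ^ 1) \<in> \<Omega>'"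
    using one_in_num by (intro Omega_generator subring) auto
  then show ?thesis
    using assms by (intro submodule_scale[OF submodule(2)]) auto
qed

lemma psum_in_Omega:
  assumes "(K, h) \<in> fam" "N > 0"
  shows "psum K h N \<in> \<Omega>'"
proof -
  obtain c where c: "c \<in> R" "psum K h N - xconst c * finv F' \<in> \<Omega>'p 1"
    using psum_mod_p[OF assms(1)] assms(2) by blast
  then have "(psum K h N - xconst c * finv F') + xconst c * finv F' \<in> \<Omega>'"
    using \<Omega>'p_subset[of 1] finv_F'_in by (intro submodule_add[OF submodule(2)]) auto
  then show ?thesis by simp
qed

lemma psum_Cauchy:
  assumes "CARD('p) \<noteq> 2" "(K, h) \<in> fam"
  shows "\<exists>S\<in>\<Omega>'. \<forall>\<^sub>F N in sequentially. psum K h N - S \<in> \<Omega>'p m"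
proof -
  have "\<forall>\<^sub>F r in sequentially. \<forall>k\<in>{1..K}. cartier_term F k (h k) r \<in> \<Omega>'p m"
    using assms by (intro eventually_ball_finite finite_atLeastAtMost ballI cartier_term_mem_pm)
      (auto simp: families_def)
  then obtain N0 where N0: "\<And>r k. r \<ge> N0 \<Longrightarrow> k \<in> {1..K} \<Longrightarrow> cartier_term F k (h k) r \<in> \<Omega>'p m"
    unfolding eventually_sequentially by blast
  let ?S = "psum K h (Suc N0)"
  have "psum K h N - ?S \<in> \<Omega>'p m" if N: "N \<ge> Suc N0" for N
  proof -
    have "(\<Sum>r<N. t r) - (\<Sum>r<Suc N0. t r) = (\<Sum>r=Suc N0..<N. t r)" for t :: "nat \<Rightarrow> ('n, 'p) lseries"
      using sum.atLeastLessThan_concat[of 0 "Suc N0" N t] N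
      by (simp only: lessThan_atLeast0 le0) (metis add_diff_cancel_left')
    then have "psum K h N - ?S = (\<Sum>k=1..K. \<Sum>r=Suc N0..<N. cartier_term F k (h k) r)"
      unfolding cartier_partial_sum_def sum_subtractf[symmetric] by simp
    also have "\<dots> \<in> \<Omega>'p m"
      using N0 by (intro submodule_sum[OF submodule(3)]) auto
    finally show ?thesis .
  qed
  then show ?thesis
    using psum_in_Omega[OF assms(2), of "Suc N0"] unfolding eventually_sequentially by blast
qed

lemma cartier_exists_F: "cartier_exists R (interior D) F"
proof (cases "CARD('p) = 2")
  case True
  then show ?thesis by (rule exists_2)
next
  case False
  show ?thesis
    unfolding cartier_exists_def
  proof
    fix w assume "w \<in> \<Omega>"
    then obtain K h where h: "(K, h) \<in> fam" "represented F K h = w"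
      by (rule OmegaE)
    have "\<forall>m. \<exists>S. S \<in> \<Omega>' \<and> (\<forall>\<^sub>F N in sequentially. psum K h N - S \<in> \<Omega>'p m)"
      using psum_Cauchy[OF False h(1)] by blast
    then obtain S where S: "\<And>m. S m \<in> \<Omega>'" "\<And>m. \<forall>\<^sub>F N in sequentially. psum K h N - S m \<in> \<Omega>'p m"
      by metis
    define \<eta> where "\<eta> m = S m +o \<Omega>'p m" for m
    have "\<eta> \<in> completion CARD('p) \<Omega>'"
    proof (rule completionI[OF submodule(2) subring])
      show "\<exists>w\<in>\<Omega>'. \<eta> m = w +o \<Omega>'p m" for m
        using S(1) by (auto simp: \<eta>_def)
      fix m
      have "\<forall>\<^sub>F N in sequentially. psum K h N - S m \<in> \<Omega>'p m \<and> psum K h N - S (Suc m) \<in> \<Omega>'p (Suc m)"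
        by (intro eventually_conj S(2))
      then obtain N where "psum K h N - S m \<in> \<Omega>'p m" "psum K h N - S (Suc m) \<in> \<Omega>'p (Suc m)"
        using eventually_happens'[OF sequentially_bot] by blast
      then show "\<exists>x. x \<in> \<eta> m \<and> x \<in> \<eta> (Suc m)"
        unfolding \<eta>_def mem_elt_set_plus by blast
    qed
    moreover have "compl_tendsto (psum K' h') \<eta>" if h': "(K', h') \<in> fam" "represented F K' h' = w" for K' h'
      unfolding compl_tendsto_def
    proof
      fix m
      \<comment> \<open>the difference of the two representations represents 0\<close>
      let ?M = "max K K'"
      let ?h = "\<lambda>k. truncate_family K' h' k + xconst (- 1) * truncate_family K h k"
      have "- 1 \<in> R"
        using is_subring_diff[OF subring is_subring_zero[OF subring] is_subring_one[OF subring]] by simp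
      then have fam: "(?M, ?h) \<in> fam"
        using h h' by (intro families_add families_scale families_truncate subring)
      have "represented F ?M ?h = 0"
        unfolding represented_add represented_scale using h h'
        by (simp add: represented_truncate xconst_uminus_one)
      then have "\<forall>\<^sub>F N in sequentially. psum ?M ?h N \<in> \<Omega>'p m"
        by (rule psum_null_tendsto[OF False fam])
      moreover have "psum ?M ?h N = psum K' h' N - psum K h N" for N
        unfolding cartier_partial_sum_add cartier_partial_sum_scale
        by (simp add: cartier_partial_sum_truncate xconst_uminus_one)
      ultimately have "\<forall>\<^sub>F N in sequentially. psum K' h' N - psum K h N \<in> \<Omega>'p m"
        by simp
      then show "\<forall>\<^sub>F N in sequentially. psum K' h' N \<in> \<eta> m"
        using S(2)[of m]
      proof eventually_elim
        case (elim N)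
        then have "(psum K' h' N - psum K h N) + (psum K h N - S m) \<in> \<Omega>'p m"
          by (rule submodule_add[OF submodule(3)])
        then show ?case
          by (simp add: \<eta>_def mem_elt_set_plus)
      qed
    qed
    ultimately show "\<exists>\<eta>. is_cartier R (interior D) F w \<eta>"
      unfolding is_cartier_def Omega_hat_def by blast
  qed
qed

subsection \<open>The operation modulo powers of p\<close>

abbreviation "rel \<equiv> cartier_rel R (interior D) F"

lemma is_cartier_mem_iff:
  assumes "is_cartier R (interior D) F w \<eta>" "(K, h) \<in> fam" "represented F K h = w"
  shows "x \<in> \<eta> m \<longleftrightarrow> x \<in> \<Omega>' \<and> (\<forall>\<^sub>F N in sequentially. psum K h N - x \<in> \<Omega>'p m)"
proof -
  have \<eta>: "\<eta> \<in> completion CARD('p) \<Omega>'" and lim: "\<forall>\<^sub>F N in sequentially. psum K h N \<in> \<eta> m"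
    using assms by (auto simp: is_cartier_def Omega_hat_def compl_tendsto_def)
  show ?thesis
  proof
    assume x: "x \<in> \<eta> m"
    note c = completion_coset[OF submodule(2) subring \<eta> x]
    then show "x \<in> \<Omega>' \<and> (\<forall>\<^sub>F N in sequentially. psum K h N - x \<in> \<Omega>'p m)"
      using lim by (simp add: c(2) mem_elt_set_plus)
  next
    assume "x \<in> \<Omega>' \<and> (\<forall>\<^sub>F N in sequentially. psum K h N - x \<in> \<Omega>'p m)"
    then have "\<forall>\<^sub>F N in sequentially. psum K h N - x \<in> \<Omega>'p m \<and> psum K h N \<in> \<eta> m"
      using lim by (intro eventually_conj) auto
    then obtain N where N: "psum K h N - x \<in> \<Omega>'p m" "psum K h N \<in> \<eta> m"
      using eventually_happens'[OF sequentially_bot] by blast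
    have "0 - (psum K h N - x) \<in> \<Omega>'p m"
      by (rule submodule_diff[OF submodule(3) subring submodule_zero[OF submodule(3)] N(1)])
    then show "x \<in> \<eta> m"
      unfolding completion_coset(2)[OF submodule(2) subring \<eta> N(2)] by (simp add: mem_elt_set_plus)
  qed
qed

lemma is_cartier_The:
  assumes "w \<in> \<Omega>"
  shows "is_cartier R (interior D) F w (THE \<eta>. is_cartier R (interior D) F w \<eta>)"
proof -
  obtain \<eta> where \<eta>: "is_cartier R (interior D) F w \<eta>"
    using cartier_exists_F assms unfolding cartier_exists_def by blast
  obtain K h where h: "(K, h) \<in> fam" "represented F K h = w"
    using assms by (rule OmegaE)
  show ?thesis
  proof (rule theI[of _ \<eta>])
    fix \<theta> assume \<theta>: "is_cartier R (interior D) F w \<theta>"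
    have "x \<in> \<theta> m \<longleftrightarrow> x \<in> \<eta> m" for x m
      using is_cartier_mem_iff[OF \<theta> h] is_cartier_mem_iff[OF \<eta> h] by simp
    then show "\<theta> = \<eta>" by blast
  qed fact
qed

lemma rel_iff:
  assumes "w \<in> \<Omega>"
  shows "rel m w x \<longleftrightarrow> x \<in> (THE \<eta>. is_cartier R (interior D) F w \<eta>) m"
proof -
  note mem = is_cartier_mem_iff[OF is_cartier_The[OF assms]]
  obtain K h where "(K, h) \<in> fam" "represented F K h = w"
    using assms by (rule OmegaE)
  then show ?thesis
    using mem assms unfolding cartier_rel_def by blast
qed

lemma relI:
  assumes "(K, h) \<in> fam" "represented F K h = w" "x \<in> \<Omega>'"
    "\<forall>\<^sub>F N in sequentially. psum K h N - x \<in> \<Omega>'p m"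
  shows "rel m w x"
proof -
  have w: "w \<in> \<Omega>" using assms(1,2) unfolding Omega_def by force
  show ?thesis
    unfolding rel_iff[OF w] using is_cartier_mem_iff[OF is_cartier_The[OF w] assms(1,2)] assms(3,4) by simp
qed

lemma rel_ex:
  assumes "w \<in> \<Omega>"
  shows "\<exists>x. rel m w x"
proof -
  have "(THE \<eta>. is_cartier R (interior D) F w \<eta>) \<in> completion CARD('p) \<Omega>'"
    using is_cartier_The[OF assms] by (simp add: is_cartier_def Omega_hat_def)
  then show ?thesis
    unfolding rel_iff[OF assms] by (rule completion_nonempty[OF submodule(2)])
qed

lemma relD:
  assumes "rel m w x"
  shows "w \<in> \<Omega>" "x \<in> \<Omega>'"
  using assms by (auto simp: cartier_rel_def)

lemma rel_psum: "rel m w x \<Longrightarrow> (K, h) \<in> fam \<Longrightarrow> represented F K h = w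
    \<Longrightarrow> \<forall>\<^sub>F N in sequentially. psum K h N - x \<in> \<Omega>'p m"
  unfolding cartier_rel_def by blast

lemma rel_add:
  assumes x: "rel m w x" and y: "rel m v y"
  shows "rel m (w + v) (x + y)"
proof -
  obtain K h where h: "(K, h) \<in> fam" "represented F K h = w"
    using relD(1)[OF x] by (rule OmegaE)
  obtain K' h' where h': "(K', h') \<in> fam" "represented F K' h' = v"
    using relD(1)[OF y] by (rule OmegaE)
  let ?h = "\<lambda>k. truncate_family K h k + truncate_family K' h' k"
  show ?thesis
  proof (rule relI[of "max K K'" ?h])
    show "(max K K', ?h) \<in> fam"
      using h h' by (intro families_add families_truncate subring)
    show "represented F (max K K') ?h = w + v"
      using h h' by (simp add: represented_add represented_truncate)
    show "x + y \<in> \<Omega>'"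
      using relD(2)[OF x] relD(2)[OF y] by (rule submodule_add[OF submodule(2)])
    show "\<forall>\<^sub>F N in sequentially. psum (max K K') ?h N - (x + y) \<in> \<Omega>'p m"
      using rel_psum[OF x h] rel_psum[OF y h']
    proof eventually_elim
      case (elim N)
      then have "(psum K h N - x) + (psum K' h' N - y) \<in> \<Omega>'p m"
        by (rule submodule_add[OF submodule(3)])
      moreover have "psum (max K K') ?h N = psum K h N + psum K' h' N"
        unfolding cartier_partial_sum_add by (simp add: cartier_partial_sum_truncate)
      ultimately show ?case
        by (simp add: algebra_simps)
    qed
  qed
qed

lemma rel_scale:
  assumes x: "rel m w x" and r: "r \<in> R"
  shows "rel m (xconst r * w) (xconst r * x)"
proof -
  obtain K h where h: "(K, h) \<in> fam" "represented F K h = w"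
    using relD(1)[OF x] by (rule OmegaE)
  show ?thesis
  proof (rule relI[of K "\<lambda>k. xconst r * h k"])
    show "(K, \<lambda>k. xconst r * h k) \<in> fam"
      using h(1) r by (intro families_scale subring)
    show "represented F K (\<lambda>k. xconst r * h k) = xconst r * w"
      by (simp add: represented_scale h(2))
    show "xconst r * x \<in> \<Omega>'"
      using relD(2)[OF x] r by (intro submodule_scale[OF submodule(2)])
    show "\<forall>\<^sub>F N in sequentially. psum K (\<lambda>k. xconst r * h k) N - xconst r * x \<in> \<Omega>'p m"
      using rel_psum[OF x h]
    proof eventually_elim
      case (elim N)
      then have "xconst r * (psum K h N - x) \<in> \<Omega>'p m"
        by (rule submodule_scale[OF submodule(3) r])
      then show ?case
        by (simp only: cartier_partial_sum_scale right_diff_distrib)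
    qed
  qed
qed

lemma rel_diff:
  assumes x: "rel m w x" and y: "rel m v y"
  shows "rel m (w - v) (x - y)"
proof -
  have "- 1 \<in> R"
    using is_subring_diff[OF subring is_subring_zero[OF subring] is_subring_one[OF subring]] by simp
  then show ?thesis
    using rel_add[OF x rel_scale[OF y, of "- 1"]] by (simp add: xconst_uminus_one)
qed

text \<open>Multiplication by \<open>p\<^sup>s\<close> gains precision.\<close>

lemma rel_power_p:
  assumes x: "rel m w x"
  shows "rel (s + m) (of_nat CARD('p) ^ s * w) (of_nat CARD('p) ^ s * x)"
proof -
  obtain K h where h: "(K, h) \<in> fam" "represented F K h = w"
    using relD(1)[OF x] by (rule OmegaE)
  let ?r = "of_nat CARD('p) ^ s :: 'p padic_int fps"
  have r: "?r \<in> R" "xconst ?r = of_nat CARD('p) ^ s"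
    by (auto simp: xconst_power xconst_of_nat intro: is_subring_power[OF subring] is_subring_of_nat[OF subring])
  have "rel (s + m) (xconst ?r * w) (xconst ?r * x)"
  proof (rule relI[of K "\<lambda>k. xconst ?r * h k"])
    show "(K, \<lambda>k. xconst ?r * h k) \<in> fam"
      using h(1) r(1) by (intro families_scale subring)
    show "represented F K (\<lambda>k. xconst ?r * h k) = xconst ?r * w"
      by (simp only: represented_scale h(2))
    show "xconst ?r * x \<in> \<Omega>'"
      using relD(2)[OF x] r(1) by (intro submodule_scale[OF submodule(2)])
    show "\<forall>\<^sub>F N in sequentially. psum K (\<lambda>k. xconst ?r * h k) N - xconst ?r * x \<in> \<Omega>'p (s + m)"
      using rel_psum[OF x h]
    proof eventually_elim
      case (elim N)
      then obtain y where y: "y \<in> \<Omega>'" "psum K h N - x = of_nat CARD('p) ^ m * y"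
        unfolding mem_elt_set_times by blast
      have "psum K (\<lambda>k. xconst ?r * h k) N - xconst ?r * x = xconst ?r * (psum K h N - x)"
        by (simp only: cartier_partial_sum_scale right_diff_distrib)
      also have "\<dots> = of_nat CARD('p) ^ (s + m) * y"
        by (simp only: r(2) y(2) power_add mult.assoc)
      finally show ?case
        using y(1) unfolding mem_elt_set_times by blast
    qed
  qed
  then show ?thesis
    by (simp only: r(2))
qed

lemma rel_cong_right:
  assumes x: "rel m w x" and d: "y - x \<in> \<Omega>'p m"
  shows "rel m w y"
proof -
  obtain K h where h: "(K, h) \<in> fam" "represented F K h = w"
    using relD(1)[OF x] by (rule OmegaE)
  have "x + (y - x) \<in> \<Omega>'"
    using d \<Omega>'p_subset by (intro submodule_add[OF submodule(2) relD(2)[OF x]]) auto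
  then have "y \<in> \<Omega>'" by simp
  moreover have "\<forall>\<^sub>F N in sequentially. psum K h N - y \<in> \<Omega>'p m"
    using rel_psum[OF x h]
  proof eventually_elim
    case (elim N)
    then have "(psum K h N - x) - (y - x) \<in> \<Omega>'p m"
      using d by (rule submodule_diff[OF submodule(3) subring])
    then show ?case by simp
  qed
  ultimately show ?thesis
    by (rule relI[OF h])
qed

lemma rel_unique:
  assumes x: "rel m w x" and y: "rel m w y"
  shows "y - x \<in> \<Omega>'p m"
proof -
  have w: "w \<in> \<Omega>" using x by (rule relD)
  have \<eta>: "(THE \<eta>. is_cartier R (interior D) F w \<eta>) \<in> completion CARD('p) \<Omega>'"
    using is_cartier_The[OF w] by (simp add: is_cartier_def Omega_hat_def)
  show ?thesis
    using y completion_coset(2)[OF submodule(2) subring \<eta>, of x m] x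
    unfolding rel_iff[OF w] by (simp add: mem_elt_set_plus)
qed

lemma rel_cong_left:
  assumes x: "rel m w x" and d: "v - w \<in> of_nat CARD('p) ^ m *o \<Omega>"
  shows "rel m v x"
proof -
  obtain z where z: "z \<in> \<Omega>" "v - w = of_nat CARD('p) ^ m * z"
    using d unfolding mem_elt_set_times by blast
  obtain y where y: "rel 0 z y"
    using rel_ex[OF z(1)] by blast
  have "rel m (v - w) (of_nat CARD('p) ^ m * y)"
    using rel_power_p[OF y, of m] z(2) by simp
  then have "rel m (w + (v - w)) (x + of_nat CARD('p) ^ m * y)"
    by (rule rel_add[OF x])
  then have *: "rel m v (x + of_nat CARD('p) ^ m * y)"
    by simp
  have "of_nat CARD('p) ^ m * y \<in> \<Omega>'p m"
    using relD(2)[OF y] unfolding mem_elt_set_times by blast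
  then have "0 - of_nat CARD('p) ^ m * y \<in> \<Omega>'p m"
    by (intro submodule_diff[OF submodule(3) subring] submodule_zero[OF submodule(3)])
  then show ?thesis
    by (intro rel_cong_right[OF *]) simp
qed

lemma rel_mono:
  assumes x: "rel m w x" and "l \<le> m"
  shows "rel l w x"
proof -
  obtain K h where h: "(K, h) \<in> fam" "represented F K h = w"
    using relD(1)[OF x] by (rule OmegaE)
  have "\<Omega>'p m \<subseteq> \<Omega>'p l"
    by (rule submodule_power_times_mono[OF submodule(2) subring assms(2)])
  then show ?thesis
    using rel_psum[OF x h] by (intro relI[OF h relD(2)[OF x]]) (auto elim: eventually_mono)
qed

lemma rel_mod_p:
  assumes "rel m w x" "m > 0"
  shows "\<exists>c\<in>R. x - xconst c * finv F' \<in> \<Omega>'p 1"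
proof -
  obtain K h where h: "(K, h) \<in> fam" "represented F K h = w"
    using relD(1)[OF assms(1)] by (rule OmegaE)
  obtain c where c: "c \<in> R" "\<And>N. N > 0 \<Longrightarrow> psum K h N - xconst c * finv F' \<in> \<Omega>'p 1"
    using psum_mod_p[OF h(1)] by blast
  have "rel 1 w x"
    using assms(2) by (intro rel_mono[OF assms(1)]) auto
  moreover have "rel 1 w (xconst c * finv F')"
    using c by (intro relI[OF h finv_F'_in] eventually_mono[OF eventually_gt_at_top[of 0]])
  ultimately show ?thesis
    using rel_unique c(1) by blast
qed

lemma rel_finv_mod_p:
  assumes "rel m (finv F) x" "m > 0"
  shows "x - xconst (xcoeff (F ^ (CARD('p) - 1)) 0) * finv F' \<in> \<Omega>'p 1"
proof -
  have "rel 1 (finv F) x"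
    using assms(2) by (intro rel_mono[OF assms(1)]) auto
  moreover have "xcoeff (F ^ (CARD('p) - 1)) 0 \<in> R"
    using cartier_term_mem(4)[OF one_in_num] p_gt_1 by simp
  then have "rel 1 (finv F) (xconst (xcoeff (F ^ (CARD('p) - 1)) 0) * finv F')"
    using psum_finv_mod_p
    by (intro relI[OF finv_represented finv_F'_in] eventually_mono[OF eventually_gt_at_top[of 0]])
  ultimately show ?thesis
    by (intro rel_unique)
qed

lemma \<Omega>'p_xcoeff:
  assumes "x \<in> \<Omega>'p m"
  shows "of_nat CARD('p) ^ m dvd xcoeff x v"
proof -
  have "of_nat (CARD('p) ^ m) dvd x"
    using assms unfolding mem_elt_set_times by auto
  from of_nat_dvd_xcoeff[OF this] show ?thesis
    by simp
qed

text \<open>The constant term in \<open>x\<close> is preserved.\<close>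

lemma rel_constant_term:
  assumes "rel m w x"
  shows "of_nat CARD('p) ^ m dvd xcoeff x 0 - xcoeff w 0"
proof -
  obtain K h where h: "(K, h) \<in> fam" "represented F K h = w"
    using relD(1)[OF assms] by (rule OmegaE)
  have "\<forall>\<^sub>F N in sequentially. psum K h N - x \<in> \<Omega>'p m \<and> N \<ge> m"
    using rel_psum[OF assms h] by (intro eventually_conj eventually_ge_at_top)
  then obtain N where N: "psum K h N - x \<in> \<Omega>'p m" "N \<ge> m"
    using eventually_happens'[OF sequentially_bot] by blast
  have "of_nat CARD('p) ^ m dvd (of_nat (CARD('p) ^ N) :: 'p padic_int fps)"
    using N(2) by (simp add: le_imp_power_dvd)
  then have 1: "of_nat CARD('p) ^ m dvd xcoeff (psum K h N) 0 - xcoeff w 0"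
    using xcoeff_psum_cong[of N K h] unfolding h(2) by (rule dvd_trans)
  have 2: "of_nat CARD('p) ^ m dvd xcoeff (psum K h N) 0 - xcoeff x 0"
    using \<Omega>'p_xcoeff[OF N(1)] by (simp add: xcoeff_diff)
  show ?thesis
    using dvd_diff[OF 1 2] by simp
qed

subsection \<open>The operation on the completion\<close>

lemma cartier_coset:
  assumes \<omega>: "\<omega> \<in> Omega_hat R (interior D) F" and w: "w \<in> \<omega> m"
  shows "x \<in> cartier R (interior D) F \<omega> m \<longleftrightarrow> rel m w x"
proof -
  note c = completion_coset[OF submodule(1) subring \<omega>[unfolded Omega_hat_def]]
  have "x \<in> cartier R (interior D) F \<omega> m \<longleftrightarrow> (\<exists>v\<in>\<omega> m. rel m v x)"
    unfolding cartier_def using rel_iff c(1) by auto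
  also have "\<dots> \<longleftrightarrow> rel m w x"
  proof
    assume "\<exists>v\<in>\<omega> m. rel m v x"
    then obtain v where v: "v \<in> \<omega> m" "rel m v x" by blast
    then have "w - v \<in> of_nat CARD('p) ^ m *o \<Omega>"
      using w c(2)[OF v(1)] by (simp add: mem_elt_set_plus)
    then show "rel m w x"
      by (rule rel_cong_left[OF v(2)])
  qed (use w in blast)
  finally show ?thesis .
qed

lemma cartier_in_Omega_hat:
  assumes \<omega>: "\<omega> \<in> Omega_hat R (interior D) F"
  shows "cartier R (interior D) F \<omega> \<in> Omega_hat R (interior D) F'"
  unfolding Omega_hat_def
proof (rule completionI[OF submodule(2) subring])
  fix m
  note c = completion_coset(1)[OF submodule(1) subring \<omega>[unfolded Omega_hat_def]]
  obtain w where w: "w \<in> \<omega> (Suc m)"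
    using completion_nonempty[OF submodule(1)] \<omega> unfolding Omega_hat_def by blast
  have w': "w \<in> \<omega> m"
    using w completion_antimono[OF \<omega>[unfolded Omega_hat_def], of m "Suc m"] by auto
  obtain x where x: "rel (Suc m) w x"
    using rel_ex[OF c[OF w]] by blast
  then have x': "rel m w x"
    by (rule rel_mono) simp
  show "\<exists>x. x \<in> cartier R (interior D) F \<omega> m \<and> x \<in> cartier R (interior D) F \<omega> (Suc m)"
    unfolding cartier_coset[OF \<omega> w] cartier_coset[OF \<omega> w'] using x x' by blast
  have "y \<in> cartier R (interior D) F \<omega> m \<longleftrightarrow> y \<in> x +o \<Omega>'p m" for y
    unfolding cartier_coset[OF \<omega> w'] mem_elt_set_plus
    using rel_unique[OF x'] rel_cong_right[OF x'] by blast
  then show "\<exists>w\<in>\<Omega>'. cartier R (interior D) F \<omega> m = w +o \<Omega>'p m"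
    using relD(2)[OF x] by blast
qed

end

section \<open>The Frobenius twists of f\<close>

lemma twist_add: "twist m g + fps_X ^ m * fps_const g = 1"
  by (simp add: twist_def)

lemma fps_nth_twist_0: "m > 0 \<Longrightarrow> fps_nth (twist m g) 0 = 1"
  by (simp add: twist_def fps_X_power_mult_nth)

lemma supp_in_X_power_const:
  assumes "real_vec ` Poly_Mapping.keys g \<subseteq> (\<lambda>y. real k *\<^sub>R y) ` D"
  shows "supp_in (fps_X ^ m * fps_const g) k D"
  using assms xsupp_X_power_const[of m g] unfolding supp_in_def by blast

lemma supp_in_twist:
  assumes "0 \<in> D" "real_vec ` Poly_Mapping.keys g \<subseteq> (\<lambda>y. real k *\<^sub>R y) ` D"
  shows "supp_in (twist m g) k D"
  unfolding twist_def using assms by (intro supp_in_diff supp_in_one supp_in_X_power_const)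

lemma xpow_twist: "xpow (twist m g) = twist m (laurent_xpow g)"
proof -
  have "xpow (fps_X ^ m * fps_const g) = fps_X ^ m * fps_const (laurent_xpow g)"
    by (rule fps_ext) (simp add: fps_X_power_mult_nth)
  then show ?thesis
    by (simp add: twist_def xpow_diff)
qed

lemma keys_laurent_xpow:
  fixes g :: "('n::finite, 'p::prime_card) laurent"
  shows "Poly_Mapping.keys (laurent_xpow g) \<subseteq> (\<lambda>v. int CARD('p) *s v) ` Poly_Mapping.keys g"
proof
  fix w assume "w \<in> Poly_Mapping.keys (laurent_xpow g)"
  then have "(\<Sum>v\<in>Poly_Mapping.keys g. Poly_Mapping.lookup (Poly_Mapping.single (int CARD('p) *s v)
      (Poly_Mapping.lookup g v)) w) \<noteq> 0"
    by (simp add: laurent_xpow_def in_keys_iff lookup_sum)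
  then obtain v where "v \<in> Poly_Mapping.keys g"
    "Poly_Mapping.lookup (Poly_Mapping.single (int CARD('p) *s v) (Poly_Mapping.lookup g v)) w \<noteq> 0"
    by (meson sum.not_neutral_contains_not_neutral)
  then show "w \<in> (\<lambda>v. int CARD('p) *s v) ` Poly_Mapping.keys g"
    by (auto simp: lookup_single when_def split: if_splits)
qed

lemma twist_power_cong:
  fixes g :: "('n::finite, 'p::prime_card) laurent"
  shows "of_nat CARD('p) dvd twist m g ^ CARD('p) - xpow (twist (CARD('p) * m) g)"
proof -
  let ?p = "CARD('p)" and ?T = "fps_X ^ m * fps_const g" and ?T' = "fps_X ^ (CARD('p) * m) * fps_const (laurent_xpow g)"
  obtain d where "g ^ ?p - laurent_xpow g = of_nat ?p * d"
    using laurent_power_cong_xpow[of g] by (elim dvdE)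
  then have "fps_const (g ^ ?p) - fps_const (laurent_xpow g) = of_nat ?p * fps_const d"
    by (metis fps_const_mult fps_const_sub fps_of_nat)
  then have "fps_X ^ (?p * m) * (fps_const (g ^ ?p) - fps_const (laurent_xpow g)) = of_nat ?p * (fps_X ^ (?p * m) * fps_const d)"
    by (simp only: mult.left_commute)
  moreover have "?T ^ ?p = fps_X ^ (?p * m) * fps_const (g ^ ?p)"
    by (simp add: power_mult_distrib fps_const_power mult.commute[of ?p m] power_mult)
  ultimately have "?T ^ ?p - ?T' = of_nat ?p * (fps_X ^ (?p * m) * fps_const d)"
    by (simp only: right_diff_distrib)
  then have "of_nat ?p dvd ?T ^ ?p - ?T'" by simp
  moreover have "of_nat ?p dvd (twist m g + ?T) ^ ?p - (twist m g ^ ?p + ?T ^ ?p)"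
    by (rule prime_dvd_power_add_diff[OF prime_CARD])
  ultimately have "of_nat ?p dvd - ((?T ^ ?p - ?T') + ((twist m g + ?T) ^ ?p - (twist m g ^ ?p + ?T ^ ?p)))"
    by (intro dvd_minus_iff[THEN iffD2] dvd_add)
  also have "\<dots> = twist m g ^ ?p - xpow (twist (?p * m) g)"
    unfolding xpow_twist twist_add power_one unfolding twist_def[of "?p * m"] by simp
  finally show ?thesis .
qed

text \<open>The constant term of \<open>1/f\<close> is \<open>q\<close>.\<close>

lemma xcoeff_finv_twist: "xcoeff (finv (twist 1 g)) 0 = period_series g"
proof -
  let ?A = "Abs_fps (\<lambda>i. g ^ i)"
  have "twist 1 g * ?A = 1"
  proof (rule fps_ext)
    fix n
    have "fps_nth (twist 1 g * ?A) n = fps_nth ?A n - fps_nth (fps_X * (fps_const g * ?A)) n"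
      by (simp add: twist_def left_diff_distrib mult.assoc)
    also have "\<dots> = fps_nth 1 n"
      by (cases n) (simp_all add: fps_X_mult_nth)
    finally show "fps_nth (twist 1 g * ?A) n = fps_nth 1 n" .
  qed
  then have "finv (twist 1 g) = ?A"
    by (rule finv_unique) (simp add: fps_nth_twist_0)
  then show ?thesis
    by (intro fps_ext) (simp add: period_series_def)
qed

lemma fps_nth_period_series_0: "fps_nth (period_series g) 0 = 1"
  by (simp add: period_series_def)

lemma finv_frob:
  assumes "p > 0" "fps_nth F 0 = 1"
  shows "finv (frob p F) = frob p (finv F)"
proof (rule finv_unique)
  show "frob p F * frob p (finv F) = 1"
    using assms by (simp add: finv_right flip: frob_mult)
  show "fps_nth (frob p F) 0 = 1"
    using assms by (simp add: fps_nth_frob)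
qed

lemma frob_power: "p > 0 \<Longrightarrow> frob p (a ^ n) = frob p a ^ n"
  by (induction n) (simp_all add: frob_mult)

section \<open>Iterating the Cartier operation\<close>

text \<open>
  The Laurent polynomial \<open>g\<close> of the theorem. The index \<open>s\<close> in \<open>Fs s\<close>, \<open>Om s\<close> and \<open>crel s\<close> counts Frobenius twists,
  so that \<open>Fs 0\<close> is \<open>f\<close> and \<open>Fs 1\<close> is \<open>f\<^sup>\<sigma>\<close>.
\<close>

locale one_interior_point =
  fixes g :: "('n::finite, 'p::prime_card) laurent"
  assumes interior_point: "{v. real_vec v \<in> interior (newton_polytope g)} = {0}"
    and cartier_exists_if_2: "CARD('p) = 2 \<Longrightarrow>
      \<forall>s. cartier_exists (coeff_ring g) (interior (newton_polytope g)) ((frob CARD('p) ^^ s) (f_of g))"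
begin

abbreviation "R \<equiv> coeff_ring g"
abbreviation "D \<equiv> newton_polytope g"
abbreviation "Fs s \<equiv> twist (CARD('p) ^ s) g"
abbreviation "Om s \<equiv> Omega R (interior D) (Fs s)"
abbreviation "crel s \<equiv> cartier_rel R (interior D) (Fs s)"

lemma frob_Fs: "frob CARD('p) (Fs s) = Fs (Suc s)"
  by (simp add: frob_twist)

lemma frob_iterate: "(frob CARD('p) ^^ s) (f_of g) = Fs s"
  by (induction s) (simp_all add: f_of_eq_twist frob_twist)

lemma frob_iterate_Suc: "(frob CARD('p) ^^ s) (Fs (Suc 0)) = Fs (Suc s)"
  by (induction s) (simp_all add: frob_twist)

lemma is_subring_R: "is_subring R"
  by (rule is_subring_coeff_ring)

lemma Fs_0: "fps_nth (Fs s) 0 = 1"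
  by (simp add: fps_nth_twist_0)

lemma defect_ex:
  "\<exists>G. G \<in> laurent_over R \<and> supp_in G CARD('p) D \<and>
    Fs s ^ CARD('p) = xpow (frob CARD('p) (Fs s)) + of_nat CARD('p) * G"
proof -
  let ?p = "CARD('p)"
  have "0 \<in> interior D"
    using interior_point real_vec_zero[where ?'a = 'n] by (metis mem_Collect_eq singletonI)
  then have D: "convex D" "0 \<in> D"
    using interior_subset[of D] by (auto simp: newton_polytope_def)
  have keys: "real_vec v \<in> D" if "v \<in> Poly_Mapping.keys g" for v
    using that unfolding newton_polytope_def by (intro hull_inc) blast
  obtain G where G: "Fs s ^ ?p - xpow (Fs (Suc s)) = of_nat ?p * G"
    using twist_power_cong[of "?p ^ s" g] by (auto elim: dvdE)
  have pG: "xcoeff (of_nat ?p * G) v = of_nat ?p * xcoeff G v" for v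
    by (rule xcoeff_of_nat_mult)
  have supp: "xsupp (of_nat ?p * G) = xsupp G"
    unfolding xsupp_def pG using padic_fps_prime_cancel by auto
  have over: "of_nat ?p * G \<in> laurent_over R"
    unfolding G[symmetric] xpow_twist
    by (intro is_subring_diff is_subring_power is_subring_laurent_over is_subring_R twist_in_laurent_over
        range_fps_of_poly_subset_coeff_ring)
  have "xcoeff G v \<in> R" for v
  proof -
    have "xcoeff (of_nat ?p * G) v \<in> R"
      using over by (simp add: laurent_over_def)
    then have "of_nat ?p ^ 1 * xcoeff G v \<in> R"
      unfolding pG by simp
    then show ?thesis
      by (rule coeff_ring_saturated)
  qed
  then have "G \<in> laurent_over R"
    using over supp by (auto simp: laurent_over_def)
  moreover have "supp_in (of_nat ?p * G) ?p D"
    unfolding G[symmetric] xpow_twist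
  proof (rule supp_in_diff)
    have "supp_in (Fs s) 1 D"
      using keys by (intro supp_in_twist D) auto
    then show "supp_in (Fs s ^ ?p) ?p D"
      using supp_in_power[OF D, of "Fs s" 1 ?p] by simp
    show "supp_in (twist (?p ^ Suc s) (laurent_xpow g)) ?p D"
    proof (intro supp_in_twist D subsetI)
      fix z assume "z \<in> real_vec ` Poly_Mapping.keys (laurent_xpow g)"
      then obtain v where "v \<in> Poly_Mapping.keys g" "z = real_vec (int ?p *s v)"
        using keys_laurent_xpow[of g] by blast
      then show "z \<in> (\<lambda>y. real ?p *\<^sub>R y) ` D"
        using keys by (auto simp: real_vec_smult)
    qed
  qed
  ultimately show ?thesis
    using G supp by (intro exI[of _ G]) (auto simp: frob_Fs supp_in_def algebra_simps)
qed

text \<open>The Laurent polynomial \<open>G\<close> belonging to the s-th twist.\<close>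

definition Gs where "Gs s = (SOME G. G \<in> laurent_over R \<and> supp_in G CARD('p) D \<and>
    Fs s ^ CARD('p) = xpow (frob CARD('p) (Fs s)) + of_nat CARD('p) * G)"

lemma step: "cartier_step R D (Fs s) (Gs s)"
proof
  note Gs = someI_ex[OF defect_ex, of s, folded Gs_def]
  show "Gs s \<in> laurent_over R" "supp_in (Gs s) CARD('p) D"
    "Fs s ^ CARD('p) = xpow (frob CARD('p) (Fs s)) + of_nat CARD('p) * Gs s"
    using Gs by blast+
  show "is_subring R" by (rule is_subring_R)
  show "fps_const c \<in> R" for c
    using range_fps_of_poly_subset_coeff_ring[of g] fps_of_poly_const[of c] by (metis rangeI subsetD)
  show "convex D" by (simp add: newton_polytope_def)
  show "{v. real_vec v \<in> interior D} = {0}" by (rule interior_point)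
  show "Fs s \<in> laurent_over R"
    by (intro is_subring_R twist_in_laurent_over range_fps_of_poly_subset_coeff_ring)
  show "fps_nth (Fs s) 0 = 1" by (rule Fs_0)
  have "0 \<in> interior D"
    using interior_point real_vec_zero[where ?'a = 'n] by (metis mem_Collect_eq singletonI)
  then show "supp_in (Fs s) 1 D"
    using interior_subset[of D] by (intro supp_in_twist) (auto simp: newton_polytope_def intro: hull_inc)
  show "CARD('p) = 2 \<Longrightarrow> cartier_exists R (interior D) (Fs s)"
    using cartier_exists_if_2 unfolding frob_iterate by blast
qed

lemmas crel_ex = cartier_step.rel_ex[OF step, unfolded frob_Fs]
  and crelD = cartier_step.relD[OF step, unfolded frob_Fs]
  and crel_add = cartier_step.rel_add[OF step]
  and crel_diff = cartier_step.rel_diff[OF step]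
  and crel_scale = cartier_step.rel_scale[OF step]
  and crel_power_p = cartier_step.rel_power_p[OF step]
  and crel_unique = cartier_step.rel_unique[OF step, unfolded frob_Fs]
  and crel_mod_p = cartier_step.rel_mod_p[OF step, unfolded frob_Fs]
  and crel_finv_mod_p = cartier_step.rel_finv_mod_p[OF step, unfolded frob_Fs]
  and crel_constant_term = cartier_step.rel_constant_term[OF step]
  and cartier_coset = cartier_step.cartier_coset[OF step]
  and cartier_in_Omega_hat = cartier_step.cartier_in_Omega_hat[OF step, unfolded frob_Fs]
  and finv_in_Om = cartier_step.finv_in_\<Omega>[OF step]

lemma Om_submodule: "is_submodule R (Om s)"
  by (rule is_submodule_Omega[OF is_subring_R])

lemma pOm_submodule: "is_submodule R (of_nat CARD('p) ^ m *o Om s)"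
  by (rule is_submodule_times[OF Om_submodule])

lemma R_power_p: "of_nat CARD('p) ^ s \<in> R"
  by (rule is_subring_power[OF is_subring_R is_subring_of_nat[OF is_subring_R]])

lemma xconst_power_p: "xconst (of_nat CARD('p) ^ s) = of_nat CARD('p) ^ s"
  by (simp add: xconst_power xconst_of_nat)

lemma beta_twist: "xcoeff (Fs s ^ (CARD('p) - 1)) 0 = (frob CARD('p) ^^ s) (hasse_witt g)"
proof (induction s)
  case 0
  then show ?case by (simp add: hasse_witt_def f_of_eq_twist)
next
  case (Suc s)
  have "Fs (Suc s) ^ (CARD('p) - 1) = frob CARD('p) (Fs s ^ (CARD('p) - 1))"
    by (simp add: frob_power frob_twist)
  then show ?case
    using Suc by (simp add: xcoeff_frob)
qed

lemma beta_twist_unit: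
  "xcoeff (Fs s ^ (CARD('p) - 1)) 0 \<in> R"
  "xcoeff (Fs s ^ (CARD('p) - 1)) 0 * finv (xcoeff (Fs s ^ (CARD('p) - 1)) 0) = 1"
  "finv (xcoeff (Fs s ^ (CARD('p) - 1)) 0) \<in> R"
proof -
  have "Fs s ^ (CARD('p) - 1) \<in> laurent_over R"
    by (intro is_subring_power is_subring_laurent_over is_subring_R twist_in_laurent_over
        range_fps_of_poly_subset_coeff_ring)
  then show "xcoeff (Fs s ^ (CARD('p) - 1)) 0 \<in> R"
    by (simp add: laurent_over_def)
  show "xcoeff (Fs s ^ (CARD('p) - 1)) 0 * finv (xcoeff (Fs s ^ (CARD('p) - 1)) 0) = 1"
    by (rule finv_right) (simp add: fps_nth_power_0 Fs_0)
  show "finv (xcoeff (Fs s ^ (CARD('p) - 1)) 0) \<in> R"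
    unfolding beta_twist by (rule finv_frob_hasse_witt_in_coeff_ring)
qed

text \<open>
  \<open>chain m s w w'\<close>: \<open>w'\<close> represents the image of \<open>w\<close> under the s-fold Cartier operation modulo \<open>p\<^sup>m\<close>,
  starting from \<open>f\<^sup>\<sigma>\<close>.
\<close>

primrec chain :: "nat \<Rightarrow> nat \<Rightarrow> ('n, 'p) lseries \<Rightarrow> ('n, 'p) lseries \<Rightarrow> bool"
  where
    "chain m 0 w w' \<longleftrightarrow> w \<in> Om (Suc 0) \<and> w' = w"
  | "chain m (Suc s) w w' \<longleftrightarrow> (\<exists>v. chain m s w v \<and> crel (Suc s) m v w')"

lemma chainD: "chain m s w w' \<Longrightarrow> w \<in> Om (Suc 0)" "chain m s w w' \<Longrightarrow> w' \<in> Om (Suc s)"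
  by (induction s arbitrary: w') (auto dest: crelD(2) simp del: power_Suc power_Suc0_right)

lemma chain_ex: "w \<in> Om (Suc 0) \<Longrightarrow> \<exists>w'. chain m s w w'"
proof (induction s)
  case (Suc s)
  then obtain v where v: "chain m s w v" by blast
  obtain w' where "crel (Suc s) m v w'"
    using crel_ex[OF chainD(2)[OF v]] by blast
  then show ?case using v by auto
qed auto

lemma chain_diff: "chain m s w w' \<Longrightarrow> chain m s v v' \<Longrightarrow> chain m s (w - v) (w' - v')"
proof (induction s arbitrary: w' v')
  case 0
  then show ?case using submodule_diff[OF Om_submodule is_subring_R] by (auto simp only: chain.simps)
next
  case (Suc s)
  obtain x y where "chain m s w x" "crel (Suc s) m x w'" "chain m s v y" "crel (Suc s) m y v'"
    using Suc.prems by (auto simp only: chain.simps)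
  then have "chain m s (w - v) (x - y)" "crel (Suc s) m (x - y) (w' - v')"
    using Suc.IH crel_diff by blast+
  then show ?case by (auto simp only: chain.simps)
qed

lemma chain_scale: "chain m s w w' \<Longrightarrow> r \<in> R \<Longrightarrow> chain m s (xconst r * w) (xconst r * w')"
proof (induction s arbitrary: w')
  case 0
  then show ?case using submodule_scale[OF Om_submodule] by (auto simp only: chain.simps)
next
  case (Suc s)
  obtain x where "chain m s w x" "crel (Suc s) m x w'"
    using Suc.prems by (auto simp only: chain.simps)
  then have "chain m s (xconst r * w) (xconst r * x)" "crel (Suc s) m (xconst r * x) (xconst r * w')"
    using Suc.IH Suc.prems(2) crel_scale by blast+
  then show ?case by (auto simp only: chain.simps)
qed

lemma chain_constant_term:
  "chain m s w w' \<Longrightarrow> of_nat CARD('p) ^ m dvd xcoeff w' 0 - xcoeff w 0"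
proof (induction s arbitrary: w')
  case (Suc s)
  then obtain v where v: "chain m s w v" "crel (Suc s) m v w'" by auto
  have "of_nat CARD('p) ^ m dvd (xcoeff w' 0 - xcoeff v 0) + (xcoeff v 0 - xcoeff w 0)"
    using Suc.IH[OF v(1)] crel_constant_term[OF v(2)] by (intro dvd_add)
  then show ?case by simp
qed auto

text \<open>Modulo \<open>p\<close> the iterated images of \<open>1/f\<^sup>\<sigma>\<close> are unit multiples of the generators.\<close>

lemma chain_finv_mod_p:
  assumes "m > 0" "chain m s (finv (Fs (Suc 0))) b"
  shows "\<exists>B\<in>R. \<exists>C\<in>R. B * C = 1 \<and> b - xconst B * finv (Fs (Suc s)) \<in> of_nat CARD('p) ^ 1 *o Om (Suc s)"
  using assms(2)
proof (induction s arbitrary: b)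
  case 0
  then have "b - xconst 1 * finv (Fs (Suc 0)) = 0" by simp
  then have "b - xconst 1 * finv (Fs (Suc 0)) \<in> of_nat CARD('p) ^ 1 *o Om (Suc 0)"
    using submodule_zero[OF pOm_submodule] by metis
  then show ?case
    using is_subring_one[OF is_subring_R] by (intro bexI[of _ 1] conjI) auto
next
  case (Suc s)
  let ?F = "finv (Fs (Suc s))" and ?F' = "finv (Fs (Suc (Suc s)))"
  let ?N = "of_nat CARD('p) ^ 1 *o Om (Suc (Suc s))"
  let ?\<beta> = "xcoeff (Fs (Suc s) ^ (CARD('p) - 1)) 0"
  obtain v where v: "chain m s (finv (Fs (Suc 0))) v" "crel (Suc s) m v b"
    using Suc.prems by auto
  obtain B C where BC: "B \<in> R" "C \<in> R" "B * C = 1"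
    "v - xconst B * ?F \<in> of_nat CARD('p) ^ 1 *o Om (Suc s)"
    using Suc.IH[OF v(1)] by blast
  obtain z where z: "z \<in> Om (Suc s)" "v - xconst B * ?F = of_nat CARD('p) ^ 1 * z"
    using BC(4) unfolding mem_elt_set_times by blast
  obtain d where d: "crel (Suc s) m ?F d"
    using crel_ex[OF finv_in_Om] by blast
  obtain e where e: "crel (Suc s) m z e"
    using crel_ex[OF z(1)] by blast
  have r1: "crel (Suc s) m (xconst B * ?F + xconst (of_nat CARD('p) ^ 1) * z) (xconst B * d + xconst (of_nat CARD('p) ^ 1) * e)"
    using d e BC(1) R_power_p by (intro crel_add crel_scale)
  have v_eq: "xconst B * ?F + xconst (of_nat CARD('p) ^ 1) * z = v"
    unfolding xconst_power_p z(2)[symmetric] by simp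
  have "b - (xconst B * d + of_nat CARD('p) ^ 1 * e) \<in> of_nat CARD('p) ^ m *o Om (Suc (Suc s))"
    by (rule crel_unique[OF r1[unfolded v_eq, unfolded xconst_power_p] v(2)])
  then have 1: "b - (xconst B * d + of_nat CARD('p) ^ 1 * e) \<in> ?N"
    using submodule_power_times_mono[OF Om_submodule is_subring_R, of 1 m "CARD('p)"] assms(1) by fastforce
  have "of_nat CARD('p) ^ 1 * e \<in> ?N"
    using crelD(2)[OF e] unfolding mem_elt_set_times by blast
  moreover have "xconst B * (d - xconst ?\<beta> * ?F') \<in> ?N"
    using crel_finv_mod_p[OF d assms(1)] BC(1) by (intro submodule_scale[OF pOm_submodule])
  ultimately have "(b - (xconst B * d + of_nat CARD('p) ^ 1 * e))
      + (of_nat CARD('p) ^ 1 * e + xconst B * (d - xconst ?\<beta> * ?F')) \<in> ?N"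
    using 1 by (intro submodule_add[OF pOm_submodule])
  moreover have "(b - (xconst B * d + of_nat CARD('p) ^ 1 * e))
      + (of_nat CARD('p) ^ 1 * e + xconst B * (d - xconst ?\<beta> * ?F')) = b - xconst (B * ?\<beta>) * ?F'"
    by (simp add: xconst_mult algebra_simps)
  moreover have "B * ?\<beta> * (C * finv ?\<beta>) = 1"
    using BC(3) beta_twist_unit(2)[of "Suc s"] by (metis (no_types, lifting) mult.assoc mult.left_commute mult_1_right)
  moreover have "B * ?\<beta> \<in> R" "C * finv ?\<beta> \<in> R"
    by (rule is_subring_mult[OF is_subring_R BC(1) beta_twist_unit(1)])
      (rule is_subring_mult[OF is_subring_R BC(2) beta_twist_unit(3)])
  ultimately show ?case
    by metis
qed

text \<open>
  Successive approximation: for every element \<open>w\<close> there is a multiple of \<open>1/f\<^sup>\<sigma>\<close> such that the s-fold operation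
  maps the difference into multiples of \<open>p\<^sup>s\<close>. The correction at each stage solves a linear equation
  modulo \<open>p\<close> whose coefficient is a unit.
\<close>

lemma chain_approximation:
  assumes "w \<in> Om (Suc 0)" "s \<le> m"
  shows "\<exists>l\<in>R. \<exists>z\<in>Om (Suc s). chain m s (w - xconst l * finv (Fs (Suc 0))) (of_nat CARD('p) ^ s * z)"
  using assms(2)
proof (induction s)
  case 0
  have "chain m 0 (w - xconst 0 * finv (Fs (Suc 0))) (of_nat CARD('p) ^ 0 * w)"
    using assms(1) by simp
  then show ?case
    using assms(1) is_subring_zero[OF is_subring_R] by blast
next
  case (Suc s)
  let ?F = "finv (Fs (Suc 0))" and ?F' = "finv (Fs (Suc (Suc s)))"
  let ?N = "of_nat CARD('p) ^ 1 *o Om (Suc (Suc s))"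
  obtain l z where l: "l \<in> R" "z \<in> Om (Suc s)" "chain m s (w - xconst l * ?F) (of_nat CARD('p) ^ s * z)"
    using Suc by auto
  obtain y where y: "crel (Suc s) (m - s) z y"
    using crel_ex[OF l(2)] by blast
  obtain c where c: "c \<in> R" "y - xconst c * ?F' \<in> ?N"
    using crel_mod_p[OF y] Suc.prems by auto
  have "crel (Suc s) m (of_nat CARD('p) ^ s * z) (of_nat CARD('p) ^ s * y)"
    using crel_power_p[OF y, of s] Suc.prems by simp
  then have 1: "chain m (Suc s) (w - xconst l * ?F) (of_nat CARD('p) ^ s * y)"
    using l(3) by auto
  obtain b where b: "chain m (Suc s) ?F b"
    using chain_ex[OF finv_in_Om] by blast
  obtain B C where BC: "B \<in> R" "C \<in> R" "B * C = 1" "b - xconst B * ?F' \<in> ?N"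
    using chain_finv_mod_p[OF _ b] Suc.prems by auto
  \<comment> \<open>the correction: it changes the image modulo \<open>p\<^bsup>s+1\<^esup>\<close> by \<open>p\<^sup>s c C B = p\<^sup>s c\<close> times \<open>?F'\<close>\<close>
  let ?c = "of_nat CARD('p) ^ s * (c * C)"
  have c': "?c \<in> R" "c * C \<in> R"
    using c(1) BC(2) R_power_p by (auto intro: is_subring_mult[OF is_subring_R])
  have 2: "chain m (Suc s) (xconst ?c * ?F) (xconst ?c * b)"
    using b c'(1) by (rule chain_scale)
  have "xconst (c * C) * (b - xconst B * ?F') \<in> ?N"
    using BC(4) c'(2) by (intro submodule_scale[OF pOm_submodule])
  then have "(y - xconst c * ?F') - xconst (c * C) * (b - xconst B * ?F') \<in> ?N"
    by (rule submodule_diff[OF pOm_submodule is_subring_R c(2)])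
  moreover have "c * C * B = c"
    using BC(3) by (simp add: mult.assoc mult.commute[of C])
  then have "xconst (c * C) * (xconst B * ?F') = xconst c * ?F'"
    by (metis mult.assoc xconst_mult)
  then have "(y - xconst c * ?F') - xconst (c * C) * (b - xconst B * ?F') = y - xconst (c * C) * b"
    by (simp add: right_diff_distrib)
  ultimately obtain x where x: "x \<in> Om (Suc (Suc s))" "y - xconst (c * C) * b = of_nat CARD('p) ^ 1 * x"
    unfolding mem_elt_set_times by metis
  have "chain m (Suc s) (w - xconst l * ?F - xconst ?c * ?F) (of_nat CARD('p) ^ s * y - xconst ?c * b)"
    using 1 2 by (rule chain_diff)
  moreover have "w - xconst l * ?F - xconst ?c * ?F = w - xconst (l + ?c) * ?F"
    by (simp add: xconst_add algebra_simps)
  moreover have "of_nat CARD('p) ^ s * y - xconst ?c * b = of_nat CARD('p) ^ s * (y - xconst (c * C) * b)"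
    by (simp only: xconst_mult[of "of_nat CARD('p) ^ s"] xconst_power_p right_diff_distrib mult.assoc)
  then have "of_nat CARD('p) ^ s * y - xconst ?c * b = of_nat CARD('p) ^ Suc s * x"
    unfolding x(2) by (simp add: mult_ac)
  moreover have "l + ?c \<in> R"
    using l(1) c'(1) by (rule is_subring_add[OF is_subring_R])
  ultimately show ?case
    using x(1) by metis
qed

section \<open>The Cartier matrix\<close>

lemma cartier_iter_in_Omega_hat:
  assumes "\<omega> \<in> Omega_hat R (interior D) (Fs (Suc 0))"
  shows "cartier_iter R (interior D) (Fs (Suc 0)) s \<omega> \<in> Omega_hat R (interior D) (Fs (Suc s))"
proof (induction s)
  case (Suc s)
  then show ?case
    unfolding cartier_iter.simps frob_iterate_Suc by (rule cartier_in_Omega_hat)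
qed (use assms in simp)

lemma chain_cartier_iter:
  assumes "\<omega> \<in> Omega_hat R (interior D) (Fs (Suc 0))" "w \<in> \<omega> m" "chain m s w w'"
  shows "w' \<in> cartier_iter R (interior D) (Fs (Suc 0)) s \<omega> m"
  using assms(3)
proof (induction s arbitrary: w')
  case (Suc s)
  then obtain v where v: "chain m s w v" "crel (Suc s) m v w'" by auto
  show ?case
    unfolding cartier_iter.simps frob_iterate_Suc
    using cartier_coset[OF cartier_iter_in_Omega_hat[OF assms(1)] Suc.IH[OF v(1)]] v(2) by blast
qed (use assms in auto)

lemma compl_of_in_Omega_hat:
  assumes "w \<in> Om s"
  shows "compl_of CARD('p) (Om s) w \<in> Omega_hat R (interior D) (Fs s)" "w \<in> compl_of CARD('p) (Om s) w m"
proof -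
  show mem: "w \<in> compl_of CARD('p) (Om s) w m" for m
    using submodule_zero[OF pOm_submodule] by (simp add: compl_of_def mem_elt_set_plus)
  show "compl_of CARD('p) (Om s) w \<in> Omega_hat R (interior D) (Fs s)"
    unfolding Omega_hat_def
  proof (rule completionI[OF Om_submodule is_subring_R])
    show "\<exists>v\<in>Om s. compl_of CARD('p) (Om s) w m = v +o (of_nat CARD('p) ^ m *o Om s)" for m
      using assms by (auto simp: compl_of_def)
    show "\<exists>x. x \<in> compl_of CARD('p) (Om s) w m \<and> x \<in> compl_of CARD('p) (Om s) w (Suc m)" for m
      using mem[of m] mem[of "Suc m"] by blast
  qed
qed

abbreviation "q \<equiv> period_series g"
abbreviation "q\<sigma> \<equiv> frob CARD('p) (period_series g)"
text \<open>\<open>\<omega>\<^sub>1\<close> is \<open>\<C>\<^sub>p(1/f)\<close>.\<close>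

abbreviation "\<omega>\<^sub>1 \<equiv> cartier R (interior D) (Fs 0) (compl_of CARD('p) (Om 0) (finv (Fs 0)))"

lemma xcoeff_finv_Fs: "xcoeff (finv (Fs 0)) 0 = q" "xcoeff (finv (Fs (Suc 0))) 0 = q\<sigma>"
proof -
  show 0: "xcoeff (finv (Fs 0)) 0 = q"
    using xcoeff_finv_twist[of g] by simp
  have "finv (Fs (Suc 0)) = frob CARD('p) (finv (Fs 0))"
    unfolding frob_Fs[symmetric] by (rule finv_frob) (auto simp: fps_nth_twist_0)
  then show "xcoeff (finv (Fs (Suc 0))) 0 = q\<sigma>"
    using 0 by (simp add: xcoeff_frob)
qed

lemma q\<sigma>_inverse: "q\<sigma> * finv q\<sigma> = 1"
  by (rule finv_right) (simp add: fps_nth_frob fps_nth_period_series_0)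

lemma \<omega>\<^sub>1_in: "\<omega>\<^sub>1 \<in> Omega_hat R (interior D) (Fs (Suc 0))"
  by (rule cartier_in_Omega_hat[OF compl_of_in_Omega_hat(1)[OF finv_in_Om]])

lemma \<omega>\<^sub>1_mem:
  assumes "x \<in> \<omega>\<^sub>1 m"
  shows "x \<in> Om (Suc 0)" "of_nat CARD('p) ^ m dvd xcoeff x 0 - q"
proof -
  have "crel 0 m (finv (Fs 0)) x"
    using cartier_coset[OF compl_of_in_Omega_hat[OF finv_in_Om]] assms by blast
  then show "x \<in> Om (Suc 0)" "of_nat CARD('p) ^ m dvd xcoeff x 0 - q"
    using crelD(2) crel_constant_term xcoeff_finv_Fs(1) by metis+
qed

lemma is_cartier_matrix_iff:
  "is_cartier_matrix R (interior D) (f_of g) L \<longleftrightarrow> L \<in> R \<and>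
    (\<exists>u\<in>U_module R (interior D) (Fs (Suc 0)). \<omega>\<^sub>1 =
      compl_add (compl_scale CARD('p) (Om (Suc 0)) (xconst L)
        (compl_of CARD('p) (Om (Suc 0)) (finv (Fs (Suc 0))))) u)"
proof -
  have "f_of g = Fs 0" by (simp add: f_of_eq_twist)
  then show ?thesis
    unfolding is_cartier_matrix_def Let_def by (simp only: frob_Fs)
qed

text \<open>
  The constant term of an element of \<open>U\<close> is 0; here stated for the representatives modulo \<open>p\<^sup>s\<close>.
\<close>

lemma U_module_constant_term:
  assumes u: "u \<in> U_module R (interior D) (Fs (Suc 0))" and "s \<ge> 1" and w: "w \<in> u s"
  shows "of_nat CARD('p) ^ s dvd xcoeff w 0"
proof -
  let ?p = "of_nat CARD('p) :: ('n, 'p) lseries"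
  have u': "u \<in> Omega_hat R (interior D) (Fs (Suc 0))"
    using u by (simp add: U_module_def)
  have "w \<in> Om (Suc 0)"
    using completion_coset(1)[OF Om_submodule is_subring_R u'[unfolded Omega_hat_def] w] .
  then obtain w' where w': "chain s s w w'"
    using chain_ex by blast
  obtain \<eta> where "cartier_iter R (interior D) (Fs (Suc 0)) s u
      = compl_scale CARD('p) (Om (Suc s)) (?p ^ s) \<eta>"
    using u assms(2) unfolding U_module_def frob_iterate_Suc by auto
  then have "w' \<in> (?p ^ s *o \<eta> s) + (?p ^ s *o Om (Suc s))"
    using chain_cartier_iter[OF u' w w'] by (simp add: compl_scale_def)
  then have "of_nat (CARD('p) ^ s) dvd w'"
    by (auto simp: set_plus_def mem_elt_set_times simp flip: distrib_left)
  then have "of_nat CARD('p) ^ s dvd xcoeff w' 0"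
    using of_nat_dvd_xcoeff by fastforce
  moreover have "of_nat CARD('p) ^ s dvd xcoeff w' 0 - xcoeff w 0"
    by (rule chain_constant_term[OF w'])
  ultimately have "of_nat CARD('p) ^ s dvd xcoeff w' 0 - (xcoeff w' 0 - xcoeff w 0)"
    by (rule dvd_diff)
  then show ?thesis by simp
qed

text \<open>Taking constant terms determines the Cartier matrix.\<close>

lemma cartier_matrix_unique:
  assumes "is_cartier_matrix R (interior D) (f_of g) L"
  shows "L * q\<sigma> = q"
proof -
  let ?p = "of_nat CARD('p) :: ('n, 'p) lseries"
  let ?F = "finv (Fs (Suc 0))"
  obtain u where u: "u \<in> U_module R (interior D) (Fs (Suc 0))"
    "\<omega>\<^sub>1 = compl_add (compl_scale CARD('p) (Om (Suc 0)) (xconst L) (compl_of CARD('p) (Om (Suc 0)) ?F)) u"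
    using assms unfolding is_cartier_matrix_iff by blast
  have "of_nat CARD('p) ^ s dvd q - L * q\<sigma>" for s
  proof (cases "s \<ge> 1")
    case True
    obtain x where x: "x \<in> \<omega>\<^sub>1 s"
      using completion_nonempty[OF Om_submodule \<omega>\<^sub>1_in[unfolded Omega_hat_def]] by blast
    then have "x \<in> (xconst L *o (?F +o (?p ^ s *o Om (Suc 0))) + (?p ^ s *o Om (Suc 0))) + u s"
      using u(2) by (simp add: compl_add_def compl_scale_def compl_of_def)
    then obtain a b v where x': "x = xconst L * (?F + ?p ^ s * a) + ?p ^ s * b + v" "v \<in> u s"
      unfolding set_plus_def elt_set_plus_def elt_set_times_def by blast
    have "x - (xconst L * ?F + v) = of_nat (CARD('p) ^ s) * (xconst L * a + b)"
      unfolding x'(1) by (simp add: algebra_simps)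
    then have "of_nat (CARD('p) ^ s) dvd x - (xconst L * ?F + v)"
      by simp
    from of_nat_dvd_xcoeff[OF this, of 0]
    have "of_nat CARD('p) ^ s dvd xcoeff x 0 - (L * q\<sigma> + xcoeff v 0)"
      by (simp only: of_nat_power xcoeff_diff xcoeff_add xcoeff_xconst_mult xcoeff_finv_Fs)
    then have "of_nat CARD('p) ^ s dvd (xcoeff x 0 - (L * q\<sigma> + xcoeff v 0)) - (xcoeff x 0 - q) + xcoeff v 0"
      by (rule dvd_add[OF dvd_diff[OF _ \<omega>\<^sub>1_mem(2)[OF x]] U_module_constant_term[OF u(1) True x'(2)]])
    then show ?thesis by simp
  next
    case False
    then have "s = 0" by simp
    then show ?thesis by simp
  qed
  then have "q - L * q\<sigma> = 0"
    by (rule padic_fps_separated)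
  then show ?thesis by simp
qed

lemma cartier_matrix_exists: "is_cartier_matrix R (interior D) (f_of g) (q * finv q\<sigma>)"
proof -
  let ?p = "of_nat CARD('p) :: ('n, 'p) lseries"
  let ?F = "finv (Fs (Suc 0))"
  let ?M = "Om (Suc 0)"
  define L where "L = q * finv q\<sigma>"
  have Lq: "L * q\<sigma> = q"
    unfolding L_def using q\<sigma>_inverse by (simp add: mult.assoc mult.commute[of "finv q\<sigma>"])
  \<comment> \<open>comparison of constant terms identifies the approximating scalars modulo \<open>p\<^sup>s\<close>\<close>
  have approx: "\<exists>l\<in>R. \<exists>z\<in>Om (Suc s). chain s s (x - xconst l * ?F) (?p ^ s * z)
      \<and> of_nat CARD('p) ^ s dvd L - l" if x: "x \<in> \<omega>\<^sub>1 s" for x s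
  proof -
    obtain l z where l: "l \<in> R" "z \<in> Om (Suc s)" "chain s s (x - xconst l * ?F) (?p ^ s * z)"
      using chain_approximation[OF \<omega>\<^sub>1_mem(1)[OF x], of s s] by auto
    have "of_nat (CARD('p) ^ s) dvd ?p ^ s * z" by simp
    then have 1: "of_nat CARD('p) ^ s dvd xcoeff (?p ^ s * z) 0"
      using of_nat_dvd_xcoeff by fastforce
    have 2: "of_nat CARD('p) ^ s dvd xcoeff (?p ^ s * z) 0 - (xcoeff x 0 - l * q\<sigma>)"
      using chain_constant_term[OF l(3)] by (simp only: xcoeff_diff xcoeff_xconst_mult xcoeff_finv_Fs)
    have "of_nat CARD('p) ^ s dvd xcoeff (?p ^ s * z) 0 - (xcoeff (?p ^ s * z) 0 - (xcoeff x 0 - l * q\<sigma>)) - (xcoeff x 0 - q)"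
      by (rule dvd_diff[OF dvd_diff[OF 1 2] \<omega>\<^sub>1_mem(2)[OF x]])
    then have "of_nat CARD('p) ^ s dvd (q - l * q\<sigma>) * finv q\<sigma>"
      by simp
    also have "(q - l * q\<sigma>) * finv q\<sigma> = L - l"
      using q\<sigma>_inverse by (simp add: L_def left_diff_distrib mult.assoc)
    finally show ?thesis
      using l by blast
  qed
  have nonempty: "\<exists>x. x \<in> \<omega>\<^sub>1 s" for s
    using completion_nonempty[OF Om_submodule \<omega>\<^sub>1_in[unfolded Omega_hat_def]] .
  have LR: "L \<in> R"
    using approx nonempty by (intro coeff_ring_closed) blast
  \<comment> \<open>by saturation \<open>L - l \<in> p\<^sup>s R\<close>, so that \<open>l\<close> may be replaced by \<open>L\<close>\<close>
  have Lchain: "\<exists>z\<in>Om (Suc s). chain s s (x - xconst L * ?F) (?p ^ s * z)" if x: "x \<in> \<omega>\<^sub>1 s" for x s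
  proof -
    obtain l z where l: "l \<in> R" "z \<in> Om (Suc s)" "chain s s (x - xconst l * ?F) (?p ^ s * z)"
      "of_nat CARD('p) ^ s dvd L - l"
      using approx[OF x] by blast
    obtain \<mu> where \<mu>: "L - l = of_nat CARD('p) ^ s * \<mu>"
      using l(4) by (elim dvdE)
    have "L - l \<in> R"
      using LR l(1) by (rule is_subring_diff[OF is_subring_R])
    then have \<mu>R: "\<mu> \<in> R"
      unfolding \<mu> by (rule coeff_ring_saturated)
    obtain b where b: "chain s s ?F b"
      using chain_ex[OF finv_in_Om] by blast
    have "chain s s (x - xconst l * ?F - xconst (L - l) * ?F) (?p ^ s * z - xconst (L - l) * b)"
      using chain_diff[OF l(3) chain_scale[OF b \<open>L - l \<in> R\<close>]] .
    moreover have "x - xconst l * ?F - xconst (L - l) * ?F = x - xconst L * ?F"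
      by (simp add: xconst_diff algebra_simps)
    moreover have "?p ^ s * z - xconst (L - l) * b = ?p ^ s * (z - xconst \<mu> * b)"
      unfolding \<mu> xconst_mult xconst_power_p by (simp add: right_diff_distrib mult.assoc)
    moreover have "z - xconst \<mu> * b \<in> Om (Suc s)"
      using l(2) chainD(2)[OF b] \<mu>R
      by (intro submodule_diff[OF Om_submodule is_subring_R] submodule_scale[OF Om_submodule])
    ultimately show ?thesis by metis
  qed
  \<comment> \<open>the element \<open>\<C>\<^sub>p(1/f) - L / f\<^sup>\<sigma>\<close> of the completion\<close>
  define u where "u m = {w. w + xconst L * ?F \<in> \<omega>\<^sub>1 m}" for m
  have LF: "xconst L * ?F \<in> ?M"
    using LR finv_in_Om by (intro submodule_scale[OF Om_submodule])
  have coset: "\<omega>\<^sub>1 m = x +o (?p ^ m *o ?M)" if "x \<in> \<omega>\<^sub>1 m" for x m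
    using completion_coset(2)[OF Om_submodule is_subring_R \<omega>\<^sub>1_in[unfolded Omega_hat_def] that] .
  have u_hat: "u \<in> Omega_hat R (interior D) (Fs (Suc 0))"
    unfolding Omega_hat_def
  proof (rule completionI[OF Om_submodule is_subring_R])
    fix m
    obtain x where x: "x \<in> \<omega>\<^sub>1 (Suc m)" using nonempty by blast
    then have x': "x \<in> \<omega>\<^sub>1 m"
      using completion_antimono[OF \<omega>\<^sub>1_in[unfolded Omega_hat_def], of m "Suc m"] by auto
    have "u m = (x - xconst L * ?F) +o (?p ^ m *o ?M)"
      unfolding u_def coset[OF x'] by (auto simp: mem_elt_set_plus algebra_simps)
    moreover have "x - xconst L * ?F \<in> ?M"
      using \<omega>\<^sub>1_mem(1)[OF x] LF by (rule submodule_diff[OF Om_submodule is_subring_R])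
    ultimately show "\<exists>w\<in>?M. u m = w +o (?p ^ m *o ?M)" by blast
    show "\<exists>w. w \<in> u m \<and> w \<in> u (Suc m)"
      using x x' by (intro exI[of _ "x - xconst L * ?F"]) (simp add: u_def)
  qed
  have "u \<in> U_module R (interior D) (Fs (Suc 0))"
    unfolding U_module_def frob_iterate_Suc
  proof (intro CollectI conjI u_hat allI impI)
    fix s :: nat assume "1 \<le> s"
    let ?c = "cartier_iter R (interior D) (Fs (Suc 0)) s u"
    have c: "?c \<in> completion CARD('p) (Om (Suc s))"
      using cartier_iter_in_Omega_hat[OF u_hat] by (simp add: Omega_hat_def)
    obtain x where x: "x \<in> \<omega>\<^sub>1 s" using nonempty by blast
    obtain z where z: "z \<in> Om (Suc s)" "chain s s (x - xconst L * ?F) (?p ^ s * z)"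
      using Lchain[OF x] by blast
    have "x - xconst L * ?F \<in> u s"
      using x by (simp add: u_def)
    then have "?p ^ s * z \<in> ?c s"
      using z(2) by (rule chain_cartier_iter[OF u_hat])
    then have "?c s = ?p ^ s * z +o (?p ^ s *o Om (Suc s))"
      by (rule completion_coset(2)[OF Om_submodule is_subring_R c])
    moreover have "0 - ?p ^ s * z \<in> ?p ^ s *o Om (Suc s)"
    proof (rule submodule_diff[OF pOm_submodule is_subring_R submodule_zero[OF pOm_submodule]])
      show "?p ^ s * z \<in> ?p ^ s *o Om (Suc s)"
        using z(1) unfolding mem_elt_set_times by blast
    qed
    ultimately have "0 \<in> ?c s"
      by (simp only: mem_elt_set_plus)
    then show "?c \<in> compl_scale CARD('p) (Om (Suc s)) (?p ^ s) ` Omega_hat R (interior D) (Fs (Suc s))"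
      unfolding Omega_hat_def by (rule completion_divide_power[OF Om_submodule is_subring_R c])
  qed
  moreover have "\<omega>\<^sub>1 = compl_add (compl_scale CARD('p) ?M (xconst L) (compl_of CARD('p) ?M ?F)) u"
  proof
    fix m
    let ?N = "?p ^ m *o ?M"
    have "\<omega>\<^sub>1 m = (xconst L *o (?F +o ?N) + ?N) + u m"
    proof (intro equalityI subsetI)
      fix x assume x: "x \<in> \<omega>\<^sub>1 m"
      have zero: "0 \<in> ?N"
        by (rule submodule_zero[OF pOm_submodule])
      then have "xconst L * (?F + 0) \<in> xconst L *o (?F +o ?N)"
        unfolding elt_set_times_def elt_set_plus_def by blast
      then have "xconst L * (?F + 0) + 0 \<in> xconst L *o (?F +o ?N) + ?N"
        using zero by (rule set_plus_intro)
      moreover have "x - xconst L * ?F \<in> u m"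
        using x by (simp add: u_def)
      ultimately have "(xconst L * (?F + 0) + 0) + (x - xconst L * ?F) \<in> (xconst L *o (?F +o ?N) + ?N) + u m"
        by (rule set_plus_intro)
      then show "x \<in> (xconst L *o (?F +o ?N) + ?N) + u m" by simp
    next
      fix x assume "x \<in> (xconst L *o (?F +o ?N) + ?N) + u m"
      then obtain a b v where x: "x = xconst L * (?F + a) + b + v" "a \<in> ?N" "b \<in> ?N" "v \<in> u m"
        unfolding set_plus_def elt_set_plus_def elt_set_times_def[of "xconst L"] by blast
      have "v + xconst L * ?F \<in> \<omega>\<^sub>1 m"
        using x(4) by (simp add: u_def)
      moreover have "x - (v + xconst L * ?F) = xconst L * a + b"
        unfolding x(1) by (simp add: algebra_simps)
      moreover have "xconst L * a + b \<in> ?N"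
        using x LR by (intro submodule_add[OF pOm_submodule] submodule_scale[OF pOm_submodule])
      ultimately show "x \<in> \<omega>\<^sub>1 m"
        using coset[of "v + xconst L * ?F" m] by (simp add: mem_elt_set_plus)
    qed
    then show "\<omega>\<^sub>1 m = compl_add (compl_scale CARD('p) ?M (xconst L) (compl_of CARD('p) ?M ?F)) u m"
      by (simp add: compl_add_def compl_scale_def compl_of_def)
  qed
  ultimately show ?thesis
    unfolding is_cartier_matrix_iff L_def[symmetric] using LR by blast
qed

end

theorem corollary3p1:
  fixes g :: "('n::finite, 'p::prime_card) laurent"
  assumes interior_point: "{v. real_vec v \<in> interior (newton_polytope g)} = {0}"
    and cartier_exists_if_2: "CARD('p) = 2 \<Longrightarrow>
      \<forall>s. cartier_exists (coeff_ring g) (interior (newton_polytope g))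
        ((frob CARD('p) ^^ s) (f_of g))"
  shows "(\<exists>!\<Lambda>. is_cartier_matrix (coeff_ring g) (interior (newton_polytope g)) (f_of g) \<Lambda>) \<and>
    period_series g * finv (frob CARD('p) (period_series g)) =
      cartier_matrix (coeff_ring g) (interior (newton_polytope g)) (f_of g)"
proof -
  interpret one_interior_point g
    using assms by unfold_locales
  have unique: "L = q * finv q\<sigma>" if "is_cartier_matrix R (interior D) (f_of g) L" for L
  proof -
    have "q * finv q\<sigma> = L * (q\<sigma> * finv q\<sigma>)"
      using cartier_matrix_unique[OF that] by (simp flip: mult.assoc)
    then show ?thesis
      by (simp add: q\<sigma>_inverse)
  qed
  have "cartier_matrix R (interior D) (f_of g) = q * finv q\<sigma>"
    unfolding cartier_matrix_def using cartier_matrix_exists unique by (rule the_equality)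
  then show ?thesis
    using cartier_matrix_exists unique by metis
qed

end
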